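(* Let $N\in\mathbb{N}$, let $X_1,\dots,X_N,Y_1,\dots,Y_N$ be Polish spaces, $X=\prod_{t=1}^N X_t$, $Y=\prod_{t=1}^N Y_t$, $\mu\in\mathcal P(X)$ and $\nu\in\mathcal P(Y)$. If $\pi\in\mathrm{Cpl}_{bc}(\mu,\nu)$, then there exists a biadapted map $T:\widehat X\to\widehat Y$ such that (i) $T_\ast\widehat\mu=\widehat\nu$, and (ii) with $\widehat\pi:=(\mathrm{id},T)_\ast\widehat\mu$, one has $(\mathrm{pr}_{X\times Y})_\ast\widehat\pi=\pi$. Conversely, if $\pi\in\mathcal P(X\times Y)$ and there exists a biadapted map $T:\widehat X\to\widehat Y$ satisfying (i) and (ii), then $\pi\in\mathrm{Cpl}_{bc}(\mu,\nu)$.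
   Context: $\lambda$ is Lebesgue measure on $[0,1]$. Set $\widehat X_t:=X_t\times[0,1]$, $\widehat X:=\prod_{t=1}^N\widehat X_t$ (elements written $(x_{1:N},u_{1:N})$ with $x_t\in X_t,u_t\in[0,1]$), similarly $\widehat Y_t=Y_t\times[0,1]$, $\widehat Y=\prod_t\widehat Y_t$. $\widehat\mu:=\mu\otimes\lambda^N$ (i.e. $\int f\,d\widehat\mu=\int f(x_{1:N},u_{1:N})\,d\mu(x_{1:N})d\lambda^N(u_{1:N})$), similarly $\widehat\nu$. $\mathrm{pr}_{X\times Y}:\widehat X\times\widehat Y\to X\times Y$ forgets the $[0,1]$-coordinates. For products $A=\prod_{t=1}^N A_t$, $B=\prod_{t=1}^N B_t$ of Polish spaces, a Borel map $T=(T_1,\dots,T_N):A\to B$ ($T_t$ with values in $B_t$) is adapted if each $T_t(a)$ depends only on $(a_1,\dots,a_t)$; it is biadapted if it is bijective and both $T$ and $T^{-1}$ are adapted (for $\widehat X,\widehat Y$ the time-$t$ factors are $\widehat X_t,\widehat Y_t$). For $t<N$ let $\mathcal F^X_t$ (resp. $\mathcal F^Y_t$) be the $\sigma$-algebra on $X$ (resp. $Y$) generated by the first $t$ coordinates. $\pi\in\mathrm{Cpl}(\mu,\nu)$ with disintegration $\pi(dx,dy)=\mu(dx)\pi^x(dy)$ is causal if for all $t<N$ and $B\in\mathcal F^Y_t$ the map $x\mapsto\pi^x(B)$ is $\mathcal F^X_t$-measurable; bicausal if moreover the image of $\pi$ under $(x,y)\mapsto(y,x)$ is a causal coupling of $\nu$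 and $\mu$. $\mathrm{Cpl}_{bc}(\mu,\nu)$ is the set of bicausal couplings. *)

theory Defs
  imports "HOL-Probability.Probability"
begin

definition polish_top :: "'a topology \<Rightarrow> bool" where
  "polish_top X \<longleftrightarrow> completely_metrizable_space X \<and> separable_space X"

definition borel_top :: "'a topology \<Rightarrow> 'a measure" where
  "borel_top X = sigma (topspace X) {U. openin X U}"

definition lam01 :: "real measure" where
  "lam01 = restrict_space lborel {0..1}"

definition pathsp :: "nat \<Rightarrow> (nat \<Rightarrow> 'a measure) \<Rightarrow> (nat \<Rightarrow> 'a) measure" where
  "pathsp N M = PiM {1..N} M"

definition Xsp :: "nat \<Rightarrow> (nat \<Rightarrow> 'a topology) \<Rightarrow> (nat \<Rightarrow> 'a) measure" where
  "Xsp N TX = pathsp N (\<lambda>t. borel_top (TX t))"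

definition hatsp :: "nat \<Rightarrow> (nat \<Rightarrow> 'a topology) \<Rightarrow> (nat \<Rightarrow> 'a \<times> real) measure" where
  "hatsp N TX = pathsp N (\<lambda>t. borel_top (TX t) \<Otimes>\<^sub>M lam01)"

definition hatmeas :: "nat \<Rightarrow> (nat \<Rightarrow> 'a topology) \<Rightarrow> (nat \<Rightarrow> 'a) measure \<Rightarrow> (nat \<Rightarrow> 'a \<times> real) measure" where
  "hatmeas N TX \<mu> = distr (\<mu> \<Otimes>\<^sub>M PiM {1..N} (\<lambda>_. lam01)) (hatsp N TX)
      (\<lambda>(x, u). \<lambda>t\<in>{1..N}. (x t, u t))"

definition forget :: "nat \<Rightarrow> (nat \<Rightarrow> 'a \<times> real) \<Rightarrow> (nat \<Rightarrow> 'a)" where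
  "forget N a = (\<lambda>t\<in>{1..N}. fst (a t))"

definition adapted :: "nat \<Rightarrow> (nat \<Rightarrow> 'b) measure \<Rightarrow> (nat \<Rightarrow> 'd) measure
      \<Rightarrow> ((nat \<Rightarrow> 'b) \<Rightarrow> (nat \<Rightarrow> 'd)) \<Rightarrow> bool" where
  "adapted N A B T \<longleftrightarrow> T \<in> measurable A B \<and>
     (\<forall>a\<in>space A. \<forall>a'\<in>space A. \<forall>t\<in>{1..N}.
        (\<forall>s\<in>{1..t}. a s = a' s) \<longrightarrow> T a t = T a' t)"

definition biadapted :: "nat \<Rightarrow> (nat \<Rightarrow> 'b) measure \<Rightarrow> (nat \<Rightarrow> 'd) measure
      \<Rightarrow> ((nat \<Rightarrow> 'b) \<Rightarrow> (nat \<Rightarrow> 'd)) \<Rightarrow> bool" where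
  "biadapted N A B T \<longleftrightarrow> bij_betw T (space A) (space B) \<and> adapted N A B T \<and>
     (\<exists>S. (\<forall>a\<in>space A. S (T a) = a) \<and> (\<forall>b\<in>space B. T (S b) = b) \<and> adapted N B A S)"

definition filt :: "nat \<Rightarrow> nat \<Rightarrow> (nat \<Rightarrow> 'a measure) \<Rightarrow> (nat \<Rightarrow> 'a) measure" where
  "filt N t M = vimage_algebra (space (PiM {1..N} M)) (\<lambda>x. restrict x {1..t}) (PiM {1..t} M)"

definition Cpl :: "'x measure \<Rightarrow> 'y measure \<Rightarrow> 'x measure \<Rightarrow> 'y measure
      \<Rightarrow> ('x \<times> 'y) measure set" where
  "Cpl MX MY \<mu> \<nu> = {\<pi>. prob_space \<pi> \<and> sets \<pi> = sets (MX \<Otimes>\<^sub>M MY) \<and>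
      distr \<pi> MX fst = \<mu> \<and> distr \<pi> MY snd = \<nu>}"

definition causal :: "nat \<Rightarrow> (nat \<Rightarrow> 'a measure) \<Rightarrow> (nat \<Rightarrow> 'b measure)
      \<Rightarrow> (nat \<Rightarrow> 'a) measure \<Rightarrow> (nat \<Rightarrow> 'b) measure \<Rightarrow> ((nat \<Rightarrow> 'a) \<times> (nat \<Rightarrow> 'b)) measure \<Rightarrow> bool" where
  "causal N MX MY \<mu> \<nu> \<pi> \<longleftrightarrow>
     \<pi> \<in> Cpl (PiM {1..N} MX) (PiM {1..N} MY) \<mu> \<nu> \<and>
     (\<exists>\<kappa>. \<kappa> \<in> measurable (PiM {1..N} MX) (prob_algebra (PiM {1..N} MY)) \<and>
        \<pi> = bind \<mu> (\<lambda>x. distr (\<kappa> x) (PiM {1..N} MX \<Otimes>\<^sub>M PiM {1..N} MY) (\<lambda>y. (x, y))) \<and>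
        (\<forall>t\<in>{1..<N}. \<forall>B\<in>sets (filt N t MY).
           (\<lambda>x. measure (\<kappa> x) B) \<in> borel_measurable (filt N t MX)))"

definition Cpl_bc :: "nat \<Rightarrow> (nat \<Rightarrow> 'a measure) \<Rightarrow> (nat \<Rightarrow> 'b measure)
      \<Rightarrow> (nat \<Rightarrow> 'a) measure \<Rightarrow> (nat \<Rightarrow> 'b) measure \<Rightarrow> ((nat \<Rightarrow> 'a) \<times> (nat \<Rightarrow> 'b)) measure set" where
  "Cpl_bc N MX MY \<mu> \<nu> = {\<pi>. causal N MX MY \<mu> \<nu> \<pi> \<and>
     causal N MY MX \<nu> \<mu> (distr \<pi> (PiM {1..N} MY \<Otimes>\<^sub>M PiM {1..N} MX) (\<lambda>(x, y). (y, x)))}"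

end

theory Submission
  imports Defs
begin

text \<open>
  Work forward in time. Given the pasts of both processes, the conditional law of the next pair of
  coordinates under a bicausal coupling couples the conditional laws of the two processes given their own
  pasts. Conditional laws are represented by measurable functions of the past and an independent uniform
  variable. Since the product of any law with the uniform law is atomless, distribution functions
  identify both \<open>X\<^sub>t \<times> [0,1]\<close> and \<open>Y\<^sub>t \<times> [0,1]\<close> modulo null sets with \<open>X\<^sub>t \<times> Y\<^sub>t \<times> [0,1]\<close> carrying the
  conditional coupling times the uniform law, measurably in the past. Composing the two identifications
  gives the transport map outside a null set; an exact bijection results from a Cantor--Schroeder--Bernstein
  argument on the exceptional sets, which have been enlarged by an uncountable null set into which every
  standard Borel space embeds.

  Conversely, pushing the auxiliary uniform variables through an adapted map gives a kernel
  whose first \<open>t\<close> coordinates depend only on the first \<open>t\<close> coordinates of the argument.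
\<close>

section \<open>Standard Borel spaces as retracts of a null set\<close>

text \<open>A biadapted map is bijective at every point, while a coupling only determines laws. Each
  step must therefore be exactly invertible for every pair of pasts, including the null set of pasts
  where the conditional laws fail to match. The repair is carried out fibrewise and jointly
  measurably, and only statements about laws are confined to almost every past. The room for it
  comes from the uniform coordinate: the points whose uniform coordinate lies in a fixed null set of
  Cantor type form a null set whatever the law of the other coordinate, yet a single copy of that
  set receives any standard Borel space. Accordingly a standard Borel space is given by a measurable
  code and a measurable decoder; images under codes are recognised by an equation, which keeps them
  measurable. Bicausality enters in one place: given both pasts, the next coordinate of either
  process has a law depending on its own past alone. On the target side the new pair then consists
  of the right conditional law and an independent uniform variable, which is why the image measure
  is again a product with uniform laws.\<close>

definition cantor_space :: "(nat \<Rightarrow> bool) measure" where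
  "cantor_space = PiM UNIV (\<lambda>_. count_space UNIV)"

text \<open>Only the digits 0 and 1 occur, so the tail contributes at most half a unit of the
  leading place: the leading digit is read off by comparison with 1/3, and expansions are unique.
  The range is the middle-thirds Cantor set scaled by 1/2.\<close>

definition ternary :: "(nat \<Rightarrow> bool) \<Rightarrow> real" where
  "ternary b = (\<Sum>k. of_bool (b k) / 3 ^ Suc k)"

definition ternary_shift :: "real \<Rightarrow> real" where
  "ternary_shift r = 3 * r - of_bool (1 / 3 \<le> r)"

definition ternary_digits :: "real \<Rightarrow> nat \<Rightarrow> bool" where
  "ternary_digits r k \<longleftrightarrow> 1 / 3 \<le> (ternary_shift ^^ k) r"

text \<open>This is the range of \<open>ternary\<close>. The description by a fixed-point equation
  makes it a Borel set at once.\<close>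

definition thin_set :: "real set" where
  "thin_set = {r. ternary (ternary_digits r) = r}"

lemma sums_ternary_geometric: "(\<lambda>k. 1 / 3 ^ Suc k :: real) sums (1 / 2)"
  using sums_mult[OF geometric_sums[of "1/3::real"], of "1/3"]
  by (simp add: power_one_over)

lemma summable_ternary: "summable (\<lambda>k. of_bool (b k) / 3 ^ Suc k :: real)"
  by (rule summable_comparison_test'[OF sums_summable[OF sums_ternary_geometric], of 0]) simp

lemma ternary_nonneg: "0 \<le> ternary b"
  unfolding ternary_def by (rule suminf_nonneg[OF summable_ternary]) simp

lemma ternary_le_half: "ternary b \<le> 1 / 2"
  unfolding ternary_def sums_unique[OF sums_ternary_geometric]
  by (rule suminf_le[OF _ summable_ternary sums_summable[OF sums_ternary_geometric]])
     (simp add: divide_right_mono)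

lemma ternary_split: "ternary b = (of_bool (b 0) + ternary (\<lambda>k. b (Suc k))) / 3"
proof -
  have "ternary (\<lambda>k. b (Suc k)) / 3 = (\<Sum>k. of_bool (b (Suc k)) / 3 ^ Suc (Suc k))"
    unfolding ternary_def
    by (subst suminf_divide[OF summable_ternary[of "\<lambda>k. b (Suc k)"], symmetric]) (simp add: mult.commute)
  also have "\<dots> = ternary b - of_bool (b 0) / 3"
    unfolding ternary_def using suminf_split_initial_segment[OF summable_ternary[of b], of 1] by simp
  finally show ?thesis by (simp add: field_simps)
qed

lemma third_le_ternary_iff: "1 / 3 \<le> ternary b \<longleftrightarrow> b 0"
  using ternary_split[of b] ternary_nonneg[of "\<lambda>k. b (Suc k)"] ternary_le_half[of "\<lambda>k. b (Suc k)"]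
  by (cases "b 0") auto

lemma ternary_shift_ternary: "ternary_shift (ternary b) = ternary (\<lambda>k. b (Suc k))"
  unfolding ternary_shift_def third_le_ternary_iff by (subst ternary_split) (auto simp: add_divide_distrib)

lemma ternary_digits_ternary: "ternary_digits (ternary b) = b"
proof -
  have "(ternary_shift ^^ k) (ternary b) = ternary (\<lambda>j. b (j + k))" for k
    by (induction k arbitrary: b) (simp_all add: funpow_swap1 ternary_shift_ternary)
  then show ?thesis
    unfolding ternary_digits_def fun_eq_iff by (simp only: third_le_ternary_iff) simp
qed

lemma ternary_in_thin_set: "ternary b \<in> thin_set"
  by (simp add: thin_set_def ternary_digits_ternary)

lemma thin_set_subset: "thin_set \<subseteq> {0..<1}"
proof
  fix r assume "r \<in> thin_set"
  then show "r \<in> {0..<1}"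
    using ternary_nonneg[of "ternary_digits r"] ternary_le_half[of "ternary_digits r"] by (simp add: thin_set_def)
qed

lemma measurable_cantor_component[measurable]:
  "(\<lambda>b. b k) \<in> cantor_space \<rightarrow>\<^sub>M count_space UNIV"
  unfolding cantor_space_def by measurable

lemma measurable_ternary[measurable]: "ternary \<in> borel_measurable cantor_space"
  unfolding ternary_def of_bool_def by measurable

lemma measurable_ternary_shift[measurable]: "ternary_shift \<in> borel_measurable borel"
  unfolding ternary_shift_def of_bool_def by measurable

lemma measurable_to_cantor_space:
  assumes "\<And>k. (\<lambda>x. f x k) \<in> M \<rightarrow>\<^sub>M count_space UNIV"
  shows "f \<in> M \<rightarrow>\<^sub>M cantor_space"
  unfolding cantor_space_def by (rule measurable_PiM_single') (use assms in \<open>auto simp: space_PiM\<close>)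

lemma measurable_ternary_digits[measurable]: "ternary_digits \<in> borel \<rightarrow>\<^sub>M cantor_space"
proof (rule measurable_to_cantor_space)
  fix k
  have [measurable]: "(\<lambda>r. (ternary_shift ^^ k) r) \<in> borel_measurable borel"
    by (induction k) simp_all
  show "(\<lambda>r. ternary_digits r k) \<in> borel \<rightarrow>\<^sub>M count_space UNIV"
    unfolding ternary_digits_def by measurable
qed

lemma sets_thin_set[measurable]: "thin_set \<in> sets borel"
  unfolding thin_set_def by measurable

text \<open>The thin set is contained in the union of two copies of itself scaled by one third, so its
  (finite) measure is at most two thirds of itself.\<close>

lemma emeasure_thin_set: "emeasure lborel thin_set = 0"
proof -
  define m where "m = emeasure lborel thin_set"
  have scale: "m = 3 * emeasure lborel {x. t + 3 * x \<in> thin_set}" for t :: real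
    unfolding m_def
    by (subst lborel_real_affine[of 3 t])
       (simp_all add: emeasure_density nn_integral_cmult emeasure_distr vimage_def)
  have "m \<le> emeasure lborel {0..<1::real}"
    unfolding m_def by (intro emeasure_mono thin_set_subset) simp
  then have fin: "m \<le> 1" by simp
  \<comment> \<open>Removing the leading digit from \<open>r\<close> means passing to
    \<open>3 * r\<close> or \<open>3 * r - 1\<close>, whence the shifts 0 and -1.\<close>
  have "thin_set \<subseteq> {x. 0 + 3 * x \<in> thin_set} \<union> {x. -1 + 3 * x \<in> thin_set}"
  proof
    fix r assume "r \<in> thin_set"
    then have "r = ternary (ternary_digits r)" by (simp add: thin_set_def)
    then obtain b where "r = ternary b" ..
    then have "3 * r - of_bool (b 0) = ternary (\<lambda>k. b (Suc k))" using ternary_split[of b] by simp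
    then show "r \<in> {x. 0 + 3 * x \<in> thin_set} \<union> {x. -1 + 3 * x \<in> thin_set}"
      using ternary_in_thin_set[of "\<lambda>k. b (Suc k)"] by (cases "b 0") auto
  qed
  then have "m \<le> emeasure lborel {x. 0 + 3 * x \<in> thin_set} + emeasure lborel {x. -1 + 3 * x \<in> thin_set}"
    unfolding m_def by (intro order_trans[OF emeasure_mono emeasure_subadditive]) measurable
  then have "3 * m \<le> 3 * emeasure lborel {x. 0 + 3 * x \<in> thin_set} + 3 * emeasure lborel {x. -1 + 3 * x \<in> thin_set}"
    by (metis distrib_left mult_left_mono zero_le)
  then have "3 * m \<le> m + m" by (simp only: scale[symmetric])
  \<comment> \<open>The inequality \<open>3 * m \<le> m + m\<close> forces \<open>m = 0\<close>
    because \<open>m\<close> is finite.\<close>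
  moreover obtain x where "0 \<le> x" "m = ennreal x"
    using fin by (cases m) (auto simp: top_unique)
  ultimately show ?thesis
    unfolding m_def[symmetric] by (simp add: ennreal_plus[symmetric] ennreal_mult'[symmetric] ennreal_numeral[symmetric] del: ennreal_plus ennreal_numeral)
qed

text \<open>A space is presented as a measurable retract: \<open>e\<close> codes points by reals in
  the null set, \<open>d\<close> decodes. Since \<open>d\<close> is total on the reals with values
  in \<open>space M\<close>, the space is nonempty. Codes inside \<open>thin_set\<close> later allow
  every such space to be placed in a null set of uniform values.\<close>

definition std_borel :: "'a measure \<Rightarrow> bool" where
  "std_borel M \<longleftrightarrow> (\<exists>e d. e \<in> borel_measurable M \<and> d \<in> borel \<rightarrow>\<^sub>M M \<and>
     (\<forall>x\<in>space M. e x \<in> thin_set \<and> d (e x) = x))"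

lemma std_borelE:
  assumes "std_borel M"
  obtains e d where "e \<in> borel_measurable M" "d \<in> borel \<rightarrow>\<^sub>M M"
    "\<And>x. x \<in> space M \<Longrightarrow> e x \<in> thin_set" "\<And>x. x \<in> space M \<Longrightarrow> d (e x) = x"
  using assms unfolding std_borel_def by blast

lemma std_borelI_cantor:
  assumes [measurable]: "e \<in> M \<rightarrow>\<^sub>M cantor_space" "d \<in> cantor_space \<rightarrow>\<^sub>M M"
    and "\<And>x. x \<in> space M \<Longrightarrow> d (e x) = x"
  shows "std_borel M"
  unfolding std_borel_def
proof (intro exI conjI)
  show "(\<lambda>x. ternary (e x)) \<in> borel_measurable M" by measurable
  show "(\<lambda>r. d (ternary_digits r)) \<in> borel \<rightarrow>\<^sub>M M" by measurable
  show "\<forall>x\<in>space M. ternary (e x) \<in> thin_set \<and> d (ternary_digits (ternary (e x))) = x"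
    using assms by (simp add: ternary_digits_ternary ternary_in_thin_set)
qed

lemma std_borelE_cantor:
  assumes "std_borel M"
  obtains e d where "e \<in> M \<rightarrow>\<^sub>M cantor_space" "d \<in> cantor_space \<rightarrow>\<^sub>M M"
    "\<And>x. x \<in> space M \<Longrightarrow> d (e x) = x"
proof -
  obtain e d where [measurable]: "e \<in> borel_measurable M" "d \<in> borel \<rightarrow>\<^sub>M M"
    and ed: "\<And>x. x \<in> space M \<Longrightarrow> e x \<in> thin_set" "\<And>x. x \<in> space M \<Longrightarrow> d (e x) = x"
    by (rule std_borelE[OF assms]) (rule that)
  show thesis
  proof
    show "(\<lambda>x. ternary_digits (e x)) \<in> M \<rightarrow>\<^sub>M cantor_space" by measurable
    show "(\<lambda>b. d (ternary b)) \<in> cantor_space \<rightarrow>\<^sub>M M" by measurable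
    show "d (ternary (ternary_digits (e x))) = x" if "x \<in> space M" for x
      using ed[OF that] by (simp add: thin_set_def)
  qed
qed

text \<open>Two bit sequences are interleaved at even and odd positions, so a pair is again coded by
  one sequence.\<close>

lemma std_borel_pair:
  assumes "std_borel M" "std_borel N"
  shows "std_borel (M \<Otimes>\<^sub>M N)"
proof -
  obtain e d where [measurable]: "e \<in> M \<rightarrow>\<^sub>M cantor_space" "d \<in> cantor_space \<rightarrow>\<^sub>M M"
    and ed: "\<And>x. x \<in> space M \<Longrightarrow> d (e x) = x" by (rule std_borelE_cantor[OF assms(1)]) (rule that)
  obtain e' d' where [measurable]: "e' \<in> N \<rightarrow>\<^sub>M cantor_space" "d' \<in> cantor_space \<rightarrow>\<^sub>M N"
    and ed': "\<And>x. x \<in> space N \<Longrightarrow> d' (e' x) = x" by (rule std_borelE_cantor[OF assms(2)]) (rule that)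
  define mix :: "(nat \<Rightarrow> bool) \<times> (nat \<Rightarrow> bool) \<Rightarrow> nat \<Rightarrow> bool"
    where "mix p k = (if even k then fst p (k div 2) else snd p (k div 2))" for p k
  have [measurable]: "mix \<in> cantor_space \<Otimes>\<^sub>M cantor_space \<rightarrow>\<^sub>M cantor_space"
    by (rule measurable_to_cantor_space) (simp add: mix_def)
  have [measurable]: "(\<lambda>b k. b (2 * k)) \<in> cantor_space \<rightarrow>\<^sub>M cantor_space"
    "(\<lambda>b k. b (Suc (2 * k))) \<in> cantor_space \<rightarrow>\<^sub>M cantor_space"
    by (auto intro!: measurable_to_cantor_space)
  show ?thesis
  proof (rule std_borelI_cantor)
    show "(\<lambda>(x, y). mix (e x, e' y)) \<in> M \<Otimes>\<^sub>M N \<rightarrow>\<^sub>M cantor_space" by measurable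
    show "(\<lambda>b. (d (\<lambda>k. b (2 * k)), d' (\<lambda>k. b (Suc (2 * k))))) \<in> cantor_space \<rightarrow>\<^sub>M M \<Otimes>\<^sub>M N"
      by measurable
  qed (auto simp: space_pair_measure mix_def ed ed')
qed

lemma measurable_borel_top_ball:
  assumes "Metric_space S d" "a \<in> S"
  shows "d a \<in> borel_measurable (borel_top (Metric_space.mtopology S d))"
proof (rule borel_measurable_iff_less[THEN iffD2], rule allI)
  interpret Metric_space S d by fact
  fix q
  have "{x \<in> space (borel_top mtopology). d a x < q} = mball a q"
    using assms(2) by (auto simp: borel_top_def space_measure_of_conv)
  also have "\<dots> \<in> sets (borel_top mtopology)"
    unfolding borel_top_def using openin_subset[of mtopology] by (intro in_measure_of) auto
  finally show "{x \<in> space (borel_top mtopology). d a x < q} \<in> sets (borel_top mtopology)" .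
qed

text \<open>A point is coded by the indices of points of a dense sequence approximating it, and
  decoded by taking a limit.\<close>

lemma std_borel_polish:
  assumes "polish_top X" "topspace X \<noteq> {}"
  shows "std_borel (borel_top X)"
proof -
  obtain S d where "Metric_space S d" and mc: "Metric_space.mcomplete S d"
    and X: "X = Metric_space.mtopology S d"
    using assms(1) unfolding polish_top_def completely_metrizable_space_def by blast
  interpret Metric_space S d by fact
  obtain C where C: "countable C" "C \<subseteq> S" "mtopology closure_of C = S"
    using assms(1) unfolding polish_top_def separable_space_def X by auto
  with assms(2) have "C \<noteq> {}" by (auto simp: X)
  define z where "z = from_nat_into C"
  have rz: "range z = C" unfolding z_def using C \<open>C \<noteq> {}\<close> by (simp add: range_from_nat_into)
  have zS[simp]: "z m \<in> S" for m using rz C(2) by auto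
  have dense: "\<exists>m. d (z m) x < e" if "x \<in> S" "0 < e" for x e
  proof -
    have "x \<in> mtopology closure_of C" using that C(3) by simp
    then have "\<exists>y\<in>C. y \<in> mball x e" using that by (auto simp: metric_closure_of)
    then show ?thesis using rz commute by (metis in_mball rangeE)
  qed
  let ?B = "borel_top mtopology"
  have spB: "space ?B = S" by (simp add: borel_top_def space_measure_of_conv)
  have [measurable]: "d (z m) \<in> borel_measurable ?B" for m
    by (rule measurable_borel_top_ball) (auto intro: \<open>Metric_space S d\<close>)
  \<comment> \<open>Bit \<open>(i, m)\<close> records whether \<open>z m\<close> lies within
    \<open>1 / (i + 1)\<close> of \<open>x\<close>.\<close>
  define enc where "enc x k = (case prod_decode k of (i, m) \<Rightarrow> d (z m) x < inverse (real (Suc i)))" for x k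
  have enc[measurable]: "enc \<in> ?B \<rightarrow>\<^sub>M cantor_space"
    by (rule measurable_to_cantor_space) (simp add: enc_def split: prod.split)
  \<comment> \<open>The first dense point recorded at accuracy \<open>i\<close>. For arbitrary bits
    this index may be meaningless; \<open>cau\<close> filters out the sequences that fail to
    converge.\<close>
  define idx where "idx b i = (LEAST m. b (prod_encode (i, m)))" for b :: "nat \<Rightarrow> bool" and i
  have [measurable]: "(\<lambda>b. idx b i) \<in> cantor_space \<rightarrow>\<^sub>M count_space UNIV" for i
    unfolding idx_def by measurable
  have [measurable]: "(\<lambda>b. d (z m) (z (idx b i))) \<in> borel_measurable cantor_space" for m i
    by (rule measurable_compose[where f="\<lambda>b. idx b i" and N="count_space UNIV"]) simp_all
  \<comment> \<open>Accuracies are taken from the countable set of all \<open>1 / (j + 1)\<close>,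
    so the Cauchy property is a measurable condition on the bits.\<close>
  define cau where "cau b \<longleftrightarrow> (\<forall>j. \<exists>n. \<forall>i\<ge>n. \<forall>i'\<ge>n. d (z (idx b i)) (z (idx b i')) < inverse (real (Suc j)))" for b
  have [measurable]: "Measurable.pred cantor_space cau"
    unfolding cau_def by measurable
  have cau_iff: "cau b \<longleftrightarrow> MCauchy (\<lambda>i. z (idx b i))" for b
  proof
    assume "MCauchy (\<lambda>i. z (idx b i))"
    then show "cau b" unfolding cau_def MCauchy_def by (metis inverse_positive_iff_positive of_nat_0_less_iff zero_less_Suc)
  next
    assume c: "cau b"
    show "MCauchy (\<lambda>i. z (idx b i))" unfolding MCauchy_def
    proof (intro conjI allI impI)
      fix \<epsilon> :: real assume "0 < \<epsilon>"
      then obtain j where "inverse (real (Suc j)) < \<epsilon>" using reals_Archimedean by blast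
      with c show "\<exists>N. \<forall>n n'. N \<le> n \<longrightarrow> N \<le> n' \<longrightarrow> d (z (idx b n)) (z (idx b n')) < \<epsilon>"
        unfolding cau_def by (meson order_less_trans)
    qed auto
  qed
  have "\<exists>x. x \<in> S \<and> (if cau b then limitin mtopology (\<lambda>i. z (idx b i)) x sequentially else x = z 0)" for b
    using mc cau_iff[of b] zS[of 0] unfolding mcomplete_def by (metis limitin_mspace)
  then obtain dec where dec: "\<And>b. dec b \<in> S"
    "\<And>b. cau b \<Longrightarrow> limitin mtopology (\<lambda>i. z (idx b i)) (dec b) sequentially"
    "\<And>b. \<not> cau b \<Longrightarrow> dec b = z 0"
    by metis
  \<comment> \<open>The decoder is obtained by choice. It is measurable because its distance to each
    dense point is a pointwise limit of measurable functions, and open sets are countable unions of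
    balls around dense points.\<close>
  have dlim: "(\<lambda>i. d (z m) (z (idx b i))) \<longlonglongrightarrow> d (z m) (dec b)" if "cau b" for m b
  proof -
    have lim0: "(\<lambda>i. d (z (idx b i)) (dec b)) \<longlonglongrightarrow> 0"
      using dec(2)[OF that] by (simp add: limitin_metric_dist_null)
    have le: "\<bar>d (z m) (z (idx b i)) - d (z m) (dec b)\<bar> \<le> d (z (idx b i)) (dec b)" for i
      using triangle[of "z m" "z (idx b i)" "dec b"] triangle[of "z m" "dec b" "z (idx b i)"] commute[of "dec b"] dec(1)
      by (simp add: abs_le_iff)
    have "(\<lambda>i. d (z m) (z (idx b i)) - d (z m) (dec b)) \<longlonglongrightarrow> 0"
      by (rule Lim_null_comparison[OF _ lim0]) (use le in \<open>simp add: always_eventually\<close>)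
    then show ?thesis by (rule LIM_zero_cancel)
  qed
  have dm[measurable]: "(\<lambda>b. d (z m) (dec b)) \<in> borel_measurable cantor_space" for m
  proof -
    have "(\<lambda>b. d (z m) (dec b)) = (\<lambda>b. if cau b then lim (\<lambda>i. d (z m) (z (idx b i))) else d (z m) (z 0))"
      using dlim[THEN limI] dec(3) by auto
    also have "\<dots> \<in> borel_measurable cantor_space" by measurable
    finally show ?thesis .
  qed
  have dec_meas: "dec \<in> cantor_space \<rightarrow>\<^sub>M ?B"
    unfolding borel_top_def
  proof (rule measurable_measure_of)
    fix U assume "U \<in> {U. openin mtopology U}"
    then have U: "openin mtopology U" by simp
    define G where "G = {(m, j). mball (z m) (inverse (real (Suc j))) \<subseteq> U}"
    have "x \<in> U \<longleftrightarrow> (\<exists>m j. (m, j) \<in> G \<and> d (z m) x < inverse (real (Suc j)))" if x: "x \<in> S" for x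
    proof
      assume "x \<in> U"
      then obtain r where r: "0 < r" "mball x r \<subseteq> U" using U openin_mtopology by blast
      \<comment> \<open>Half the radius: a ball around \<open>z m\<close> of radius below
        \<open>r / 2\<close> that contains \<open>x\<close> stays inside
        \<open>mball x r\<close>.\<close>
      then obtain j where j: "inverse (real (Suc j)) < r / 2" using reals_Archimedean[of "r/2"] by auto
      obtain m where m: "d (z m) x < inverse (real (Suc j))" using dense[OF x, of "inverse (real (Suc j))"] by auto
      have "mball (z m) (inverse (real (Suc j))) \<subseteq> mball x r"
      proof
        fix y assume y: "y \<in> mball (z m) (inverse (real (Suc j)))"
        then show "y \<in> mball x r" using triangle[of x "z m" y] m j commute[of x] x by auto
      qed
      then show "\<exists>m j. (m, j) \<in> G \<and> d (z m) x < inverse (real (Suc j))"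
        using m r(2) unfolding G_def by blast
    next
      assume "\<exists>m j. (m, j) \<in> G \<and> d (z m) x < inverse (real (Suc j))"
      then show "x \<in> U" unfolding G_def using x by force
    qed
    then have "dec -` U \<inter> space cantor_space =
      {b \<in> space cantor_space. \<exists>m j. (m, j) \<in> G \<and> d (z m) (dec b) < inverse (real (Suc j))}"
      using dec(1) by auto
    also have "\<dots> \<in> sets cantor_space" by measurable
    finally show "dec -` U \<inter> space cantor_space \<in> sets cantor_space" .
  qed (use dec(1) openin_subset[of mtopology] in auto)
  have "dec (enc x) = x" if x: "x \<in> S" for x
  proof -
    have "d (z (idx (enc x) i)) x < inverse (real (Suc i))" for i
    proof -
      obtain m where "enc x (prod_encode (i, m))" using dense[OF x, of "inverse (real (Suc i))"] by (auto simp: enc_def)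
      then have "enc x (prod_encode (i, idx (enc x) i))" unfolding idx_def by (rule LeastI)
      then show ?thesis by (simp add: enc_def)
    qed
    then have "(\<lambda>i. d (z (idx (enc x) i)) x) \<longlonglongrightarrow> 0"
      by (intro Lim_null_comparison[OF _ LIMSEQ_inverse_real_of_nat]) (auto intro!: always_eventually less_imp_le)
    then have L: "limitin mtopology (\<lambda>i. z (idx (enc x) i)) x sequentially"
      using x by (simp add: limitin_metric_dist_null)
    then have "cau (enc x)" unfolding cau_iff by (intro convergent_imp_MCauchy[OF _ L]) auto
    from dec(2)[OF this] L show ?thesis
      using limitin_metric_unique trivial_limit_sequentially by blast
  qed
  then show ?thesis unfolding X by (intro std_borelI_cantor[OF enc dec_meas]) (simp add: spB)
qed

lemma borel_top_euclidean: "borel_top euclidean = borel"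
  unfolding borel_top_def borel_def by simp

section \<open>The uniform law on the unit interval\<close>

lemma space_lam01[simp]: "space lam01 = {0..1}"
  by (simp add: lam01_def)

lemma sets_lam01: "sets lam01 = sets (restrict_space borel {0..1})"
  unfolding lam01_def by (rule sets_restrict_space_cong) simp

lemma measurable_to_lam01:
  assumes "f \<in> borel_measurable M" "\<And>x. x \<in> space M \<Longrightarrow> f x \<in> {0..1}"
  shows "f \<in> M \<rightarrow>\<^sub>M lam01"
  unfolding measurable_cong_sets[OF refl sets_lam01]
  using assms by (intro measurable_restrict_space2) auto

lemma measurable_from_lam01: "f \<in> borel_measurable borel \<Longrightarrow> f \<in> borel_measurable lam01"
  unfolding measurable_cong_sets[OF sets_lam01 refl] by (rule measurable_restrict_space1)

lemma measurable_ident_lam01[measurable]: "(\<lambda>x. x) \<in> borel_measurable lam01"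
  by (rule measurable_from_lam01) simp

lemma prob_space_lam01: "prob_space lam01"
  by standard (simp add: lam01_def emeasure_restrict_space)

lemma std_borel_lam01: "std_borel lam01"
proof -
  have "polish_top (euclidean :: real topology)"
    unfolding polish_top_def separable_space_def
    using countable_rat Rats_closure_real by (auto simp: completely_metrizable_space_euclidean)
  then have "std_borel (borel :: real measure)"
    using std_borel_polish[of "euclidean :: real topology"] by (simp add: borel_top_euclidean)
  then obtain e d :: "real \<Rightarrow> real" where [measurable]: "e \<in> borel_measurable borel" "d \<in> borel_measurable borel"
    and ed: "\<And>x. e x \<in> thin_set" "\<And>x. d (e x) = x"
    by (rule std_borelE) auto
  show ?thesis unfolding std_borel_def
  proof (intro exI conjI)
    show "e \<in> borel_measurable lam01" by (rule measurable_from_lam01) measurable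
    \<comment> \<open>The decoder of the real line may leave the unit interval, so its values are
      clamped; codes of points of the interval are unaffected.\<close>
    show "(\<lambda>r. max 0 (min 1 (d r))) \<in> borel \<rightarrow>\<^sub>M lam01" by (rule measurable_to_lam01) auto
  qed (use ed in auto)
qed

lemma AE_lam01_not_thin: "AE u in lam01. u \<notin> thin_set"
proof -
  have "AE u in lborel. u \<notin> thin_set"
    using emeasure_thin_set by (intro AE_I[of _ _ thin_set]) auto
  then show ?thesis unfolding lam01_def by (subst AE_restrict_space_iff) auto
qed

lemma emeasure_lam01_singleton: "emeasure lam01 {u} = 0"
proof (cases "u \<in> {0..1}")
  case True then show ?thesis by (simp add: lam01_def emeasure_restrict_space)
next
  case False
  then have "{u} \<notin> sets lam01" using sets.sets_into_space[of "{u}" lam01] by auto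
  then show ?thesis by (rule emeasure_notin_sets)
qed

text \<open>Equality can be tested on real codes, since the code is injective; thus exceptional sets
  defined by equations are measurable.\<close>

lemma measurable_pred_eq_std_borel:
  assumes "std_borel A" and [measurable]: "f \<in> M \<rightarrow>\<^sub>M A" "g \<in> M \<rightarrow>\<^sub>M A"
  shows "Measurable.pred M (\<lambda>x. f x = g x)"
proof -
  obtain e :: "_ \<Rightarrow> real" and d where [measurable]: "e \<in> borel_measurable A" "d \<in> borel \<rightarrow>\<^sub>M A"
    and ed: "\<And>x. x \<in> space A \<Longrightarrow> d (e x) = x"
    using assms(1) unfolding std_borel_def by blast
  have "Measurable.pred M (\<lambda>x. f x = g x) \<longleftrightarrow> Measurable.pred M (\<lambda>x. e (f x) = e (g x))"
    by (rule measurable_cong) (metis ed assms(2,3) measurable_space)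
  also have "\<dots>" by measurable
  finally show ?thesis .
qed

section \<open>Quantile functions and disintegration\<close>

abbreviation lam01_sq :: "(real \<times> real) measure" where
  "lam01_sq \<equiv> lam01 \<Otimes>\<^sub>M lam01"

section \<open>Measures determined by countably many thresholds\<close>

lemma rational_incseq_below:
  fixes x :: real
  obtains r where "incseq r" "\<And>n. r n \<in> \<rat>" "\<And>n. r n < x" "r \<longlonglongrightarrow> x"
proof
  \<comment> \<open>The largest dyadic of order \<open>n\<close> strictly below \<open>x\<close>.
    Subtracting 1 from the ceiling keeps the inequality strict even when \<open>x\<close> itself is
    dyadic.\<close>
  define r :: "nat \<Rightarrow> real" where "r n = (of_int \<lceil>x * 2 ^ n\<rceil> - 1) / 2 ^ n" for n
  show "incseq r"
  proof (rule incseq_SucI)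
    fix n
    have "2 * of_int \<lceil>x * 2 ^ n\<rceil> - 1 \<le> (of_int \<lceil>x * 2 ^ Suc n\<rceil> :: real)"
    proof -
      have "2 * \<lceil>x * 2 ^ n\<rceil> - 2 < \<lceil>x * 2 ^ Suc n\<rceil>"
        by (subst less_ceiling_iff) (use ceiling_correct[of "x * 2 ^ n"] in simp)
      then show ?thesis by linarith
    qed
    then have "2 * (of_int \<lceil>x * 2 ^ n\<rceil> - 1) / 2 ^ Suc n \<le> (of_int \<lceil>x * 2 ^ Suc n\<rceil> - 1 :: real) / 2 ^ Suc n"
      by (intro divide_right_mono) simp_all
    moreover have "r n = 2 * (of_int \<lceil>x * 2 ^ n\<rceil> - 1) / 2 ^ Suc n" by (simp add: r_def field_simps)
    ultimately show "r n \<le> r (Suc n)" by (simp add: r_def)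
  qed
  show "r n \<in> \<rat>" for n unfolding r_def by simp
  show less: "r n < x" for n
    using ceiling_correct[of "x * 2 ^ n"] by (simp add: r_def pos_divide_less_eq)
  have lower: "x - (1 / 2) ^ n \<le> r n" for n
    using ceiling_correct[of "x * 2 ^ n"] by (simp add: r_def field_simps)
  have lim: "(\<lambda>n. x - (1 / 2) ^ n) \<longlonglongrightarrow> x"
    by (auto intro!: tendsto_eq_intros LIMSEQ_power_zero)
  show "r \<longlonglongrightarrow> x"
    by (rule tendsto_sandwich[OF _ _ lim tendsto_const])
       (auto intro!: always_eventually lower less_imp_le[OF less])
qed

lemma incseq_below_covers:
  fixes x :: real
  assumes "r \<longlonglongrightarrow> x" "y < x"
  shows "\<exists>n. y < r n"
  using order_tendstoD(1)[OF assms] by (auto simp: eventually_sequentially)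

text \<open>Thresholds are rational because equalities of conditional laws are known only almost
  everywhere for each threshold, and countably many null sets may be discarded together. Strict
  half-lines pass to real thresholds by increasing unions.\<close>

lemma real_measure_eqI_rat:
  fixes M N :: "real measure"
  assumes "finite_measure M" "finite_measure N" and [measurable_cong]: "sets M = sets borel" "sets N = sets borel"
    and eq: "\<And>r. r \<in> \<rat> \<Longrightarrow> emeasure M {..<r} = emeasure N {..<r}"
  shows "M = N"
proof (rule measure_eqI_generator_eq[of "range lessThan" UNIV _ _ "\<lambda>n. {..<real n}"])
  interpret M: finite_measure M by fact
  interpret N: finite_measure N by fact
  show "Int_stable (range lessThan :: real set set)"
  proof (clarsimp simp: Int_stable_def)
    fix a b :: real
    have "{..<a} \<inter> {..<b} = {..<min a b}" by auto
    then show "{..<a} \<inter> {..<b} \<in> range lessThan" by blast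
  qed
  have "sets borel = sigma_sets UNIV (range lessThan :: real set set)"
    by (subst borel_eq_lessThan) (simp add: eucl_lessThan)
  then show "sets M = sigma_sets UNIV (range lessThan)" "sets N = sigma_sets UNIV (range lessThan)"
    using assms(3,4) by simp_all
  show "range (\<lambda>n. {..<real n}) \<subseteq> range lessThan" by auto
  show "(\<Union>n. {..<real n}) = UNIV" using reals_Archimedean2 by auto
  show "emeasure M {..<real n} \<noteq> \<infinity>" for n by simp
  show "emeasure M X = emeasure N X" if XE: "X \<in> range lessThan" for X
  proof -
    obtain x where X: "X = {..<x}" using XE by auto
    obtain r where r: "incseq r" "\<And>n. r n \<in> \<rat>" "\<And>n. r n < x" "r \<longlonglongrightarrow> x"
      by (rule rational_incseq_below[of x]) (rule that)
    have un: "X = (\<Union>n. {..<r n})"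
      using incseq_below_covers[OF r(4)] r(3) unfolding X by (auto intro: order.strict_trans)
    have inc: "incseq (\<lambda>n. {..<r n})" using r(1) by (auto simp: incseq_def intro: order.strict_trans2)
    have "emeasure M X = (SUP n. emeasure M {..<r n})"
      unfolding un by (rule SUP_emeasure_incseq[symmetric]) (use inc in auto)
    also have "\<dots> = (SUP n. emeasure N {..<r n})" using eq[OF r(2)] by simp
    also have "\<dots> = emeasure N X"
      unfolding un by (rule SUP_emeasure_incseq) (use inc in auto)
    finally show ?thesis .
  qed
qed auto

lemma pair_measure_eqI_Times:
  assumes "finite_measure P" "finite_measure Q"
    and [measurable_cong]: "sets P = sets (M \<Otimes>\<^sub>M N)" "sets Q = sets (M \<Otimes>\<^sub>M N)"
    and eq: "\<And>A B. A \<in> sets M \<Longrightarrow> B \<in> sets N \<Longrightarrow> emeasure P (A \<times> B) = emeasure Q (A \<times> B)"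
  shows "P = Q"
proof (rule measure_eqI_generator_eq[OF Int_stable_pair_measure_generator[of M N], of "space M \<times> space N" _ _ "\<lambda>_. space M \<times> space N"])
  interpret P: finite_measure P by fact
  show "{a \<times> b |a b. a \<in> sets M \<and> b \<in> sets N} \<subseteq> Pow (space M \<times> space N)"
    by (rule pair_measure_closed)
  show "emeasure P (space M \<times> space N) \<noteq> \<infinity>" by simp
  show "sets P = sigma_sets (space M \<times> space N) {a \<times> b |a b. a \<in> sets M \<and> b \<in> sets N}"
    "sets Q = sigma_sets (space M \<times> space N) {a \<times> b |a b. a \<in> sets M \<and> b \<in> sets N}"
    using assms(3,4) by (simp_all add: sets_pair_measure)
  show "emeasure P X = emeasure Q X" if "X \<in> {a \<times> b |a b. a \<in> sets M \<and> b \<in> sets N}" for X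
    using that eq by blast
qed blast+

text \<open>For fixed \<open>A\<close> the part of the measure over \<open>A\<close> projects to a
  real measure, which reduces the claim to half-lines in the second coordinate.\<close>

lemma pair_real_measure_eqI_rat:
  fixes P Q :: "('a \<times> real) measure"
  assumes "finite_measure P" "finite_measure Q"
    and s[measurable_cong]: "sets P = sets (M \<Otimes>\<^sub>M borel)" "sets Q = sets (M \<Otimes>\<^sub>M borel)"
    and eq: "\<And>A r. A \<in> sets M \<Longrightarrow> r \<in> \<rat> \<Longrightarrow> emeasure P (A \<times> {..<r}) = emeasure Q (A \<times> {..<r})"
  shows "P = Q"
proof (rule pair_measure_eqI_Times[OF assms(1-4)])
  interpret P: finite_measure P by fact
  interpret Q: finite_measure Q by fact
  fix A and B :: "real set" assume [measurable]: "A \<in> sets M" "B \<in> sets borel"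
  define slice where "slice R = distr (density R (indicator (A \<times> UNIV))) borel snd" for R :: "('a \<times> real) measure"
  have slice: "emeasure (slice R) B = emeasure R (A \<times> B)"
    if [measurable_cong]: "sets R = sets (M \<Otimes>\<^sub>M borel)" and [measurable]: "B \<in> sets borel" for R B
  proof -
    have sp: "space R = space M \<times> UNIV" using sets_eq_imp_space_eq[OF that(1)] by (simp add: space_pair_measure)
    have "emeasure (slice R) B = (\<integral>\<^sup>+z. indicator (A \<times> UNIV) z * indicator (snd -` B \<inter> space R) z \<partial>R)"
      unfolding slice_def by (simp add: emeasure_distr emeasure_density)
    also have "\<dots> = (\<integral>\<^sup>+z. indicator (A \<times> B) z \<partial>R)"
      by (rule nn_integral_cong) (auto simp: sp indicator_def)
    finally show ?thesis by simp
  qed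
  have "slice P = slice Q"
  proof (rule real_measure_eqI_rat)
    show "finite_measure (slice P)" "finite_measure (slice Q)"
      using slice[OF s(1), of UNIV] slice[OF s(2), of UNIV] by (auto intro!: finite_measureI simp: slice_def)
    show "emeasure (slice P) {..<r} = emeasure (slice Q) {..<r}" if "r \<in> \<rat>" for r
      using eq[OF _ that] by (simp add: slice s)
  qed (simp_all add: slice_def)
  then show "emeasure P (A \<times> B) = emeasure Q (A \<times> B)"
    using slice[OF s(1), of B] slice[OF s(2), of B] by simp
qed

text \<open>Testing on the set where \<open>g < f\<close> shows that \<open>f - g\<close> integrates
  to 0 there; finiteness of the integral of \<open>g\<close> makes the subtraction
  legitimate.\<close>

lemma AE_le_of_nn_integral_le:
  fixes f g :: "'a \<Rightarrow> ennreal"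
  assumes [measurable]: "f \<in> borel_measurable M" "g \<in> borel_measurable M"
    and fin: "integral\<^sup>N M g \<noteq> \<infinity>"
    and le: "\<And>A. A \<in> sets M \<Longrightarrow> (\<integral>\<^sup>+x. f x * indicator A x \<partial>M) \<le> (\<integral>\<^sup>+x. g x * indicator A x \<partial>M)"
  shows "AE x in M. f x \<le> g x"
proof -
  define A where "A = {x \<in> space M. g x < f x}"
  have [measurable]: "A \<in> sets M" unfolding A_def by measurable
  have fing: "(\<integral>\<^sup>+x. g x * indicator A x \<partial>M) \<noteq> \<infinity>"
  proof -
    have "(\<integral>\<^sup>+x. g x * indicator A x \<partial>M) \<le> integral\<^sup>N M g"
      by (rule nn_integral_mono) (auto simp: indicator_def)
    then show ?thesis using fin by (auto simp: top_unique)
  qed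
  have "(\<integral>\<^sup>+x. f x * indicator A x - g x * indicator A x \<partial>M)
      = (\<integral>\<^sup>+x. f x * indicator A x \<partial>M) - (\<integral>\<^sup>+x. g x * indicator A x \<partial>M)"
    by (rule nn_integral_diff) (use fing in \<open>auto simp: indicator_def A_def\<close>)
  also have "\<dots> = 0" using le[of A] fing by (intro diff_eq_0_ennreal) (auto simp: less_top[symmetric] top_unique)
  finally have "AE x in M. f x * indicator A x - g x * indicator A x = 0"
    by (subst (asm) nn_integral_0_iff_AE) auto
  with AE_space show ?thesis
  proof eventually_elim
    case (elim x)
    show ?case
    proof (cases "x \<in> A")
      case True
      then have "f x - g x = 0" "g x < f x" using elim by (auto simp: A_def)
      then show ?thesis by (metis diff_gr0_ennreal less_irrefl)
    next
      case False then show ?thesis using elim by (auto simp: A_def)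
    qed
  qed
qed

section \<open>Quantile functions with rational thresholds\<close>

text \<open>The generalised inverse of a distribution function on the unit interval, computed from
  rational arguments only: a family of Radon-Nikodym derivatives is well behaved at countably many
  arguments simultaneously, and a countable infimum stays measurable. The inserted 1 supplies the
  value when no rational qualifies.\<close>

definition quantile :: "(real \<Rightarrow> ennreal) \<Rightarrow> real \<Rightarrow> real" where
  "quantile \<phi> u = Inf (insert 1 {r \<in> \<rat> \<inter> {0..<1}. ennreal u \<le> \<phi> r})"

text \<open>An infimum lies strictly below \<open>x\<close> exactly when some element does. The
  bound on \<open>x\<close> keeps the inserted 1 from being such an element.\<close>

lemma quantile_less_iff:
  assumes "x \<le> 1"
  shows "quantile \<phi> u < x \<longleftrightarrow> (\<exists>r\<in>\<rat> \<inter> {0..<1}. r < x \<and> ennreal u \<le> \<phi> r)"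
proof -
  have "bdd_below (insert 1 {r \<in> \<rat> \<inter> {0..<1}. ennreal u \<le> \<phi> r})"
    by (rule bdd_belowI[of _ 0]) auto
  then show ?thesis unfolding quantile_def using assms by (subst cInf_less_iff) auto
qed

lemma quantile_range: "0 \<le> quantile \<phi> u" "quantile \<phi> u \<le> 1"
proof -
  show "0 \<le> quantile \<phi> u" unfolding quantile_def by (rule cInf_greatest) auto
  show "quantile \<phi> u \<le> 1" unfolding quantile_def by (rule cInf_lower) (auto intro!: bdd_belowI[of _ 0])
qed

lemma measurable_quantile[measurable (raw)]:
  assumes [measurable]: "\<And>r. \<phi> r \<in> borel_measurable M" "u \<in> borel_measurable M"
  shows "(\<lambda>x. quantile (\<lambda>r. \<phi> r x) (u x)) \<in> borel_measurable M"
proof (rule borel_measurable_iff_less[THEN iffD2], rule allI)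
  fix a :: real
  show "{x \<in> space M. quantile (\<lambda>r. \<phi> r x) (u x) < a} \<in> sets M"
  proof (cases "a \<le> 1")
    case True
    have "countable (\<rat> \<inter> {0..<1::real})" using countable_rat by blast
    moreover have "{x \<in> space M. r < a \<and> ennreal (u x) \<le> \<phi> r x} \<in> sets M" for r by measurable
    ultimately have "{x \<in> space M. \<exists>r\<in>\<rat> \<inter> {0..<1}. r < a \<and> ennreal (u x) \<le> \<phi> r x} \<in> sets M"
      by (intro sets.sets_Collect_countable_Ex') auto
    then show ?thesis by (simp add: quantile_less_iff[OF True])
  next
    case False
    then have "{x \<in> space M. quantile (\<lambda>r. \<phi> r x) (u x) < a} = space M"
      using quantile_range(2) by (auto simp: not_le intro: le_less_trans)
    then show ?thesis by simp
  qed
qed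

lemma emeasure_lam01_atMost:
  assumes "p \<le> 1"
  shows "emeasure lam01 {u \<in> {0..1}. ennreal u \<le> p} = p"
proof -
  obtain q where q: "0 \<le> q" "p = ennreal q" "q \<le> 1"
    using assms by (cases p) (auto simp: top_unique)
  then have "{u \<in> {0..1}. ennreal u \<le> p} = {0..q}" by (auto simp: ennreal_le_iff)
  then show ?thesis using q by (simp add: lam01_def emeasure_restrict_space)
qed

text \<open>The strict event is an increasing union of the events
  \<open>u \<le> \<phi> (r n)\<close>, each of mass \<open>\<phi> (r n)\<close>; only left limits
  occur, so monotonicity at rationals suffices.\<close>

lemma emeasure_quantile_less:
  assumes mono: "\<And>r s. r \<in> \<rat> \<inter> {0..<1} \<Longrightarrow> s \<in> \<rat> \<inter> {0..<1} \<Longrightarrow> r \<le> s \<Longrightarrow> \<phi> r \<le> \<phi> s"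
    and le1: "\<And>r. r \<in> \<rat> \<inter> {0..<1} \<Longrightarrow> \<phi> r \<le> 1"
    and "x \<le> 1" and r: "incseq r" "\<And>n. r n \<in> \<rat> \<inter> {0..<1}" "\<And>n. r n < x" "r \<longlonglongrightarrow> x"
  shows "emeasure lam01 {u \<in> space lam01. quantile \<phi> u < x} = (SUP n. \<phi> (r n))"
proof -
  have [measurable]: "{u \<in> {0..1}. ennreal u \<le> \<phi> (r n)} \<in> sets lam01" for n
  proof -
    have "{u \<in> space lam01. ennreal u \<le> \<phi> (r n)} \<in> sets lam01" by measurable
    then show ?thesis by simp
  qed
  have "{u \<in> space lam01. quantile \<phi> u < x} = (\<Union>n. {u \<in> {0..1}. ennreal u \<le> \<phi> (r n)})"
  proof (intro set_eqI iffI)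
    fix u assume "u \<in> {u \<in> space lam01. quantile \<phi> u < x}"
    then obtain s where s: "s \<in> \<rat> \<inter> {0..<1}" "s < x" "ennreal u \<le> \<phi> s" "u \<in> {0..1}"
      using quantile_less_iff[OF \<open>x \<le> 1\<close>] by auto
    obtain n where "s < r n" using incseq_below_covers[OF r(4) s(2)] by auto
    then have "\<phi> s \<le> \<phi> (r n)" using mono[OF s(1) r(2)] by simp
    then show "u \<in> (\<Union>n. {u \<in> {0..1}. ennreal u \<le> \<phi> (r n)})" using s by (auto intro: order_trans)
  next
    fix u assume "u \<in> (\<Union>n. {u \<in> {0..1}. ennreal u \<le> \<phi> (r n)})"
    then obtain n where "u \<in> {0..1}" "ennreal u \<le> \<phi> (r n)" by blast
    then show "u \<in> {u \<in> space lam01. quantile \<phi> u < x}"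
      using quantile_less_iff[OF \<open>x \<le> 1\<close>, of \<phi> u] r(2,3)[of n] by auto
  qed
  then have "emeasure lam01 {u \<in> space lam01. quantile \<phi> u < x} = (SUP n. emeasure lam01 {u \<in> {0..1}. ennreal u \<le> \<phi> (r n)})"
  proof (simp only:, intro SUP_emeasure_incseq[symmetric])
    show "incseq (\<lambda>n. {u \<in> {0..1}. ennreal u \<le> \<phi> (r n)})"
      using mono[OF r(2) r(2)] incseqD[OF r(1)] unfolding incseq_def by (blast intro: order_trans)
    show "range (\<lambda>n. {u \<in> {0..1}. ennreal u \<le> \<phi> (r n)}) \<subseteq> sets lam01" by (rule image_subsetI) measurable
  qed
  then show ?thesis using emeasure_lam01_atMost[OF le1[OF r(2)]] by simp
qed

lemma rational_incseq_unit:
  fixes x :: real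
  assumes "0 < x" "x \<le> 1"
  obtains r where "incseq r" "\<And>n. r n \<in> \<rat> \<inter> {0..<1}" "\<And>n. r n < x" "r \<longlonglongrightarrow> x"
proof -
  obtain r where r: "incseq r" "\<And>n. r n \<in> \<rat>" "\<And>n. r n < x" "r \<longlonglongrightarrow> x"
    by (rule rational_incseq_below[of x]) (rule that)
  show thesis
  proof
    show "incseq (\<lambda>n. max 0 (r n))" using r(1) by (auto simp: incseq_def intro: max.coboundedI2)
    show "max 0 (r n) \<in> \<rat> \<inter> {0..<1}" "max 0 (r n) < x" for n
      using r(2,3)[of n] assms by (auto simp: max_def)
    have "(\<lambda>n. max 0 (r n)) \<longlonglongrightarrow> max 0 x" by (intro tendsto_intros r(4))
    then show "(\<lambda>n. max 0 (r n)) \<longlonglongrightarrow> x" using assms by simp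
  qed
qed

section \<open>Kernels represented by randomised functions\<close>

text \<open>Tonelli for a kernel represented as the law of \<open>w (a, l)\<close> for random
  \<open>l\<close>. Conditional laws appear below in this form, so kernels are compared through the
  joint law of the base point and the randomised value.\<close>

lemma emeasure_fiber_distr:
  assumes "sigma_finite_measure L"
    and w[measurable]: "w \<in> P \<Otimes>\<^sub>M L \<rightarrow>\<^sub>M Z" and [measurable_cong]: "sets P = sets H"
    and E[measurable]: "E \<in> sets (H \<Otimes>\<^sub>M Z)"
  shows "emeasure (distr (P \<Otimes>\<^sub>M L) (H \<Otimes>\<^sub>M Z) (\<lambda>(a, l). (a, w (a, l)))) E
    = (\<integral>\<^sup>+a. emeasure (distr L Z (\<lambda>l. w (a, l))) (Pair a -` E) \<partial>P)"
proof -
  interpret L: sigma_finite_measure L by fact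
  let ?f = "\<lambda>(a, l). (a, w (a, l))"
  have [measurable]: "?f \<in> P \<Otimes>\<^sub>M L \<rightarrow>\<^sub>M H \<Otimes>\<^sub>M Z" by measurable
  have "emeasure (distr (P \<Otimes>\<^sub>M L) (H \<Otimes>\<^sub>M Z) ?f) E = emeasure (P \<Otimes>\<^sub>M L) (?f -` E \<inter> space (P \<Otimes>\<^sub>M L))"
    by (rule emeasure_distr) measurable
  also have "\<dots> = (\<integral>\<^sup>+a. emeasure L (Pair a -` (?f -` E \<inter> space (P \<Otimes>\<^sub>M L))) \<partial>P)"
    by (rule L.emeasure_pair_measure_alt) measurable
  also have "\<dots> = (\<integral>\<^sup>+a. emeasure (distr L Z (\<lambda>l. w (a, l))) (Pair a -` E) \<partial>P)"
  proof (rule nn_integral_cong)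
    fix a assume a: "a \<in> space P"
    have [measurable]: "Pair a -` E \<in> sets Z" by (rule sets_Pair1) fact
    have wa[measurable]: "(\<lambda>l. w (a, l)) \<in> L \<rightarrow>\<^sub>M Z"
      using a by (intro measurable_compose[OF measurable_Pair1' w])
    show "emeasure L (Pair a -` (?f -` E \<inter> space (P \<Otimes>\<^sub>M L))) = emeasure (distr L Z (\<lambda>l. w (a, l))) (Pair a -` E)"
      using a by (subst emeasure_distr) (auto simp: space_pair_measure intro!: arg_cong[where f="emeasure L"])
  qed
  finally show ?thesis .
qed

lemma distr_fiber_cong:
  assumes "sigma_finite_measure L" "sigma_finite_measure L'"
    and [measurable]: "w \<in> P \<Otimes>\<^sub>M L \<rightarrow>\<^sub>M Z" "w' \<in> P \<Otimes>\<^sub>M L' \<rightarrow>\<^sub>M Z" and s: "sets P = sets H"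
    and AE: "AE a in P. distr L Z (\<lambda>l. w (a, l)) = distr L' Z (\<lambda>l. w' (a, l))"
  shows "distr (P \<Otimes>\<^sub>M L) (H \<Otimes>\<^sub>M Z) (\<lambda>(a, l). (a, w (a, l))) = distr (P \<Otimes>\<^sub>M L') (H \<Otimes>\<^sub>M Z) (\<lambda>(a, l). (a, w' (a, l)))"
    (is "?A = ?B")
proof (rule measure_eqI)
  fix E assume "E \<in> sets ?A"
  then have E: "E \<in> sets (H \<Otimes>\<^sub>M Z)" by simp
  show "emeasure ?A E = emeasure ?B E"
    unfolding emeasure_fiber_distr[OF assms(1,3) s E] emeasure_fiber_distr[OF assms(2,4) s E]
    using AE by (intro nn_integral_cong_AE) auto
qed simp

text \<open>Uniqueness of disintegration. For each rational \<open>r\<close> the fibre masses of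
  \<open>e z < r\<close> are two densities of the same measure, hence agree almost everywhere; one
  null set serves all rationals, and the laws of the real codes then determine the fibre
  laws.\<close>

lemma distr_fiber_unique:
  assumes "prob_space P" "prob_space L"
    and w: "w \<in> P \<Otimes>\<^sub>M L \<rightarrow>\<^sub>M Z" "w' \<in> P \<Otimes>\<^sub>M L \<rightarrow>\<^sub>M Z" and s: "sets P = sets H"
    and "std_borel Z"
    and eq: "distr (P \<Otimes>\<^sub>M L) (H \<Otimes>\<^sub>M Z) (\<lambda>(a, l). (a, w (a, l))) = distr (P \<Otimes>\<^sub>M L) (H \<Otimes>\<^sub>M Z) (\<lambda>(a, l). (a, w' (a, l)))"
  shows "AE a in P. distr L Z (\<lambda>l. w (a, l)) = distr L Z (\<lambda>l. w' (a, l))"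
proof -
  interpret P: prob_space P by fact
  interpret L: prob_space L by fact
  obtain e :: "_ \<Rightarrow> real" and d where [measurable]: "e \<in> borel_measurable Z" "d \<in> borel \<rightarrow>\<^sub>M Z"
    and ed: "\<And>x. x \<in> space Z \<Longrightarrow> d (e x) = x"
    using \<open>std_borel Z\<close> unfolding std_borel_def by blast
  define m where "m w a r = emeasure L {l \<in> space L. e (w (a, l)) < r}" for w :: "'a \<times> 'b \<Rightarrow> 'c" and a r
  have wa: "(\<lambda>l. w (a, l)) \<in> L \<rightarrow>\<^sub>M Z" if "w \<in> P \<Otimes>\<^sub>M L \<rightarrow>\<^sub>M Z" "a \<in> space P" for w a
    using that(2) by (intro measurable_compose[OF measurable_Pair1' that(1)])
  have mm: "(\<lambda>a. m w a r) \<in> borel_measurable P" if [measurable]: "w \<in> P \<Otimes>\<^sub>M L \<rightarrow>\<^sub>M Z" for w r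
    unfolding m_def by measurable
  have int: "(\<integral>\<^sup>+a. m w a r * indicator A a \<partial>P)
      = emeasure (distr (P \<Otimes>\<^sub>M L) (H \<Otimes>\<^sub>M Z) (\<lambda>(a, l). (a, w (a, l)))) (A \<times> {z \<in> space Z. e z < r})"
    if A: "A \<in> sets P" and w: "w \<in> P \<Otimes>\<^sub>M L \<rightarrow>\<^sub>M Z" for A r w
  proof -
    have [measurable]: "A \<in> sets H" using A s by simp
    have E: "A \<times> {z \<in> space Z. e z < r} \<in> sets (H \<Otimes>\<^sub>M Z)" by measurable
    show ?thesis
      unfolding emeasure_fiber_distr[OF L.sigma_finite_measure_axioms w s E]
    proof (rule nn_integral_cong)
      fix a assume a: "a \<in> space P"
      show "m w a r * indicator A a = emeasure (distr L Z (\<lambda>l. w (a, l))) (Pair a -` (A \<times> {z \<in> space Z. e z < r}))"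
        using measurable_space[OF wa[OF w a]] wa[OF w a] unfolding m_def
        by (cases "a \<in> A") (auto simp: emeasure_distr intro!: arg_cong[where f="emeasure L"])
    qed
  qed
  have "AE a in P. m w a r = m w' a r" for r
    by (rule P.density_unique_finite_measure) (simp_all add: int mm w eq)
  then have "AE a in P. \<forall>r\<in>\<rat>. m w a r = m w' a r"
    using countable_rat by (subst AE_ball_countable) auto
  with AE_space show ?thesis
  proof eventually_elim
    case (elim a)
    note wa[OF w(1) elim(1), measurable] wa[OF w(2) elim(1), measurable]
    have "distr L borel (\<lambda>l. e (w (a, l))) = distr L borel (\<lambda>l. e (w' (a, l)))"
    proof (rule real_measure_eqI_rat)
      show "finite_measure (distr L borel (\<lambda>l. e (w (a, l))))" "finite_measure (distr L borel (\<lambda>l. e (w' (a, l))))"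
        by (auto intro!: L.finite_measure_distr)
      fix r :: real assume "r \<in> \<rat>"
      with elim have "m w a r = m w' a r" by blast
      then show "emeasure (distr L borel (\<lambda>l. e (w (a, l)))) {..<r} = emeasure (distr L borel (\<lambda>l. e (w' (a, l)))) {..<r}"
        by (simp add: emeasure_distr m_def vimage_def Int_def conj_commute)
    qed simp_all
    then have "distr (distr L borel (\<lambda>l. e (w (a, l)))) Z d = distr (distr L borel (\<lambda>l. e (w' (a, l)))) Z d" by simp
    moreover have "distr (distr L borel (\<lambda>l. e (v (a, l)))) Z d = distr L Z (\<lambda>l. v (a, l))"
      if v[measurable]: "(\<lambda>l. v (a, l)) \<in> L \<rightarrow>\<^sub>M Z" for v
      using measurable_space[OF v] by (subst distr_distr) (auto simp: ed intro!: distr_cong)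
    ultimately show ?case using wa[OF w(1) elim(1)] wa[OF w(2) elim(1)] by simp
  qed
qed

section \<open>Quantile transform and existence of disintegrations\<close>

lemma distr_quantile:
  fixes m :: "real measure"
  assumes "prob_space m" and [measurable_cong]: "sets m = sets borel" and AE: "AE y in m. y \<in> {0..<1}"
  shows "distr lam01 borel (quantile (\<lambda>r. emeasure m {..r})) = m"
proof (rule real_measure_eqI_rat)
  interpret m: prob_space m by fact
  interpret lam01: prob_space lam01 by (rule prob_space_lam01)
  let ?q = "quantile (\<lambda>r. emeasure m {..r})"
  have [measurable]: "?q \<in> borel_measurable lam01" by measurable
  show "finite_measure m" by (rule m.finite_measure_axioms)
  show "finite_measure (distr lam01 borel ?q)" by (rule lam01.finite_measure_distr) measurable
  fix x :: real assume "x \<in> \<rat>"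
  have D: "emeasure (distr lam01 borel ?q) {..<x} = emeasure lam01 {u \<in> space lam01. ?q u < x}"
    by (subst emeasure_distr) (auto intro!: arg_cong[where f="emeasure lam01"])
  \<comment> \<open>Thresholds outside \<open>(0, 1]\<close> are trivial, because both the quantile
    and the measure live on the unit interval.\<close>
  consider "x \<le> 0" | "0 < x" "x \<le> 1" | "1 < x" by linarith
  then show "emeasure (distr lam01 borel ?q) {..<x} = emeasure m {..<x}"
  proof cases
    case 1
    then have "{u \<in> space lam01. ?q u < x} = {}" using quantile_range(1) by (auto simp: not_less intro: order_trans)
    moreover have "emeasure m {..<x} = emeasure m {}"
      by (rule emeasure_eq_AE) (use AE 1 in auto)
    ultimately show ?thesis unfolding D by (simp only: emeasure_empty)
  next
    case 2
    obtain r where r: "incseq r" "\<And>n. r n \<in> \<rat> \<inter> {0..<1}" "\<And>n. r n < x" "r \<longlonglongrightarrow> x"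
      by (rule rational_incseq_unit[OF 2]) (rule that)
    have "emeasure lam01 {u \<in> space lam01. ?q u < x} = (SUP n. emeasure m {..r n})"
      by (rule emeasure_quantile_less[OF _ _ 2(2) r]) (auto intro!: emeasure_mono m.emeasure_le_1)
    also have "\<dots> = emeasure m (\<Union>n. {..r n})"
      by (rule SUP_emeasure_incseq) (use r(1) in \<open>auto simp: incseq_def intro: order_trans\<close>)
    also have "(\<Union>n. {..r n}) = {..<x}"
      using incseq_below_covers[OF r(4)] r(3) by (auto intro: le_less_trans) (meson less_imp_le)
    finally show ?thesis unfolding D .
  next
    case 3
    then have "{u \<in> space lam01. ?q u < x} = space lam01" using quantile_range(2) by (auto intro: le_less_trans)
    moreover have "emeasure m {..<x} = emeasure m (space m)"
      by (rule emeasure_eq_AE) (use AE 3 in auto)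
    ultimately show ?thesis unfolding D by (simp only: lam01.emeasure_space_1 m.emeasure_space_1)
  qed
qed (simp_all add: assms(2))

text \<open>Without atoms the distribution function is continuous and so undoes its quantile
  function at every \<open>u\<close>; this makes the quantile function injective.\<close>

lemma emeasure_atMost_quantile:
  fixes m :: "real measure"
  assumes "prob_space m" and s[measurable_cong]: "sets m = sets borel" and AE: "AE y in m. y \<in> {0..<1}"
    and atomless: "\<And>y. emeasure m {y} = 0" and u: "u \<in> {0..1}"
  shows "emeasure m {..quantile (\<lambda>r. emeasure m {..r}) u} = ennreal u"
proof -
  interpret m: prob_space m by fact
  interpret m: real_distribution m by standard (use s sets_eq_imp_space_eq[OF s] in auto)
  let ?\<phi> = "\<lambda>r. emeasure m {..r}"
  let ?q = "quantile ?\<phi> u"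
  have em: "?\<phi> r = ennreal (cdf m r)" for r by (simp add: cdf_def m.emeasure_eq_measure)
  have cont: "isCont (cdf m) y" for y
    using atomless[of y] by (simp add: m.isCont_cdf measure_def)
  have zero: "cdf m r = 0" if "r < 0" for r
  proof -
    have "emeasure m {..r} = emeasure m {}" by (rule emeasure_eq_AE) (use AE that in auto)
    then show ?thesis by (simp add: em m.cdf_nonneg)
  qed
  have one: "cdf m r = 1" if "1 \<le> r" for r
  proof -
    have "emeasure m {..r} = emeasure m (space m)" by (rule emeasure_eq_AE) (use AE that in auto)
    then show ?thesis unfolding em m.emeasure_space_1 by simp
  qed
  \<comment> \<open>A rational below the quantile at which the distribution function exceeded
    \<open>u\<close> would belong to the set whose infimum is taken; continuity carries the bound up
    to the quantile.\<close>
  have "cdf m ?q \<le> u"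
  proof -
    obtain r where r: "incseq r" "\<And>n. r n \<in> \<rat>" "\<And>n. r n < ?q" "r \<longlonglongrightarrow> ?q"
      by (rule rational_incseq_below[of ?q]) (rule that)
    have "cdf m (r n) \<le> u" for n
    proof (cases "r n < 0")
      case True then show ?thesis using zero u by simp
    next
      case False
      have "r n < 1" using r(3)[of n] quantile_range(2)[of ?\<phi> u] by linarith
      show ?thesis
      proof (rule ccontr)
        assume "\<not> cdf m (r n) \<le> u"
        then have le: "ennreal u \<le> ?\<phi> (r n)" unfolding em by (intro ennreal_leI) simp
        have "?q < x" if "r n < x" "x \<le> 1" for x
          unfolding quantile_less_iff[OF that(2)] using le that r(2)[of n] False \<open>r n < 1\<close> by auto
        from this[of ?q] r(3)[of n] quantile_range(2)[of ?\<phi> u] show False by blast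
      qed
    qed
    moreover have "(\<lambda>n. cdf m (r n)) \<longlonglongrightarrow> cdf m ?q"
      by (rule isCont_tendsto_compose[OF cont r(4)])
    ultimately show ?thesis by (intro LIMSEQ_le_const2[of "\<lambda>n. cdf m (r n)"]) auto
  qed
  \<comment> \<open>Above the quantile the distribution function is already at least
    \<open>u\<close>, and right continuity carries this down to the quantile.\<close>
  moreover have "u \<le> cdf m ?q"
  proof (cases "?q < 1")
    case False then show ?thesis using one[of ?q] u by simp
  next
    case True
    have "u \<le> cdf m s" if "?q < s" for s
    proof -
      have "?q < min s 1" using that True by simp
      then obtain r where r: "r < min s 1" "ennreal u \<le> ?\<phi> r"
        using quantile_less_iff[of "min s 1" ?\<phi> u] by auto
      then have "u \<le> cdf m r" unfolding em using m.cdf_nonneg[of r] by (simp add: ennreal_le_iff)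
      also have "\<dots> \<le> cdf m s" using r by (intro m.cdf_nondecreasing) simp
      finally show ?thesis .
    qed
    moreover have "(cdf m \<longlongrightarrow> cdf m ?q) (at_right ?q)"
      using m.cdf_is_right_cont[of ?q] by (simp add: continuous_within)
    ultimately show ?thesis
      by (intro tendsto_lowerbound[of "cdf m" _ "at_right ?q"]) (auto simp: eventually_at_right_less intro: eventually_mono[OF eventually_at_right_less])
  qed
  ultimately show ?thesis by (simp add: em)
qed

text \<open>The conditional distribution function at \<open>r\<close> is the Radon-Nikodym
  derivative of the measure sending \<open>A\<close> to \<open>P (A \<times> {..r})\<close> with
  respect to the first marginal. For almost every \<open>h\<close> it is monotone and at most 1 at
  all rationals, and its quantile function, fed with a uniform variable, realises the conditional
  law.\<close>

lemma disintegration_real: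
  fixes P :: "('h \<times> real) measure"
  assumes "prob_space P" and s[measurable_cong]: "sets P = sets (H \<Otimes>\<^sub>M borel)"
    and AE: "AE z in P. snd z \<in> {0..<1}"
  obtains q where "q \<in> borel_measurable (H \<Otimes>\<^sub>M lam01)"
    "distr (distr P H fst \<Otimes>\<^sub>M lam01) (H \<Otimes>\<^sub>M borel) (\<lambda>(h, u). (h, q (h, u))) = P"
proof -
  interpret P: prob_space P by fact
  interpret lam01: prob_space lam01 by (rule prob_space_lam01)
  define PH where "PH = distr P H fst"
  have sPH[measurable_cong]: "sets PH = sets H" by (simp add: PH_def)
  interpret PH: prob_space PH unfolding PH_def by (rule P.prob_space_distr) measurable
  have spP: "space P = space H \<times> UNIV" using sets_eq_imp_space_eq[OF s] by (simp add: space_pair_measure)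
  define Nu where "Nu r = distr (density P (indicator (space H \<times> {..r}))) H fst" for r :: real
  have Nu: "emeasure (Nu r) A = emeasure P (A \<times> {..r})" if [measurable]: "A \<in> sets H" for r A
  proof -
    have "emeasure (Nu r) A = (\<integral>\<^sup>+z. indicator (space H \<times> {..r}) z * indicator (fst -` A \<inter> space P) z \<partial>P)"
      unfolding Nu_def by (simp add: emeasure_distr emeasure_density)
    also have "\<dots> = (\<integral>\<^sup>+z. indicator (A \<times> {..r}) z \<partial>P)"
      using sets.sets_into_space[OF that] by (intro nn_integral_cong) (auto simp: spP indicator_def)
    finally show ?thesis by simp
  qed
  have PHA: "emeasure PH A = emeasure P (A \<times> UNIV)" if "A \<in> sets H" for A
    using sets.sets_into_space[OF that] that
    by (auto simp: PH_def emeasure_distr spP intro!: arg_cong[where f="emeasure P"])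
  have ac: "absolutely_continuous PH (Nu r)" for r
    unfolding absolutely_continuous_def
  proof
    fix A assume A: "A \<in> null_sets PH"
    then have [measurable]: "A \<in> sets H" using sPH by auto
    have "emeasure P (A \<times> {..r}) \<le> emeasure P (A \<times> UNIV)" by (intro emeasure_mono) auto
    then have "emeasure (Nu r) A = 0" using A by (simp add: Nu PHA[symmetric] null_sets_def)
    then show "A \<in> null_sets (Nu r)" by (simp add: null_sets_def Nu_def)
  qed
  define \<phi> where "\<phi> r = RN_deriv PH (Nu r)" for r
  have [measurable]: "\<phi> r \<in> borel_measurable H" for r
    using borel_measurable_RN_deriv[of PH "Nu r"] unfolding \<phi>_def measurable_cong_sets[OF sPH refl] .
  have int: "(\<integral>\<^sup>+h. \<phi> r h * indicator A h \<partial>PH) = emeasure P (A \<times> {..r})" if [measurable]: "A \<in> sets H" for A r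
  proof -
    have "density PH (\<phi> r) = Nu r"
      unfolding \<phi>_def by (rule PH.density_RN_deriv[OF ac]) (simp add: Nu_def sPH)
    then have "emeasure (density PH (\<phi> r)) A = emeasure P (A \<times> {..r})" using Nu[OF that] by simp
    then show ?thesis by (simp add: emeasure_density)
  qed
  have intfin: "integral\<^sup>N PH (\<phi> r) \<noteq> \<infinity>" for r
  proof -
    have "integral\<^sup>N PH (\<phi> r) = (\<integral>\<^sup>+h. \<phi> r h * indicator (space H) h \<partial>PH)"
      using sets_eq_imp_space_eq[OF sPH] by (intro nn_integral_cong) auto
    also have "\<dots> \<noteq> \<infinity>" by (subst int) auto
    finally show ?thesis .
  qed
  have "AE h in PH. \<phi> r h \<le> 1" for r
  proof (rule AE_le_of_nn_integral_le)
    fix A assume "A \<in> sets PH"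
    then have [measurable]: "A \<in> sets H" using sPH by simp
    have "emeasure P (A \<times> {..r}) \<le> emeasure P (A \<times> UNIV)" by (intro emeasure_mono) auto
    then show "(\<integral>\<^sup>+h. \<phi> r h * indicator A h \<partial>PH) \<le> (\<integral>\<^sup>+h. 1 * indicator A h \<partial>PH)"
      by (simp add: int PHA)
  qed (simp_all add: PH.emeasure_space_1)
  then have le1: "AE h in PH. \<forall>r\<in>\<rat>. \<phi> r h \<le> 1"
    using countable_rat by (subst AE_ball_countable) auto
  have "AE h in PH. r \<le> s \<longrightarrow> \<phi> r h \<le> \<phi> s h" for r s
  proof (cases "r \<le> s")
    case True
    have "AE h in PH. \<phi> r h \<le> \<phi> s h"
    proof (rule AE_le_of_nn_integral_le)
      fix A assume "A \<in> sets PH"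
      then have [measurable]: "A \<in> sets H" using sPH by simp
      show "(\<integral>\<^sup>+h. \<phi> r h * indicator A h \<partial>PH) \<le> (\<integral>\<^sup>+h. \<phi> s h * indicator A h \<partial>PH)"
        using True by (auto simp: int intro!: emeasure_mono)
    qed (use intfin in simp_all)
    then show ?thesis by simp
  qed simp
  then have mono: "AE h in PH. \<forall>r\<in>\<rat>. \<forall>s\<in>\<rat>. r \<le> s \<longrightarrow> \<phi> r h \<le> \<phi> s h"
    by (subst AE_ball_countable[OF countable_rat], intro ballI, subst AE_ball_countable[OF countable_rat], blast)
  \<comment> \<open>The quantile is defined and measurable for every \<open>h\<close>, including
    those where the derivatives misbehave.\<close>
  define q where "q = (\<lambda>(h, u). quantile (\<lambda>r. \<phi> r h) u)"
  have qm[measurable]: "q \<in> borel_measurable (H \<Otimes>\<^sub>M lam01)"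
    unfolding q_def split_beta' by measurable
  have "distr (PH \<Otimes>\<^sub>M lam01) (H \<Otimes>\<^sub>M borel) (\<lambda>(h, u). (h, q (h, u))) = P" (is "?D = P")
  proof (rule pair_real_measure_eqI_rat)
    interpret PL: pair_prob_space PH lam01 ..
    show "finite_measure ?D" by (rule PL.finite_measure_distr) measurable
    show "finite_measure P" by (rule P.finite_measure_axioms)
    fix A and x :: real assume A[measurable]: "A \<in> sets H"
    have "emeasure ?D (A \<times> {..<x}) = (\<integral>\<^sup>+h. emeasure (distr lam01 borel (\<lambda>u. q (h, u))) (Pair h -` (A \<times> {..<x})) \<partial>PH)"
      by (rule emeasure_fiber_distr[OF lam01.sigma_finite_measure_axioms _ sPH]) measurable
    also have "\<dots> = (\<integral>\<^sup>+h. emeasure lam01 {u \<in> space lam01. quantile (\<lambda>r. \<phi> r h) u < x} * indicator A h \<partial>PH)"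
      by (rule nn_integral_cong, rename_tac h, case_tac "h \<in> A")
         (auto simp: q_def emeasure_distr intro!: arg_cong[where f="emeasure lam01"])
    finally have D: "emeasure ?D (A \<times> {..<x}) = \<dots>" .
    consider "x \<le> 0" | "0 < x" "x \<le> 1" | "1 < x" by linarith
    then show "emeasure ?D (A \<times> {..<x}) = emeasure P (A \<times> {..<x})"
    proof cases
      case 1
      then have e: "{u \<in> space lam01. quantile (\<lambda>r. \<phi> r h) u < x} = {}" for h
        using quantile_range(1) by (auto simp: not_less intro: order_trans)
      have "emeasure P (A \<times> {..<x}) = emeasure P {}"
        by (rule emeasure_eq_AE) (use AE 1 in auto)
      then show ?thesis unfolding D e by simp
    next
      case 2
      obtain r where r: "incseq r" "\<And>n. r n \<in> \<rat> \<inter> {0..<1}" "\<And>n. r n < x" "r \<longlonglongrightarrow> x"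
        by (rule rational_incseq_unit[OF 2]) (rule that)
      \<comment> \<open>The fibre masses of the open half-line are suprema over \<open>r n\<close>,
        so monotone convergence returns the mass of \<open>A \<times> {..<x}\<close>.\<close>
      have "emeasure ?D (A \<times> {..<x}) = (\<integral>\<^sup>+h. (SUP n. \<phi> (r n) h * indicator A h) \<partial>PH)"
        unfolding D
      proof (rule nn_integral_cong_AE)
        show "AE h in PH. emeasure lam01 {u \<in> space lam01. quantile (\<lambda>r. \<phi> r h) u < x} * indicator A h
            = (SUP n. \<phi> (r n) h * indicator A h)"
          using le1 mono
        proof eventually_elim
          case (elim h)
          have "emeasure lam01 {u \<in> space lam01. quantile (\<lambda>r. \<phi> r h) u < x} = (SUP n. \<phi> (r n) h)"
            by (rule emeasure_quantile_less[OF _ _ 2(2) r]) (use elim in auto)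
          then show ?case by (simp add: SUP_mult_right_ennreal)
        qed
      qed
      also have "\<dots> = (SUP n. \<integral>\<^sup>+h. \<phi> (r n) h * indicator A h \<partial>PH)"
      proof (rule nn_integral_monotone_convergence_SUP_AE)
        fix n
        show "AE h in PH. \<phi> (r n) h * indicator A h \<le> \<phi> (r (Suc n)) h * indicator A h"
          using mono
        proof eventually_elim
          case (elim h)
          then have "\<phi> (r n) h \<le> \<phi> (r (Suc n)) h" using r(2)[of n] r(2)[of "Suc n"] incseqD[OF r(1), of n "Suc n"] by auto
          then show ?case by (rule mult_right_mono) simp
        qed
      qed measurable
      also have "\<dots> = (SUP n. emeasure P (A \<times> {..r n}))" by (simp add: int)
      also have "\<dots> = emeasure P (\<Union>n. A \<times> {..r n})"
        by (rule SUP_emeasure_incseq) (use r(1) in \<open>auto simp: incseq_def intro: order_trans\<close>)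
      also have "(\<Union>n. A \<times> {..r n}) = A \<times> {..<x}"
        using incseq_below_covers[OF r(4)] r(3) by (auto intro: le_less_trans) (meson less_imp_le)
      finally show ?thesis .
    next
      case 3
      then have e: "{u \<in> space lam01. quantile (\<lambda>r. \<phi> r h) u < x} = space lam01" for h
        using quantile_range(2) by (auto intro: le_less_trans)
      have "emeasure P (A \<times> {..<x}) = emeasure P (A \<times> UNIV)"
        by (rule emeasure_eq_AE) (use AE 3 in auto)
      then show ?thesis unfolding D e by (simp add: lam01.emeasure_space_1[unfolded space_lam01] PHA)
    qed
  qed (simp_all add: s)
  then show thesis using that[OF qm] by (simp add: PH_def)
qed

text \<open>The value of \<open>g\<close> is replaced by its code, which lies in
  \<open>[0, 1)\<close>; the resulting real randomised function is decoded and realises the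
  conditional law of \<open>g\<close> given \<open>f\<close>.\<close>

lemma disintegration:
  assumes "prob_space M" and [measurable]: "f \<in> M \<rightarrow>\<^sub>M H" "g \<in> M \<rightarrow>\<^sub>M Y" and "std_borel Y"
  shows "\<exists>q. q \<in> H \<Otimes>\<^sub>M lam01 \<rightarrow>\<^sub>M Y \<and>
    distr (distr M H f \<Otimes>\<^sub>M lam01) (H \<Otimes>\<^sub>M Y) (\<lambda>(h, u). (h, q (h, u))) = distr M (H \<Otimes>\<^sub>M Y) (\<lambda>x. (f x, g x))"
proof -
  interpret prob_space M by fact
  obtain e d where [measurable]: "e \<in> borel_measurable Y" "d \<in> borel \<rightarrow>\<^sub>M Y"
    and ed: "\<And>x. x \<in> space Y \<Longrightarrow> e x \<in> thin_set" "\<And>x. x \<in> space Y \<Longrightarrow> d (e x) = x"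
    by (rule std_borelE[OF assms(4)]) (rule that)
  have gY: "x \<in> space M \<Longrightarrow> g x \<in> space Y" for x by (rule measurable_space[OF assms(3)])
  define P where "P = distr M (H \<Otimes>\<^sub>M borel) (\<lambda>x. (f x, e (g x)))"
  have sP: "sets P = sets (H \<Otimes>\<^sub>M borel)" by (simp add: P_def)
  have "prob_space P" unfolding P_def by (rule prob_space_distr) measurable
  moreover have "AE z in P. snd z \<in> {0..<1}"
    unfolding P_def
    by (subst AE_distr_iff) (use subsetD[OF thin_set_subset ed(1)[OF gY]] in \<open>auto intro!: AE_I2\<close>)
  ultimately obtain q where q[measurable]: "q \<in> borel_measurable (H \<Otimes>\<^sub>M lam01)"
    and eq: "distr (distr P H fst \<Otimes>\<^sub>M lam01) (H \<Otimes>\<^sub>M borel) (\<lambda>(h, u). (h, q (h, u))) = P"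
    by (rule disintegration_real[OF _ sP]) (rule that)
  have fst: "distr P H fst = distr M H f" unfolding P_def by (simp add: distr_distr comp_def)
  have "distr (distr M H f \<Otimes>\<^sub>M lam01) (H \<Otimes>\<^sub>M Y) (\<lambda>(h, u). (h, d (q (h, u)))) = distr P (H \<Otimes>\<^sub>M Y) (\<lambda>(h, r). (h, d r))"
    by (subst eq[symmetric], subst distr_distr) (auto simp: fst comp_def split_beta' intro!: distr_cong)
  also have "\<dots> = distr M (H \<Otimes>\<^sub>M Y) (\<lambda>x. (f x, g x))"
    unfolding P_def by (subst distr_distr) (auto simp: ed gY intro!: distr_cong)
  finally show ?thesis by (intro exI[of _ "\<lambda>p. d (q p)"]) auto
qed

text \<open>The product with the uniform law is atomless, so its distribution function along an embedding into
  the real line is an isomorphism modulo null sets onto the unit interval.\<close>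

lemma fiber_isomorphism:
  assumes c[measurable]: "c \<in> H \<Otimes>\<^sub>M lam01 \<rightarrow>\<^sub>M Y" and "std_borel Y"
  obtains f g where "f \<in> H \<Otimes>\<^sub>M lam01 \<rightarrow>\<^sub>M Y \<Otimes>\<^sub>M lam01" "g \<in> H \<Otimes>\<^sub>M (Y \<Otimes>\<^sub>M lam01) \<rightarrow>\<^sub>M lam01"
    "\<And>h. h \<in> space H \<Longrightarrow> distr lam01 (Y \<Otimes>\<^sub>M lam01) (\<lambda>u. f (h, u)) = distr lam01 Y (\<lambda>u. c (h, u)) \<Otimes>\<^sub>M lam01"
    "\<And>h. h \<in> space H \<Longrightarrow> AE u in lam01. g (h, f (h, u)) = u"
proof -
  interpret lam01: prob_space lam01 by (rule prob_space_lam01)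
  define LL where "LL = lam01_sq"
  interpret LL: prob_space LL
    unfolding LL_def by (rule prob_space_pair) (rule prob_space_lam01)+
  have [measurable_cong]: "sets LL = sets lam01_sq" by (simp add: LL_def)
  let ?Z = "Y \<Otimes>\<^sub>M lam01"
  obtain e d where [measurable]: "e \<in> borel_measurable ?Z" "d \<in> borel \<rightarrow>\<^sub>M ?Z"
    and ed: "\<And>x. x \<in> space ?Z \<Longrightarrow> e x \<in> thin_set" "\<And>x. x \<in> space ?Z \<Longrightarrow> d (e x) = x"
    by (rule std_borelE[OF std_borel_pair[OF assms(2) std_borel_lam01]]) (rule that)
  \<comment> \<open>Distribution function, in the fibre over \<open>h\<close>, of the code of
    \<open>(c (h, s), w)\<close> with \<open>s\<close> and \<open>w\<close> independent and uniform.
    Its quantile followed by decoding is \<open>f\<close>; coding followed by the function itself is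
    the inverse \<open>g\<close>.\<close>
  define F where "F h r = emeasure LL {p \<in> space LL. e (c (h, fst p), snd p) \<le> r}" for h and r :: real
  have [measurable]: "(\<lambda>(h, r). F h r) \<in> borel_measurable (H \<Otimes>\<^sub>M borel)"
    unfolding F_def by measurable
  have Fr[measurable]: "(\<lambda>h. F h r) \<in> borel_measurable H" for r by measurable
  have F1: "F h r \<le> 1" for h r unfolding F_def by (rule LL.emeasure_le_1)
  define f where "f = (\<lambda>(h, u). d (quantile (F h) u))"
  define g where "g = (\<lambda>(h, z). enn2real (F h (e z)))"
  have [measurable]: "(\<lambda>(h, u). quantile (F h) u) \<in> borel_measurable (H \<Otimes>\<^sub>M lam01)"
    unfolding split_beta' by measurable
  have fm: "f \<in> H \<Otimes>\<^sub>M lam01 \<rightarrow>\<^sub>M ?Z" unfolding f_def by measurable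
  have gm: "g \<in> H \<Otimes>\<^sub>M ?Z \<rightarrow>\<^sub>M lam01"
  proof (rule measurable_to_lam01)
    show "g \<in> borel_measurable (H \<Otimes>\<^sub>M ?Z)" unfolding g_def by measurable
    show "g x \<in> {0..1}" for x
      using enn2real_mono[OF F1] by (auto simp: g_def split_beta')
  qed
  have fib: "distr lam01 ?Z (\<lambda>u. f (h, u)) = distr lam01 Y (\<lambda>u. c (h, u)) \<Otimes>\<^sub>M lam01 \<and> (AE u in lam01. g (h, f (h, u)) = u)"
    if h: "h \<in> space H" for h
  proof -
    have ch[measurable]: "(\<lambda>u. c (h, u)) \<in> lam01 \<rightarrow>\<^sub>M Y" using h by measurable
    have cs: "s \<in> {0..1} \<Longrightarrow> c (h, s) \<in> space Y" for s using measurable_space[OF ch] by simp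
    have [measurable]: "(\<lambda>p. e (c (h, fst p), snd p)) \<in> borel_measurable LL" using h by measurable
    have [measurable]: "(\<lambda>u. quantile (F h) u) \<in> borel_measurable lam01" by measurable
    define m where "m = distr LL borel (\<lambda>p. e (c (h, fst p), snd p))"
    have sm[measurable_cong]: "sets m = sets borel" by (simp add: m_def)
    have pm: "prob_space m" unfolding m_def by (rule LL.prob_space_distr) measurable
    have spLL: "space LL = {0..1} \<times> {0..1}" by (simp add: LL_def space_pair_measure)
    have in_Z: "p \<in> space LL \<Longrightarrow> (c (h, fst p), snd p) \<in> space ?Z" for p
      using cs by (auto simp: spLL space_pair_measure)
    have AE1: "AE y in m. y \<in> {0..<1}"
      unfolding m_def
      by (subst AE_distr_iff) (use subsetD[OF thin_set_subset ed(1)[OF in_Z]] in \<open>auto intro!: AE_I2\<close>)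
    \<comment> \<open>Decoding and then coding is the identity almost surely, since \<open>m\<close>
      is carried by codes.\<close>
    have AE2: "AE y in m. e (d y) = y"
      unfolding m_def by (subst AE_distr_iff) (use ed(2)[OF in_Z] in \<open>auto intro!: AE_I2\<close>)
    have mF: "emeasure m {..r} = F h r" for r
      unfolding m_def F_def by (subst emeasure_distr) (auto intro!: arg_cong[where f="emeasure LL"])
    then have mF': "(\<lambda>r. emeasure m {..r}) = F h" by auto
    have dq: "distr lam01 borel (quantile (F h)) = m"
      using distr_quantile[OF pm sm AE1] unfolding mF' .
    \<comment> \<open>For fixed \<open>s\<close> a prescribed code \<open>y\<close> fixes the second
      coordinate as \<open>snd (d y)\<close>, a single point of uniform measure zero, whatever atoms
      the law of \<open>c\<close> may have.\<close>
    have atomless: "emeasure m {y} = 0" for y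
    proof -
      let ?S = "{p \<in> space LL. e (c (h, fst p), snd p) = y}"
      have "emeasure m {y} = emeasure LL ?S"
        unfolding m_def by (subst emeasure_distr) (auto intro!: arg_cong[where f="emeasure LL"])
      also have "\<dots> = (\<integral>\<^sup>+s. emeasure lam01 (Pair s -` ?S) \<partial>lam01)"
        unfolding LL_def by (rule lam01.emeasure_pair_measure_alt) (unfold LL_def[symmetric], measurable)
      also have "\<dots> = (\<integral>\<^sup>+s. 0 \<partial>lam01)"
      proof (rule nn_integral_cong)
        fix s assume "s \<in> space lam01"
        have "Pair s -` ?S \<subseteq> {snd (d y)}"
        proof
          fix v assume "v \<in> Pair s -` ?S"
          then have "(s, v) \<in> space LL" "e (c (h, s), v) = y" by auto
          then have "d y = (c (h, s), v)" using ed(2)[OF in_Z[of "(s, v)"]] by auto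
          then show "v \<in> {snd (d y)}" by simp
        qed
        moreover have "{snd (d y)} \<in> sets lam01"
        proof -
          have "snd (d y) \<in> {0..1}"
            using measurable_space[OF \<open>d \<in> borel \<rightarrow>\<^sub>M ?Z\<close>, of y] by (auto simp: space_pair_measure)
          then show ?thesis by (auto simp: sets_lam01 sets_restrict_space intro!: image_eqI[of _ _ "{snd (d y)}"])
        qed
        ultimately have "emeasure lam01 (Pair s -` ?S) \<le> emeasure lam01 {snd (d y)}"
          by (rule emeasure_mono)
        then show "emeasure lam01 (Pair s -` ?S) = 0" by (simp add: emeasure_lam01_singleton)
      qed
      finally show ?thesis by simp
    qed
    have "distr lam01 ?Z (\<lambda>u. f (h, u)) = distr m ?Z d"
      unfolding dq[symmetric] by (subst distr_distr) (auto simp: f_def comp_def)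
    also have "\<dots> = distr LL ?Z (\<lambda>p. (c (h, fst p), snd p))"
      unfolding m_def by (subst distr_distr) (use ed(2)[OF in_Z] in \<open>auto intro!: distr_cong\<close>)
    also have "\<dots> = distr lam01 Y (\<lambda>u. c (h, u)) \<Otimes>\<^sub>M distr lam01 lam01 (\<lambda>u. u)"
      unfolding LL_def
      by (subst pair_measure_distr) (auto simp: split_beta' distr_id lam01.sigma_finite_measure_axioms)
    finally have 1: "distr lam01 ?Z (\<lambda>u. f (h, u)) = distr lam01 Y (\<lambda>u. c (h, u)) \<Otimes>\<^sub>M lam01"
      by (simp add: distr_id)
    have "AE y in distr lam01 borel (quantile (F h)). e (d y) = y" unfolding dq by (rule AE2)
    then have "AE u in lam01. e (d (quantile (F h) u)) = quantile (F h) u"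
      by (subst (asm) AE_distr_iff) auto
    with AE_space have "AE u in lam01. g (h, f (h, u)) = u"
    proof eventually_elim
      case (elim u)
      then have u: "u \<in> {0..1}" by simp
      have "F h (quantile (F h) u) = ennreal u"
        using emeasure_atMost_quantile[OF pm sm AE1 atomless u] unfolding mF' mF .
      then show ?case using elim(2) u by (simp add: g_def f_def)
    qed
    with 1 show ?thesis by blast
  qed
  show thesis
    by (rule that[OF fm gm]) (use fib in blast)+
qed

section \<open>The one-step isomorphism\<close>

lemma std_borel_nonempty: "std_borel M \<Longrightarrow> space M \<noteq> {}"
  unfolding std_borel_def using measurable_space[of _ borel M "0 :: real"] by fastforce

text \<open>Here \<open>F\<close> injects all of \<open>A\<close> into every fibre of
  \<open>Q\<close>, and \<open>G\<close> all of \<open>B\<close> into every fibre of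
  \<open>P\<close>, so the classical argument runs in each fibre with the same maps. The left
  inverses turn membership in an image into an equation such as \<open>G (G' a) = a\<close>, which
  keeps every set measurable jointly in \<open>h\<close>.\<close>

lemma measurable_schroeder_bernstein:
  assumes A: "std_borel A" and B: "std_borel B"
    and [measurable]: "P \<in> sets (H \<Otimes>\<^sub>M A)" "Q \<in> sets (H \<Otimes>\<^sub>M B)"
    and [measurable]: "F \<in> A \<rightarrow>\<^sub>M B" "F' \<in> B \<rightarrow>\<^sub>M A" "G \<in> B \<rightarrow>\<^sub>M A" "G' \<in> A \<rightarrow>\<^sub>M B"
    and F: "\<And>a. a \<in> space A \<Longrightarrow> F' (F a) = a" "\<And>h a. h \<in> space H \<Longrightarrow> a \<in> space A \<Longrightarrow> (h, F a) \<in> Q"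
    and G: "\<And>b. b \<in> space B \<Longrightarrow> G' (G b) = b" "\<And>h b. h \<in> space H \<Longrightarrow> b \<in> space B \<Longrightarrow> (h, G b) \<in> P"
  obtains T S where "T \<in> H \<Otimes>\<^sub>M A \<rightarrow>\<^sub>M B" "S \<in> H \<Otimes>\<^sub>M B \<rightarrow>\<^sub>M A"
    "\<And>h a. (h, a) \<in> P \<Longrightarrow> (h, T (h, a)) \<in> Q \<and> S (h, T (h, a)) = a"
    "\<And>h b. (h, b) \<in> Q \<Longrightarrow> (h, S (h, b)) \<in> P \<and> T (h, S (h, b)) = b"
proof -
  have PH: "h \<in> space H \<and> a \<in> space A" if "(h, a) \<in> P" for h a
    using that sets.sets_into_space[OF assms(3)] by (auto simp: space_pair_measure)
  have QH: "h \<in> space H \<and> b \<in> space B" if "(h, b) \<in> Q" for h b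
    using that sets.sets_into_space[OF assms(4)] by (auto simp: space_pair_measure)
  note eqA[measurable (raw)] = measurable_pred_eq_std_borel[OF A] and eqB[measurable (raw)] = measurable_pred_eq_std_borel[OF B]
  \<comment> \<open>The predicates \<open>E n\<close> describe the classical orbit sets: the points
    of \<open>P\<close> that are not images under \<open>G\<close> of points of \<open>Q\<close>,
    and their iterated images under \<open>G\<close> after \<open>F\<close>.\<close>
  define step where "step E = (\<lambda>(h, a). G (G' a) = a \<and> F (F' (G' a)) = G' a \<and> E (h, F' (G' a)))"
    for E :: "'c \<times> 'a \<Rightarrow> bool"
  define E where "E n = (step ^^ n) (\<lambda>(h, a). (h, a) \<in> P \<and> \<not> ((h, G' a) \<in> Q \<and> G (G' a) = a))" for n
  have E0: "E 0 (h, a) \<longleftrightarrow> (h, a) \<in> P \<and> \<not> ((h, G' a) \<in> Q \<and> G (G' a) = a)" for h a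
    by (simp add: E_def)
  have ES: "E (Suc n) (h, a) \<longleftrightarrow> G (G' a) = a \<and> F (F' (G' a)) = G' a \<and> E n (h, F' (G' a))" for n h a
    by (simp add: E_def step_def)
  have Em[measurable]: "Measurable.pred (H \<Otimes>\<^sub>M A) (E n)" for n
  proof (induction n)
    case 0
    have "Measurable.pred (H \<Otimes>\<^sub>M A) (\<lambda>(h, a). (h, a) \<in> P \<and> \<not> ((h, G' a) \<in> Q \<and> G (G' a) = a))" by measurable
    then show ?case by (simp add: E_def)
  next
    case (Suc n)
    note this[measurable]
    have "Measurable.pred (H \<Otimes>\<^sub>M A) (\<lambda>(h, a). G (G' a) = a \<and> F (F' (G' a)) = G' a \<and> E n (h, F' (G' a)))" by measurable
    moreover have "E (Suc n) = (\<lambda>(h, a). G (G' a) = a \<and> F (F' (G' a)) = G' a \<and> E n (h, F' (G' a)))"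
      using ES by auto
    ultimately show ?case by simp
  qed
  have EP: "h \<in> space H \<Longrightarrow> a \<in> space A \<Longrightarrow> E n (h, a) \<Longrightarrow> (h, a) \<in> P" for n h a
  proof (induction n)
    case (Suc n)
    have "G' a \<in> space B" using Suc.prems by (intro measurable_space[OF assms(8)])
    then show ?case using Suc.prems G(2)[of h "G' a"] by (simp add: ES)
  qed (simp add: E0)
  define T where "T = (\<lambda>(h, a). if \<exists>n. E n (h, a) then F a else G' a)"
  define S where "S = (\<lambda>(h, b). if F (F' b) = b \<and> (\<exists>n. E n (h, F' b)) then F' b else G b)"
  show thesis
  proof
    show "T \<in> H \<Otimes>\<^sub>M A \<rightarrow>\<^sub>M B" unfolding T_def by measurable
    show "S \<in> H \<Otimes>\<^sub>M B \<rightarrow>\<^sub>M A" unfolding S_def by measurable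
  next
    fix h a assume P: "(h, a) \<in> P"
    note h = PH[OF P]
    show "(h, T (h, a)) \<in> Q \<and> S (h, T (h, a)) = a"
    proof (cases "\<exists>n. E n (h, a)")
      case True
      then show ?thesis using F h by (auto simp: T_def S_def)
    next
      case False
      then have "\<not> E 0 (h, a)" by blast
      then have *: "(h, G' a) \<in> Q" "G (G' a) = a" using P by (auto simp: E0)
      have "\<not> (F (F' (G' a)) = G' a \<and> (\<exists>n. E n (h, F' (G' a))))"
        using False ES * by blast
      then show ?thesis using * False by (auto simp: T_def S_def)
    qed
  next
    fix h b assume Q: "(h, b) \<in> Q"
    note h = QH[OF Q]
    show "(h, S (h, b)) \<in> P \<and> T (h, S (h, b)) = b"
    proof (cases "F (F' b) = b \<and> (\<exists>n. E n (h, F' b))")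
      case True
      moreover have "F' b \<in> space A" using h by (intro measurable_space[OF assms(6)]) auto
      ultimately show ?thesis using EP h by (auto simp: T_def S_def)
    next
      case False
      \<comment> \<open>A point \<open>G b\<close> over \<open>Q\<close> cannot start an orbit, and
        entering one later would mean that \<open>b\<close> is the image under \<open>F\<close> of
        an orbit point, which is the other case.\<close>
      have "\<not> E n (h, G b)" for n
        using False Q h G by (cases n) (auto simp: E0 ES)
      then show ?thesis using False G h by (auto simp: T_def S_def)
    qed
  qed
qed

section \<open>Composing isomorphisms modulo null sets\<close>

lemma distr_pair_assoc:
  assumes "prob_space M" "prob_space N" "prob_space K"
  shows "distr (M \<Otimes>\<^sub>M (N \<Otimes>\<^sub>M K)) ((M \<Otimes>\<^sub>M N) \<Otimes>\<^sub>M K) (\<lambda>(x, (y, z)). ((x, y), z)) = (M \<Otimes>\<^sub>M N) \<Otimes>\<^sub>M K"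
proof (rule pair_measure_eqI[symmetric])
  interpret M: prob_space M by fact
  interpret N: prob_space N by fact
  interpret K: prob_space K by fact
  interpret NK: pair_prob_space N K ..
  interpret MN: pair_prob_space M N ..
  show "sigma_finite_measure (M \<Otimes>\<^sub>M N)" "sigma_finite_measure K" by unfold_locales
  fix A B assume [measurable]: "A \<in> sets (M \<Otimes>\<^sub>M N)" "B \<in> sets K"
  let ?f = "\<lambda>(x, (y, z)). ((x, y), z)"
  let ?S = "?f -` (A \<times> B) \<inter> space (M \<Otimes>\<^sub>M (N \<Otimes>\<^sub>M K))"
  have "emeasure (distr (M \<Otimes>\<^sub>M (N \<Otimes>\<^sub>M K)) ((M \<Otimes>\<^sub>M N) \<Otimes>\<^sub>M K) ?f) (A \<times> B) = emeasure (M \<Otimes>\<^sub>M (N \<Otimes>\<^sub>M K)) ?S"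
    by (rule emeasure_distr) measurable
  also have "\<dots> = (\<integral>\<^sup>+x. emeasure (N \<Otimes>\<^sub>M K) (Pair x -` ?S) \<partial>M)"
    by (rule NK.P.emeasure_pair_measure_alt) measurable
  also have "\<dots> = (\<integral>\<^sup>+x. emeasure N (Pair x -` A) * emeasure K B \<partial>M)"
  proof (rule nn_integral_cong)
    fix x assume "x \<in> space M"
    then have "Pair x -` ?S = (Pair x -` A) \<times> B"
      using sets.sets_into_space[of A "M \<Otimes>\<^sub>M N"] sets.sets_into_space[of B K]
      by (auto simp: space_pair_measure)
    moreover have "Pair x -` A \<in> sets N" by (rule sets_Pair1) measurable
    ultimately show "emeasure (N \<Otimes>\<^sub>M K) (Pair x -` ?S) = emeasure N (Pair x -` A) * emeasure K B"
      by (simp add: K.emeasure_pair_measure_Times)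
  qed
  also have "\<dots> = emeasure (M \<Otimes>\<^sub>M N) A * emeasure K B"
    by (simp add: nn_integral_multc N.measurable_emeasure_Pair N.emeasure_pair_measure_alt)
  finally show "emeasure (M \<Otimes>\<^sub>M N) A * emeasure K B
      = emeasure (distr (M \<Otimes>\<^sub>M (N \<Otimes>\<^sub>M K)) ((M \<Otimes>\<^sub>M N) \<Otimes>\<^sub>M K) ?f) (A \<times> B)" ..
qed simp_all

text \<open>Both measures are carried to the same law on \<open>C\<close>. That \<open>F'\<close>
  undoes \<open>G'\<close> almost surely is known from \<open>\<beta>\<close>, but as a statement
  about this common law it can be pulled back along \<open>F\<close> to
  \<open>\<alpha>\<close>.\<close>

lemma compose_isomorphisms_mod_null:
  assumes "std_borel A" "std_borel B" "std_borel C"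
    and s[measurable_cong]: "sets \<alpha> = sets A" "sets \<beta> = sets B"
    and [measurable]: "F \<in> A \<rightarrow>\<^sub>M C" "G \<in> C \<rightarrow>\<^sub>M A" "F' \<in> B \<rightarrow>\<^sub>M C" "G' \<in> C \<rightarrow>\<^sub>M B"
    and eq: "distr \<alpha> C F = distr \<beta> C F'"
    and FG: "AE z in \<alpha>. G (F z) = z" and FG': "AE z in \<beta>. G' (F' z) = z"
  shows "distr \<alpha> B (\<lambda>z. G' (F z)) = \<beta>" "AE z in \<alpha>. G (F' (G' (F z))) = z"
proof -
  note [measurable (raw)] = measurable_pred_eq_std_borel[OF assms(1)] measurable_pred_eq_std_borel[OF assms(2)]
    measurable_pred_eq_std_borel[OF assms(3)]
  have "distr \<alpha> B (\<lambda>z. G' (F z)) = distr (distr \<alpha> C F) B G'"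
    by (subst distr_distr) (auto simp: comp_def)
  also have "\<dots> = distr \<beta> B (\<lambda>z. G' (F' z))"
    unfolding eq by (subst distr_distr) (auto simp: comp_def)
  also have "\<dots> = distr \<beta> B (\<lambda>z. z)"
    by (rule distr_cong_AE) (use FG' in auto)
  also have "\<dots> = \<beta>" by (rule distr_id2) (simp add: s)
  finally show "distr \<alpha> B (\<lambda>z. G' (F z)) = \<beta>" .
  have "AE z in \<beta>. F' (G' (F' z)) = F' z" using FG' by eventually_elim simp
  then have "AE c in distr \<alpha> C F. F' (G' c) = c" unfolding eq by (subst AE_distr_iff) auto
  then have "AE z in \<alpha>. F' (G' (F z)) = F z" by (subst (asm) AE_distr_iff) auto
  with FG show "AE z in \<alpha>. G (F' (G' (F z))) = z" by eventually_elim simp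
qed

text \<open>The fibre isomorphism is applied over a random point \<open>a r\<close>: one uniform
  variable \<open>u\<close> is exchanged for \<open>c (a r, s)\<close> together with a fresh uniform
  \<open>w\<close> independent of the pair.\<close>

lemma fiber_isomorphism_joint:
  assumes [measurable]: "a \<in> lam01 \<rightarrow>\<^sub>M X" "c \<in> X \<Otimes>\<^sub>M lam01 \<rightarrow>\<^sub>M Y" "f \<in> X \<Otimes>\<^sub>M lam01 \<rightarrow>\<^sub>M Y \<Otimes>\<^sub>M lam01"
      "g \<in> X \<Otimes>\<^sub>M (Y \<Otimes>\<^sub>M lam01) \<rightarrow>\<^sub>M lam01"
    and f: "\<And>x. x \<in> space X \<Longrightarrow> distr lam01 (Y \<Otimes>\<^sub>M lam01) (\<lambda>u. f (x, u)) = distr lam01 Y (\<lambda>u. c (x, u)) \<Otimes>\<^sub>M lam01"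
    and g: "\<And>x. x \<in> space X \<Longrightarrow> AE u in lam01. g (x, f (x, u)) = u"
  shows "distr (distr lam01_sq (X \<Otimes>\<^sub>M lam01) (\<lambda>(r, u). (a r, u))) (X \<Otimes>\<^sub>M (Y \<Otimes>\<^sub>M lam01)) (\<lambda>(x, u). (x, f (x, u)))
      = distr (distr lam01_sq (X \<Otimes>\<^sub>M Y) (\<lambda>(r, s). (a r, c (a r, s))) \<Otimes>\<^sub>M lam01) (X \<Otimes>\<^sub>M (Y \<Otimes>\<^sub>M lam01)) (\<lambda>((x, y), w). (x, (y, w)))"
      (is "?lhs = ?rhs")
    and "AE z in distr lam01_sq (X \<Otimes>\<^sub>M lam01) (\<lambda>(r, u). (a r, u)). (fst z, g (fst z, f z)) = z"
proof -
  interpret lam01: prob_space lam01 by (rule prob_space_lam01)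
  interpret LL: pair_prob_space lam01 lam01 ..
  let ?Z = "Y \<Otimes>\<^sub>M lam01"
  have ar: "r \<in> {0..1} \<Longrightarrow> a r \<in> space X" for r using measurable_space[OF assms(1)] by simp
  have fib: "distr lam01_sq (lam01 \<Otimes>\<^sub>M ?Z) (\<lambda>(r, u). (r, (\<lambda>(r, u). f (a r, u)) (r, u)))
      = distr (lam01 \<Otimes>\<^sub>M lam01_sq) (lam01 \<Otimes>\<^sub>M ?Z) (\<lambda>(r, p). (r, (\<lambda>(r, (s, w)). (c (a r, s), w)) (r, p)))"
  proof (rule distr_fiber_cong)
    show "AE r in lam01. distr lam01 ?Z (\<lambda>u. (\<lambda>(r, u). f (a r, u)) (r, u))
        = distr lam01_sq ?Z (\<lambda>p. (\<lambda>(r, (s, w)). (c (a r, s), w)) (r, p))"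
    proof (rule AE_I2)
      fix r assume "r \<in> space lam01"
      then have x: "a r \<in> space X" using ar by simp
      have [measurable]: "(\<lambda>u. c (a r, u)) \<in> lam01 \<rightarrow>\<^sub>M Y" using x by measurable
      have "distr lam01 ?Z (\<lambda>u. f (a r, u)) = distr lam01 Y (\<lambda>u. c (a r, u)) \<Otimes>\<^sub>M distr lam01 lam01 (\<lambda>w. w)"
        using f[OF x] by (simp add: distr_id)
      also have "\<dots> = distr lam01_sq ?Z (\<lambda>(s, w). (c (a r, s), w))"
        by (rule pair_measure_distr) (auto simp: distr_id lam01.sigma_finite_measure_axioms)
      finally show "distr lam01 ?Z (\<lambda>u. (\<lambda>(r, u). f (a r, u)) (r, u))
        = distr lam01_sq ?Z (\<lambda>p. (\<lambda>(r, (s, w)). (c (a r, s), w)) (r, p))" by (simp add: split_beta')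
    qed
  qed (auto simp: lam01.sigma_finite_measure_axioms LL.sigma_finite_measure_axioms)
  have "?lhs = distr (distr lam01_sq (lam01 \<Otimes>\<^sub>M ?Z) (\<lambda>(r, u). (r, (\<lambda>(r, u). f (a r, u)) (r, u)))) (X \<Otimes>\<^sub>M ?Z) (\<lambda>(r, z). (a r, z))"
    by (simp add: distr_distr comp_def split_beta')
  also have "\<dots> = distr (lam01 \<Otimes>\<^sub>M lam01_sq) (X \<Otimes>\<^sub>M ?Z) (\<lambda>(r, (s, w)). (a r, (c (a r, s), w)))"
    unfolding fib by (simp add: distr_distr comp_def split_beta')
  also have "\<dots> = distr (distr (lam01 \<Otimes>\<^sub>M lam01_sq) (lam01_sq \<Otimes>\<^sub>M lam01) (\<lambda>(x, (y, z)). ((x, y), z)))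
      (X \<Otimes>\<^sub>M ?Z) (\<lambda>((r, s), w). (a r, (c (a r, s), w)))"
    by (simp add: distr_distr comp_def split_beta')
  also have "\<dots> = distr (lam01_sq \<Otimes>\<^sub>M lam01) (X \<Otimes>\<^sub>M ?Z) (\<lambda>((r, s), w). (a r, (c (a r, s), w)))"
    by (simp only: distr_pair_assoc[OF prob_space_lam01 prob_space_lam01 prob_space_lam01])
  also have "\<dots> = distr (distr (lam01_sq \<Otimes>\<^sub>M lam01) ((X \<Otimes>\<^sub>M Y) \<Otimes>\<^sub>M lam01) (\<lambda>(p, w). ((\<lambda>(r, s). (a r, c (a r, s))) p, w)))
      (X \<Otimes>\<^sub>M ?Z) (\<lambda>((x, y), w). (x, (y, w)))"
    by (simp add: distr_distr comp_def split_beta')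
  also have "distr (lam01_sq \<Otimes>\<^sub>M lam01) ((X \<Otimes>\<^sub>M Y) \<Otimes>\<^sub>M lam01) (\<lambda>(p, w). ((\<lambda>(r, s). (a r, c (a r, s))) p, w))
      = distr lam01_sq (X \<Otimes>\<^sub>M Y) (\<lambda>(r, s). (a r, c (a r, s))) \<Otimes>\<^sub>M distr lam01 lam01 (\<lambda>w. w)"
    by (rule pair_measure_distr[symmetric]) (auto simp: distr_id lam01.sigma_finite_measure_axioms)
  finally show "?lhs = ?rhs" by (simp add: distr_id)
  note [measurable (raw)] = measurable_pred_eq_std_borel[OF std_borel_lam01]
  have "AE p in lam01_sq. g (a (fst p), f (a (fst p), snd p)) = snd p"
    by (rule LL.AE_pair_measure) (use ar g in auto)
  then have "AE z in distr lam01_sq (X \<Otimes>\<^sub>M lam01) (\<lambda>(r, u). (a r, u)). g (fst z, f z) = snd z"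
    by (subst AE_distr_iff) (auto simp: split_beta')
  then show "AE z in distr lam01_sq (X \<Otimes>\<^sub>M lam01) (\<lambda>(r, u). (a r, u)). (fst z, g (fst z, f z)) = z"
    by (simp add: prod_eq_iff)
qed

text \<open>The functions \<open>a\<close> and \<open>c\<close> generate a pair by sampling
  \<open>X\<close> before \<open>Y\<close>, the functions \<open>b\<close> and \<open>d\<close> in
  the opposite order. Invertibility holds at every \<open>h\<close>; laws are identified only where
  both orders produce the same joint law.\<close>

lemma one_step_isomorphism:
  assumes X: "std_borel X" and Y: "std_borel Y"
    and [measurable]: "a \<in> H \<Otimes>\<^sub>M lam01 \<rightarrow>\<^sub>M X" "b \<in> H \<Otimes>\<^sub>M lam01 \<rightarrow>\<^sub>M Y"
      "c \<in> (H \<Otimes>\<^sub>M X) \<Otimes>\<^sub>M lam01 \<rightarrow>\<^sub>M Y" "d \<in> (H \<Otimes>\<^sub>M Y) \<Otimes>\<^sub>M lam01 \<rightarrow>\<^sub>M X"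
  obtains T S where "T \<in> H \<Otimes>\<^sub>M (X \<Otimes>\<^sub>M lam01) \<rightarrow>\<^sub>M Y \<Otimes>\<^sub>M lam01" "S \<in> H \<Otimes>\<^sub>M (Y \<Otimes>\<^sub>M lam01) \<rightarrow>\<^sub>M X \<Otimes>\<^sub>M lam01"
    "\<And>h z. h \<in> space H \<Longrightarrow> z \<in> space (X \<Otimes>\<^sub>M lam01) \<Longrightarrow> S (h, T (h, z)) = z"
    "\<And>h z. h \<in> space H \<Longrightarrow> z \<in> space (Y \<Otimes>\<^sub>M lam01) \<Longrightarrow> T (h, S (h, z)) = z"
    "\<And>h. h \<in> space H \<Longrightarrow>
        distr lam01_sq (X \<Otimes>\<^sub>M Y) (\<lambda>(r, s). (a (h, r), c ((h, a (h, r)), s)))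
        = distr lam01_sq (X \<Otimes>\<^sub>M Y) (\<lambda>(r, s). (d ((h, b (h, r)), s), b (h, r))) \<Longrightarrow>
        distr lam01_sq (Y \<Otimes>\<^sub>M lam01) (\<lambda>(r, u). T (h, (a (h, r), u)))
        = distr lam01_sq (Y \<Otimes>\<^sub>M lam01) (\<lambda>(r, u). (b (h, r), u)) \<and>
        distr lam01_sq (X \<Otimes>\<^sub>M Y) (\<lambda>(r, u). (a (h, r), fst (T (h, (a (h, r), u)))))
        = distr lam01_sq (X \<Otimes>\<^sub>M Y) (\<lambda>(r, s). (a (h, r), c ((h, a (h, r)), s)))"
proof -
  interpret lam01: prob_space lam01 by (rule prob_space_lam01)
  interpret LL: pair_prob_space lam01 lam01 ..
  let ?XY = "X \<Otimes>\<^sub>M Y" and ?A = "X \<Otimes>\<^sub>M lam01" and ?B = "Y \<Otimes>\<^sub>M lam01" and ?L = lam01_sq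
  let ?C = "X \<Otimes>\<^sub>M (Y \<Otimes>\<^sub>M lam01)"
  have A: "std_borel ?A" and B: "std_borel ?B" by (intro std_borel_pair X Y std_borel_lam01)+
  have C: "std_borel ?C" by (intro std_borel_pair X B)
  note [measurable (raw)] = measurable_pred_eq_std_borel[OF A] measurable_pred_eq_std_borel[OF B]
  obtain f g where [measurable]: "f \<in> (H \<Otimes>\<^sub>M X) \<Otimes>\<^sub>M lam01 \<rightarrow>\<^sub>M ?B" "g \<in> (H \<Otimes>\<^sub>M X) \<Otimes>\<^sub>M ?B \<rightarrow>\<^sub>M lam01"
    and f: "\<And>h. h \<in> space (H \<Otimes>\<^sub>M X) \<Longrightarrow> distr lam01 ?B (\<lambda>u. f (h, u)) = distr lam01 Y (\<lambda>u. c (h, u)) \<Otimes>\<^sub>M lam01"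
    and g: "\<And>h. h \<in> space (H \<Otimes>\<^sub>M X) \<Longrightarrow> AE u in lam01. g (h, f (h, u)) = u"
    by (rule fiber_isomorphism[OF assms(5) Y]) (rule that)
  obtain f' g' where [measurable]: "f' \<in> (H \<Otimes>\<^sub>M Y) \<Otimes>\<^sub>M lam01 \<rightarrow>\<^sub>M ?A" "g' \<in> (H \<Otimes>\<^sub>M Y) \<Otimes>\<^sub>M ?A \<rightarrow>\<^sub>M lam01"
    and f': "\<And>h. h \<in> space (H \<Otimes>\<^sub>M Y) \<Longrightarrow> distr lam01 ?A (\<lambda>u. f' (h, u)) = distr lam01 X (\<lambda>u. d (h, u)) \<Otimes>\<^sub>M lam01"
    and g': "\<And>h. h \<in> space (H \<Otimes>\<^sub>M Y) \<Longrightarrow> AE u in lam01. g' (h, f' (h, u)) = u"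
    by (rule fiber_isomorphism[OF assms(6) X]) (rule that)
  \<comment> \<open>\<open>Fc\<close> expands \<open>(x, u)\<close> by sampling \<open>y\<close>
    given \<open>x\<close>, \<open>Fd\<close> expands \<open>(y, v)\<close> by sampling
    \<open>x\<close> given \<open>y\<close>; both list the result as \<open>(x, (y, w))\<close> so
    that they meet in the same space.\<close>
  define Fc where "Fc h = (\<lambda>(x, u). (x, f ((h, x), u)))" for h
  define Gc where "Gc h = (\<lambda>(x, z). (x, g ((h, x), z)))" for h
  define Fd where "Fd h = (\<lambda>(y, v). (fst (f' ((h, y), v)), (y, snd (f' ((h, y), v)))))" for h
  define Gd where "Gd h = (\<lambda>(x, (y, w)). (y, g' ((h, y), (x, w))))" for h
  have [measurable]: "(\<lambda>(h, z). Fc h z) \<in> H \<Otimes>\<^sub>M ?A \<rightarrow>\<^sub>M ?C" "(\<lambda>(h, z). Gc h z) \<in> H \<Otimes>\<^sub>M ?C \<rightarrow>\<^sub>M ?A"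
    "(\<lambda>(h, z). Fd h z) \<in> H \<Otimes>\<^sub>M ?B \<rightarrow>\<^sub>M ?C" "(\<lambda>(h, z). Gd h z) \<in> H \<Otimes>\<^sub>M ?C \<rightarrow>\<^sub>M ?B"
    unfolding Fc_def Gc_def Fd_def Gd_def split_beta' by measurable
  define \<phi> where "\<phi> h z = Gd h (Fc h z)" for h z
  define \<psi> where "\<psi> h z = Gc h (Fd h z)" for h z
  have [measurable]: "(\<lambda>(h, z). \<phi> h z) \<in> H \<Otimes>\<^sub>M ?A \<rightarrow>\<^sub>M ?B" "(\<lambda>(h, z). \<psi> h z) \<in> H \<Otimes>\<^sub>M ?B \<rightarrow>\<^sub>M ?A"
    unfolding \<phi>_def \<psi>_def by measurable
  \<comment> \<open>Bad points: those where the composite is not inverted, together with all points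
    whose uniform coordinate is thin on either side. The symmetric form makes \<open>\<phi>\<close>
    a bijection between the complements of \<open>P\<close> and \<open>Q\<close>, and the thin
    points leave room in every fibre.\<close>
  define P where "P = {p \<in> space (H \<Otimes>\<^sub>M ?A). \<not> (\<psi> (fst p) (\<phi> (fst p) (snd p)) = snd p \<and> snd (snd p) \<notin> thin_set \<and> snd (\<phi> (fst p) (snd p)) \<notin> thin_set)}"
  define Q where "Q = {p \<in> space (H \<Otimes>\<^sub>M ?B). \<not> (\<phi> (fst p) (\<psi> (fst p) (snd p)) = snd p \<and> snd (snd p) \<notin> thin_set \<and> snd (\<psi> (fst p) (snd p)) \<notin> thin_set)}"
  have [measurable]: "P \<in> sets (H \<Otimes>\<^sub>M ?A)" "Q \<in> sets (H \<Otimes>\<^sub>M ?B)"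
    unfolding P_def Q_def by measurable
  obtain ea da where [measurable]: "ea \<in> borel_measurable ?A" "da \<in> borel \<rightarrow>\<^sub>M ?A"
    and eda: "\<And>x. x \<in> space ?A \<Longrightarrow> ea x \<in> thin_set" "\<And>x. x \<in> space ?A \<Longrightarrow> da (ea x) = x"
    by (rule std_borelE[OF A]) (rule that)
  obtain eb db where [measurable]: "eb \<in> borel_measurable ?B" "db \<in> borel \<rightarrow>\<^sub>M ?B"
    and edb: "\<And>x. x \<in> space ?B \<Longrightarrow> eb x \<in> thin_set" "\<And>x. x \<in> space ?B \<Longrightarrow> db (eb x) = x"
    by (rule std_borelE[OF B]) (rule that)
  obtain x0 y0 where x0[measurable]: "x0 \<in> space X" and y0[measurable]: "y0 \<in> space Y"
    using std_borel_nonempty[OF X] std_borel_nonempty[OF Y] by blast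
  have thin01: "r \<in> thin_set \<Longrightarrow> r \<in> {0..1}" for r using thin_set_subset by force
  have [measurable]: "ea \<in> ?A \<rightarrow>\<^sub>M lam01" "eb \<in> ?B \<rightarrow>\<^sub>M lam01"
    using eda(1) edb(1) thin01 by (auto intro!: measurable_to_lam01)
  obtain T0 S0 where [measurable]: "T0 \<in> H \<Otimes>\<^sub>M ?A \<rightarrow>\<^sub>M ?B" "S0 \<in> H \<Otimes>\<^sub>M ?B \<rightarrow>\<^sub>M ?A"
    and T0: "\<And>h z. (h, z) \<in> P \<Longrightarrow> (h, T0 (h, z)) \<in> Q \<and> S0 (h, T0 (h, z)) = z"
    and S0: "\<And>h z. (h, z) \<in> Q \<Longrightarrow> (h, S0 (h, z)) \<in> P \<and> T0 (h, S0 (h, z)) = z"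
  \<comment> \<open>A whole space is placed over one base point \<open>y0\<close> or
    \<open>x0\<close>, its code serving as the uniform coordinate; thin codes put it inside the
    exceptional set of every fibre.\<close>
  proof (rule measurable_schroeder_bernstein[OF A B, of P H Q "\<lambda>z. (y0, ea z)" "\<lambda>z. da (snd z)" "\<lambda>z. (x0, eb z)" "\<lambda>z. db (snd z)"])
    show "(h, y0, ea z) \<in> Q" if "h \<in> space H" "z \<in> space ?A" for h z
      using that eda(1)[OF that(2)] y0 thin01 by (auto simp: Q_def space_pair_measure)
    show "(h, x0, eb z) \<in> P" if "h \<in> space H" "z \<in> space ?B" for h z
      using that edb(1)[OF that(2)] x0 thin01 by (auto simp: P_def space_pair_measure)
  qed (use eda edb that in auto)
  define T where "T p = (if p \<in> P then T0 p else \<phi> (fst p) (snd p))" for p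
  define S where "S p = (if p \<in> Q then S0 p else \<psi> (fst p) (snd p))" for p
  have Tm[measurable]: "T \<in> H \<Otimes>\<^sub>M ?A \<rightarrow>\<^sub>M ?B" unfolding T_def by measurable
  show thesis
  proof
    show "T \<in> H \<Otimes>\<^sub>M ?A \<rightarrow>\<^sub>M ?B" by (rule Tm)
    show "S \<in> H \<Otimes>\<^sub>M ?B \<rightarrow>\<^sub>M ?A" unfolding S_def by measurable
  next
    fix h z assume h: "h \<in> space H" and z: "z \<in> space ?A"
    show "S (h, T (h, z)) = z"
    proof (cases "(h, z) \<in> P")
      case True then show ?thesis using T0 by (auto simp: T_def S_def)
    next
      case False
      then have *: "\<psi> h (\<phi> h z) = z" "snd z \<notin> thin_set" "snd (\<phi> h z) \<notin> thin_set"
        using h z by (auto simp: P_def space_pair_measure)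
      \<comment> \<open>Applying \<open>\<phi> h\<close> to \<open>\<psi> h (\<phi> h z) = z\<close>
        gives the equation required at \<open>\<phi> h z\<close>, and the two thinness conditions
        exchange roles.\<close>
      then have "(h, \<phi> h z) \<notin> Q" by (auto simp: Q_def)
      then show ?thesis using False * by (simp add: T_def S_def)
    qed
  next
    fix h z assume h: "h \<in> space H" and z: "z \<in> space ?B"
    show "T (h, S (h, z)) = z"
    proof (cases "(h, z) \<in> Q")
      case True then show ?thesis using S0 by (auto simp: T_def S_def)
    next
      case False
      then have *: "\<phi> h (\<psi> h z) = z" "snd z \<notin> thin_set" "snd (\<psi> h z) \<notin> thin_set"
        using h z by (auto simp: Q_def space_pair_measure)
      then have "(h, \<psi> h z) \<notin> P" by (auto simp: P_def)
      then show ?thesis using False * by (simp add: T_def S_def)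
    qed
  next
    fix h assume h[measurable]: "h \<in> space H"
      and eq: "distr ?L ?XY (\<lambda>(r, s). (a (h, r), c ((h, a (h, r)), s)))
        = distr ?L ?XY (\<lambda>(r, s). (d ((h, b (h, r)), s), b (h, r)))"
    define \<alpha> where "\<alpha> = distr ?L ?A (\<lambda>(r, u). (a (h, r), u))"
    define \<beta> where "\<beta> = distr ?L ?B (\<lambda>(r, u). (b (h, r), u))"
    have s[measurable_cong]: "sets \<alpha> = sets ?A" "sets \<beta> = sets ?B" by (simp_all add: \<alpha>_def \<beta>_def)
    have [measurable]: "Fc h \<in> ?A \<rightarrow>\<^sub>M ?C" "Gc h \<in> ?C \<rightarrow>\<^sub>M ?A" "Fd h \<in> ?B \<rightarrow>\<^sub>M ?C" "Gd h \<in> ?C \<rightarrow>\<^sub>M ?B"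
      unfolding Fc_def Gc_def Fd_def Gd_def split_beta' by measurable
    have [measurable]: "\<phi> h \<in> ?A \<rightarrow>\<^sub>M ?B" unfolding \<phi>_def by measurable
    have [measurable]: "(\<lambda>z. T (h, z)) \<in> ?A \<rightarrow>\<^sub>M ?B" by measurable
    define \<gamma> where "\<gamma> = distr ?L ?XY (\<lambda>(r, s). (a (h, r), c ((h, a (h, r)), s)))"
    have sg[measurable_cong]: "sets \<gamma> = sets ?XY" by (simp add: \<gamma>_def)
    have FG: "distr \<alpha> ?C (Fc h) = distr (\<gamma> \<Otimes>\<^sub>M lam01) ?C (\<lambda>((x, y), w). (x, (y, w)))"
        "AE z in \<alpha>. Gc h (Fc h z) = z"
    proof -
      have ph: "x \<in> space X \<Longrightarrow> (h, x) \<in> space (H \<Otimes>\<^sub>M X)" for x using h by (simp add: space_pair_measure)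
      note J = fiber_isomorphism_joint[of "\<lambda>r. a (h, r)" X "\<lambda>(x, s). c ((h, x), s)" Y "\<lambda>(x, s). f ((h, x), s)"
        "\<lambda>(x, z). g ((h, x), z)"]
      show "distr \<alpha> ?C (Fc h) = distr (\<gamma> \<Otimes>\<^sub>M lam01) ?C (\<lambda>((x, y), w). (x, (y, w)))"
        using J(1) f[OF ph] g[OF ph] unfolding \<alpha>_def \<gamma>_def Fc_def by simp
      show "AE z in \<alpha>. Gc h (Fc h z) = z"
        using J(2) f[OF ph] g[OF ph] unfolding \<alpha>_def Fc_def Gc_def by (simp add: split_beta')
    qed
    have FG': "distr \<beta> ?C (Fd h) = distr (\<gamma> \<Otimes>\<^sub>M lam01) ?C (\<lambda>((x, y), w). (x, (y, w)))"
        "AE z in \<beta>. Gd h (Fd h z) = z"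
    proof -
      have ph: "y \<in> space Y \<Longrightarrow> (h, y) \<in> space (H \<Otimes>\<^sub>M Y)" for y using h by (simp add: space_pair_measure)
      note J = fiber_isomorphism_joint[of "\<lambda>r. b (h, r)" Y "\<lambda>(y, s). d ((h, y), s)" X "\<lambda>(y, s). f' ((h, y), s)"
        "\<lambda>(y, z). g' ((h, y), z)"]
      \<comment> \<open>Sampling \<open>y\<close> before \<open>x\<close> yields the coupling with
        its factors exchanged; the assumed equality of laws says that swapping returns
        \<open>\<gamma>\<close>.\<close>
      define \<gamma>' where "\<gamma>' = distr ?L (Y \<Otimes>\<^sub>M X) (\<lambda>(r, s). (b (h, r), d ((h, b (h, r)), s)))"
      have sg'[measurable_cong]: "sets \<gamma>' = sets (Y \<Otimes>\<^sub>M X)" by (simp add: \<gamma>'_def)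
      have \<gamma>: "\<gamma> = distr \<gamma>' ?XY (\<lambda>(y, x). (x, y))"
        unfolding \<gamma>_def eq \<gamma>'_def by (simp add: distr_distr comp_def split_beta')
      have "distr \<beta> (Y \<Otimes>\<^sub>M ?A) (\<lambda>(y, v). (y, f' ((h, y), v))) = distr (\<gamma>' \<Otimes>\<^sub>M lam01) (Y \<Otimes>\<^sub>M ?A) (\<lambda>((y, x), w). (y, (x, w)))"
        using J(1) f'[OF ph] g'[OF ph] unfolding \<beta>_def \<gamma>'_def by simp
      then have "distr (distr \<beta> (Y \<Otimes>\<^sub>M ?A) (\<lambda>(y, v). (y, f' ((h, y), v)))) ?C (\<lambda>(y, (x, w)). (x, (y, w)))
        = distr (distr (\<gamma>' \<Otimes>\<^sub>M lam01) (Y \<Otimes>\<^sub>M ?A) (\<lambda>((y, x), w). (y, (x, w)))) ?C (\<lambda>(y, (x, w)). (x, (y, w)))"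
        by simp
      moreover have "distr (distr \<beta> (Y \<Otimes>\<^sub>M ?A) (\<lambda>(y, v). (y, f' ((h, y), v)))) ?C (\<lambda>(y, (x, w)). (x, (y, w))) = distr \<beta> ?C (Fd h)"
        by (simp add: distr_distr comp_def split_beta' Fd_def)
      moreover have "distr (distr (\<gamma>' \<Otimes>\<^sub>M lam01) (Y \<Otimes>\<^sub>M ?A) (\<lambda>((y, x), w). (y, (x, w)))) ?C (\<lambda>(y, (x, w)). (x, (y, w)))
        = distr (\<gamma> \<Otimes>\<^sub>M lam01) ?C (\<lambda>((x, y), w). (x, (y, w)))"
      proof -
        have "\<gamma> \<Otimes>\<^sub>M lam01 = distr \<gamma>' ?XY (\<lambda>(y, x). (x, y)) \<Otimes>\<^sub>M distr lam01 lam01 (\<lambda>w. w)"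
          by (simp add: \<gamma> distr_id)
        also have "\<dots> = distr (\<gamma>' \<Otimes>\<^sub>M lam01) (?XY \<Otimes>\<^sub>M lam01) (\<lambda>(p, w). ((\<lambda>(y, x). (x, y)) p, w))"
          by (rule pair_measure_distr) (auto simp: distr_id lam01.sigma_finite_measure_axioms)
        finally show ?thesis by (simp add: distr_distr comp_def split_beta')
      qed
      ultimately show "distr \<beta> ?C (Fd h) = distr (\<gamma> \<Otimes>\<^sub>M lam01) ?C (\<lambda>((x, y), w). (x, (y, w)))" by simp
      show "AE z in \<beta>. Gd h (Fd h z) = z"
        using J(2) f'[OF ph] g'[OF ph] unfolding \<beta>_def Fd_def Gd_def by (simp add: split_beta')
    qed
    have iso: "distr \<alpha> ?B (\<phi> h) = \<beta>" "AE z in \<alpha>. \<psi> h (\<phi> h z) = z"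
    proof -
      note K = compose_isomorphisms_mod_null[OF A B C s, of "Fc h" "Gc h" "Fd h" "Gd h"]
      have e: "distr \<alpha> ?C (Fc h) = distr \<beta> ?C (Fd h)" using FG(1) FG'(1) by simp
      show "distr \<alpha> ?B (\<phi> h) = \<beta>" using K(1)[OF _ _ _ _ e FG(2) FG'(2)] unfolding \<phi>_def by simp
      show "AE z in \<alpha>. \<psi> h (\<phi> h z) = z" using K(2)[OF _ _ _ _ e FG(2) FG'(2)] unfolding \<phi>_def \<psi>_def by simp
    qed
    \<comment> \<open>The second coordinate is uniform under \<open>\<alpha>\<close> and under its
      image \<open>\<beta>\<close>, so thin values are null on both sides and the repaired map
      agrees with \<open>\<phi> h\<close> almost surely.\<close>
    have thin: "AE p in ?L. snd p \<notin> thin_set"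
      by (rule LL.AE_pair_measure) (use AE_lam01_not_thin in auto)
    have "AE z in \<alpha>. snd z \<notin> thin_set"
      unfolding \<alpha>_def using thin by (subst AE_distr_iff) (auto simp: split_beta')
    moreover have "AE z in \<alpha>. snd (\<phi> h z) \<notin> thin_set"
    proof -
      have "AE z in distr \<alpha> ?B (\<phi> h). snd z \<notin> thin_set"
        unfolding iso(1) \<beta>_def using thin by (subst AE_distr_iff) (auto simp: split_beta')
      then show ?thesis by (subst (asm) AE_distr_iff) auto
    qed
    ultimately have T\<phi>: "AE z in \<alpha>. T (h, z) = \<phi> h z"
      using iso(2)
    proof eventually_elim
      case (elim z) then show ?case by (simp add: T_def P_def)
    qed
    have "distr ?L ?B (\<lambda>(r, u). T (h, (a (h, r), u))) = distr \<alpha> ?B (\<lambda>z. T (h, z))"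
      unfolding \<alpha>_def by (simp add: distr_distr comp_def split_beta')
    also have "\<dots> = distr \<alpha> ?B (\<phi> h)" by (rule distr_cong_AE) (use T\<phi> in auto)
    finally have 1: "distr ?L ?B (\<lambda>(r, u). T (h, (a (h, r), u))) = \<beta>" using iso(1) by simp
    have "distr ?L ?XY (\<lambda>(r, u). (a (h, r), fst (T (h, (a (h, r), u))))) = distr \<alpha> ?XY (\<lambda>z. (fst z, fst (T (h, z))))"
      unfolding \<alpha>_def by (simp add: distr_distr comp_def split_beta')
    also have "\<dots> = distr \<alpha> ?XY (\<lambda>z. (fst z, fst (\<phi> h z)))" by (rule distr_cong_AE) (use T\<phi> in auto)
    also have "\<dots> = distr (distr \<alpha> ?C (Fc h)) ?XY (\<lambda>(x, (y, w)). (x, y))"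
      by (simp add: distr_distr comp_def split_beta' \<phi>_def Fc_def Gd_def)
    also have "\<dots> = distr (\<gamma> \<Otimes>\<^sub>M lam01) \<gamma> fst"
      unfolding FG(1) by (subst distr_distr) (auto simp: comp_def split_beta' sg intro!: distr_cong)
    also have "\<dots> = \<gamma>"
    proof -
      interpret \<gamma>: prob_space \<gamma> unfolding \<gamma>_def by (rule LL.prob_space_distr) measurable
      show ?thesis by (rule lam01.distr_pair_fst)
    qed
    finally show "distr ?L ?B (\<lambda>(r, u). T (h, (a (h, r), u))) = distr ?L ?B (\<lambda>(r, u). (b (h, r), u)) \<and>
        distr ?L ?XY (\<lambda>(r, u). (a (h, r), fst (T (h, (a (h, r), u)))))
        = distr ?L ?XY (\<lambda>(r, s). (a (h, r), c ((h, a (h, r)), s)))"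
      using 1 unfolding \<beta>_def \<gamma>_def by simp
  qed
qed

section \<open>Path spaces\<close>

definition zip_path :: "nat \<Rightarrow> (nat \<Rightarrow> 'a) \<times> (nat \<Rightarrow> real) \<Rightarrow> nat \<Rightarrow> 'a \<times> real" where
  "zip_path n p = (\<lambda>t\<in>{1..n}. (fst p t, snd p t))"

lemma hatmeas_zip_path:
  "hatmeas n TX \<mu> = distr (\<mu> \<Otimes>\<^sub>M PiM {1..n} (\<lambda>_. lam01)) (hatsp n TX) (zip_path n)"
  unfolding hatmeas_def zip_path_def by (simp add: split_beta')

lemma space_Xsp: "space (Xsp n TX) = (\<Pi>\<^sub>E t\<in>{1..n}. space (borel_top (TX t)))"
  by (simp add: Xsp_def pathsp_def space_PiM)

lemma space_hatsp: "space (hatsp n TX) = (\<Pi>\<^sub>E t\<in>{1..n}. space (borel_top (TX t)) \<times> {0..1})"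
  by (simp add: hatsp_def pathsp_def space_PiM space_pair_measure)

lemma measurable_Xsp_component[measurable (raw)]:
  assumes "f \<in> M \<rightarrow>\<^sub>M Xsp n TX" "t \<in> {1..n}"
  shows "(\<lambda>x. f x t) \<in> M \<rightarrow>\<^sub>M borel_top (TX t)"
  using assms unfolding Xsp_def pathsp_def by measurable

lemma measurable_hatsp_component[measurable (raw)]:
  assumes "f \<in> M \<rightarrow>\<^sub>M hatsp n TX" "t \<in> {1..n}"
  shows "(\<lambda>x. f x t) \<in> M \<rightarrow>\<^sub>M borel_top (TX t) \<Otimes>\<^sub>M lam01"
  using assms unfolding hatsp_def pathsp_def by measurable

lemma measurable_zip_path[measurable]:
  "zip_path n \<in> Xsp n TX \<Otimes>\<^sub>M PiM {1..n} (\<lambda>_. lam01) \<rightarrow>\<^sub>M hatsp n TX"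
  unfolding zip_path_def hatsp_def pathsp_def Xsp_def
  by (rule measurable_restrict) measurable

lemmas measurable_zip_path_Suc0[measurable] = measurable_zip_path[unfolded One_nat_def]

lemma measurable_forget[measurable]: "forget n \<in> hatsp n TX \<rightarrow>\<^sub>M Xsp n TX"
  unfolding forget_def hatsp_def pathsp_def Xsp_def by (rule measurable_restrict) measurable

lemma measurable_restrict_Xsp: "m \<le> n \<Longrightarrow> (\<lambda>x. restrict x {1..m}) \<in> Xsp n TX \<rightarrow>\<^sub>M Xsp m TX"
  unfolding Xsp_def pathsp_def by (rule measurable_restrict_subset) auto

lemma measurable_restrict_hatsp: "m \<le> n \<Longrightarrow> (\<lambda>x. restrict x {1..m}) \<in> hatsp n TX \<rightarrow>\<^sub>M hatsp m TX"
  unfolding hatsp_def pathsp_def by (rule measurable_restrict_subset) auto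

lemma measurable_upd_Xsp:
  assumes "f \<in> M \<rightarrow>\<^sub>M Xsp n TX" "g \<in> M \<rightarrow>\<^sub>M borel_top (TX (Suc n))"
  shows "(\<lambda>x. (f x)(Suc n := g x)) \<in> M \<rightarrow>\<^sub>M Xsp (Suc n) TX"
  using assms unfolding Xsp_def pathsp_def
  by (intro measurable_fun_upd[of _ "{1..n}"]) (auto simp: atLeastAtMostSuc_conv)

lemma measurable_upd_hatsp:
  assumes "f \<in> M \<rightarrow>\<^sub>M hatsp n TX" "g \<in> M \<rightarrow>\<^sub>M borel_top (TX (Suc n)) \<Otimes>\<^sub>M lam01"
  shows "(\<lambda>x. (f x)(Suc n := g x)) \<in> M \<rightarrow>\<^sub>M hatsp (Suc n) TX"
  using assms unfolding hatsp_def pathsp_def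
  by (intro measurable_fun_upd[of _ "{1..n}"]) (auto simp: atLeastAtMostSuc_conv)

lemma forget_zip_path: "x \<in> space (Xsp n TX) \<Longrightarrow> forget n (zip_path n (x, u)) = x"
  by (auto simp: forget_def zip_path_def space_Xsp PiE_def extensional_def fun_eq_iff)

lemma restrict_upd_path: "z \<in> extensional {1..n} \<Longrightarrow> restrict (z(Suc n := w)) {1..n} = z"
  by (auto simp: extensional_def restrict_def fun_eq_iff)

lemma upd_restrict_path: "a \<in> extensional {1..Suc n} \<Longrightarrow> (restrict a {1..n})(Suc n := a (Suc n)) = a"
  by (auto simp: extensional_def restrict_def fun_eq_iff)

lemma restrict_Suc_path: "(restrict x {1..n})(Suc n := x (Suc n)) = restrict x {1..Suc n}"
  by (auto simp: restrict_def fun_eq_iff)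

lemma extensional_space_Xsp: "x \<in> space (Xsp n TX) \<Longrightarrow> x \<in> extensional {1..n}"
  by (simp add: space_Xsp PiE_def)

lemma extensional_space_hatsp: "x \<in> space (hatsp n TX) \<Longrightarrow> x \<in> extensional {1..n}"
  by (simp add: space_hatsp PiE_def)

lemma prob_space_PiM_lam01: "prob_space (PiM I (\<lambda>_. lam01))"
  by (rule prob_space_PiM) (rule prob_space_lam01)

lemma sets_hatmeas[measurable_cong]: "sets (hatmeas n TX \<mu>) = sets (hatsp n TX)"
  by (simp add: hatmeas_def)

lemma prob_space_hatmeas:
  assumes "prob_space \<mu>" and [measurable_cong]: "sets \<mu> = sets (Xsp n TX)"
  shows "prob_space (hatmeas n TX \<mu>)"
proof -
  interpret prob_space "\<mu> \<Otimes>\<^sub>M PiM {1..n} (\<lambda>_. lam01)"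
    by (rule prob_space_pair[OF assms(1) prob_space_PiM_lam01])
  show ?thesis unfolding hatmeas_zip_path by (rule prob_space_distr) measurable
qed

lemma distr_hatmeas_forget:
  assumes s[measurable_cong]: "sets \<mu> = sets (Xsp n TX)"
  shows "distr (hatmeas n TX \<mu>) (Xsp n TX) (forget n) = \<mu>"
proof -
  interpret L: prob_space "PiM {1..n} (\<lambda>_. lam01)" by (rule prob_space_PiM_lam01)
  have "distr (hatmeas n TX \<mu>) (Xsp n TX) (forget n)
      = distr (\<mu> \<Otimes>\<^sub>M PiM {1..n} (\<lambda>_. lam01)) \<mu> fst"
    unfolding hatmeas_zip_path
    using sets_eq_imp_space_eq[OF s]
    by (subst distr_distr) (auto simp: forget_zip_path space_pair_measure s intro!: distr_cong)
  also have "\<dots> = \<mu>" by (rule L.distr_pair_fst)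
  finally show ?thesis .
qed

section \<open>Transport maps induce bicausal couplings\<close>

text \<open>This covers one direction of causality; the reverse direction comes from applying it to
  the inverse map.\<close>

lemma causal_of_adapted:
  fixes TX :: "nat \<Rightarrow> 'a topology" and TY :: "nat \<Rightarrow> 'b topology"
  assumes mu: "prob_space \<mu>" "sets \<mu> = sets (Xsp N TX)"
    and nu: "sets \<nu> = sets (Xsp N TY)"
    and T: "adapted N (hatsp N TX) (hatsp N TY) T"
    and push: "distr (hatmeas N TX \<mu>) (hatsp N TY) T = hatmeas N TY \<nu>"
    and \<pi>: "\<pi> = distr (hatmeas N TX \<mu>) (Xsp N TX \<Otimes>\<^sub>M Xsp N TY) (\<lambda>a. (forget N a, forget N (T a)))"
  shows "causal N (\<lambda>t. borel_top (TX t)) (\<lambda>t. borel_top (TY t)) \<mu> \<nu> \<pi>"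
proof -
  let ?X = "Xsp N TX" and ?Y = "Xsp N TY" and ?L = "PiM {1..N} (\<lambda>_. lam01)"
  note mu(2)[measurable_cong] nu[measurable_cong]
  interpret \<mu>: prob_space \<mu> by fact
  interpret L: prob_space ?L by (rule prob_space_PiM_lam01)
  interpret \<mu>hat: prob_space "hatmeas N TX \<mu>" by (rule prob_space_hatmeas[OF mu])
  have [measurable]: "T \<in> hatsp N TX \<rightarrow>\<^sub>M hatsp N TY" using T by (simp add: adapted_def)
  have XY: "PiM {1..N} (\<lambda>t. borel_top (TX t)) = ?X" "PiM {1..N} (\<lambda>t. borel_top (TY t)) = ?Y"
    by (simp_all add: Xsp_def pathsp_def)
  have sp\<mu>: "space \<mu> = space ?X" by (rule sets_eq_imp_space_eq[OF mu(2)])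
  have prob\<pi>: "prob_space \<pi>" unfolding \<pi> by (rule \<mu>hat.prob_space_distr) measurable
  have "distr \<pi> ?X fst = distr (hatmeas N TX \<mu>) ?X (forget N)"
    unfolding \<pi> by (subst distr_distr) (auto simp: comp_def)
  then have m1: "distr \<pi> ?X fst = \<mu>" by (simp add: distr_hatmeas_forget[OF mu(2)])
  have "distr \<pi> ?Y snd = distr (distr (hatmeas N TX \<mu>) (hatsp N TY) T) ?Y (forget N)"
    unfolding \<pi> by (simp add: distr_distr comp_def)
  then have m2: "distr \<pi> ?Y snd = \<nu>" by (simp add: push distr_hatmeas_forget[OF nu])
  have Cpl: "\<pi> \<in> Cpl ?X ?Y \<mu> \<nu>"
    unfolding Cpl_def using prob\<pi> m1 m2 by (simp add: \<pi>)
  define \<kappa> where "\<kappa> x = distr ?L ?Y (\<lambda>u. forget N (T (zip_path N (x, u))))" for x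
  have Lp: "(\<lambda>x. ?L) \<in> ?X \<rightarrow>\<^sub>M prob_algebra ?L"
    by (rule measurable_const) (simp add: space_prob_algebra prob_space_PiM_lam01)
  have \<kappa>m[measurable]: "\<kappa> \<in> ?X \<rightarrow>\<^sub>M prob_algebra ?Y"
    unfolding \<kappa>_def by (rule measurable_distr_prob_space2[OF Lp]) measurable
  have um[measurable]: "(\<lambda>u. forget N (T (zip_path N (x, u)))) \<in> ?L \<rightarrow>\<^sub>M ?Y" if "x \<in> space ?X" for x
    using that by measurable
  have bind: "\<pi> = bind \<mu> (\<lambda>x. distr (\<kappa> x) (?X \<Otimes>\<^sub>M ?Y) (\<lambda>y. (x, y)))" (is "_ = ?b")
  proof -
    have km: "(\<lambda>x. distr (\<kappa> x) (?X \<Otimes>\<^sub>M ?Y) (\<lambda>y. (x, y))) \<in> ?X \<rightarrow>\<^sub>M prob_algebra (?X \<Otimes>\<^sub>M ?Y)"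
      by (rule measurable_distr_prob_space2[OF \<kappa>m]) measurable
    have muA: "\<mu> \<in> space (prob_algebra ?X)" using mu by (simp add: space_prob_algebra)
    have km2: "(\<lambda>x. distr (\<kappa> x) (?X \<Otimes>\<^sub>M ?Y) (\<lambda>y. (x, y))) \<in> \<mu> \<rightarrow>\<^sub>M subprob_algebra (?X \<Otimes>\<^sub>M ?Y)"
      using measurable_prob_algebraD[OF km] by measurable
    show ?thesis
    proof (rule measure_eqI)
      show "sets \<pi> = sets ?b"
        using sets_bind_measurable[OF km2 \<mu>.not_empty] by (simp add: \<pi>)
      fix E assume "E \<in> sets \<pi>"
      then have E[measurable]: "E \<in> sets (?X \<Otimes>\<^sub>M ?Y)" by (simp add: \<pi>)
      have "\<pi> = distr (\<mu> \<Otimes>\<^sub>M ?L) (?X \<Otimes>\<^sub>M ?Y) (\<lambda>(x, u). (x, (\<lambda>p. forget N (T (zip_path N p))) (x, u)))"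
        unfolding \<pi> hatmeas_zip_path
        by (subst distr_distr) (auto simp: forget_zip_path space_pair_measure sp\<mu> intro!: distr_cong)
      then have "emeasure \<pi> E = (\<integral>\<^sup>+x. emeasure (distr ?L ?Y (\<lambda>u. forget N (T (zip_path N (x, u))))) (Pair x -` E) \<partial>\<mu>)"
        by (simp only:) (rule emeasure_fiber_distr[OF L.sigma_finite_measure_axioms _ mu(2) E], measurable)
      also have "\<dots> = (\<integral>\<^sup>+x. emeasure (distr (\<kappa> x) (?X \<Otimes>\<^sub>M ?Y) (\<lambda>y. (x, y))) E \<partial>\<mu>)"
      proof (rule nn_integral_cong)
        fix x assume "x \<in> space \<mu>"
        then have x: "x \<in> space ?X" by (simp add: sp\<mu>)
        have [measurable]: "Pair x \<in> ?Y \<rightarrow>\<^sub>M ?X \<Otimes>\<^sub>M ?Y" using x by measurable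
        have "emeasure (distr (\<kappa> x) (?X \<Otimes>\<^sub>M ?Y) (Pair x)) E = emeasure (\<kappa> x) (Pair x -` E \<inter> space ?Y)"
          unfolding \<kappa>_def by (subst emeasure_distr) auto
        also have "Pair x -` E \<inter> space ?Y = Pair x -` E"
          using sets.sets_into_space[OF E] by (auto simp: space_pair_measure)
        finally show "emeasure (distr ?L ?Y (\<lambda>u. forget N (T (zip_path N (x, u))))) (Pair x -` E)
            = emeasure (distr (\<kappa> x) (?X \<Otimes>\<^sub>M ?Y) (\<lambda>y. (x, y))) E"
          by (simp add: \<kappa>_def)
      qed
      also have "\<dots> = emeasure ?b E"
        by (rule emeasure_bind_prob_algebra[OF muA km E, symmetric])
      finally show "emeasure \<pi> E = emeasure ?b E" .
    qed
  qed
  obtain x0 where x0: "x0 \<in> space ?X" using \<mu>.not_empty sp\<mu> by auto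
  have "(\<lambda>x. measure (\<kappa> x) B) \<in> borel_measurable (filt N t (\<lambda>t. borel_top (TX t)))"
    if t: "t \<in> {1..<N}" and B: "B \<in> sets (filt N t (\<lambda>t. borel_top (TY t)))" for t B
  proof -
    let ?F = "filt N t (\<lambda>t. borel_top (TX t))"
    have spF: "space ?F = space ?X" unfolding filt_def XY by simp
    have rY: "(\<lambda>y. restrict y {1..t}) \<in> space ?Y \<rightarrow> space (Xsp t TY)"
      using measurable_space[OF measurable_restrict_Xsp[of t N TY]] t by auto
    have rX: "(\<lambda>y. restrict y {1..t}) \<in> space ?X \<rightarrow> space (Xsp t TX)"
      using measurable_space[OF measurable_restrict_Xsp[of t N TX]] t by auto
    have "B \<in> {(\<lambda>y. restrict y {1..t}) -` A \<inter> space ?Y | A. A \<in> sets (Xsp t TY)}"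
      using B unfolding filt_def XY
      using sets_vimage_algebra2[OF rY] by (simp add: Xsp_def pathsp_def)
    then obtain A where A: "B = (\<lambda>y. restrict y {1..t}) -` A \<inter> space ?Y" "A \<in> sets (Xsp t TY)" by blast
    then have [measurable]: "B \<in> sets ?Y"
      using measurable_sets[OF measurable_restrict_Xsp[of t N TY] A(2)] t by auto
    \<comment> \<open>A fixed path supplies the coordinates after \<open>t\<close>. By adaptedness
      the replacement leaves the first \<open>t\<close> image coordinates unchanged, while
      \<open>ext x\<close> is a function of the first \<open>t\<close> coordinates of
      \<open>x\<close>; hence the kernel is measurable for the filtration.\<close>
    define ext where "ext x = (\<lambda>s\<in>{1..N}. if s \<le> t then x s else x0 s)" for x
    have rF: "(\<lambda>x. restrict x {1..t}) \<in> ?F \<rightarrow>\<^sub>M Xsp t TX"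
      unfolding filt_def XY using measurable_vimage_algebra1[OF rX] by (simp add: Xsp_def pathsp_def)
    have "ext \<in> ?F \<rightarrow>\<^sub>M ?X"
      unfolding Xsp_def pathsp_def ext_def
    proof (rule measurable_restrict)
      fix s assume s: "s \<in> {1..N}"
      show "(\<lambda>x. if s \<le> t then x s else x0 s) \<in> ?F \<rightarrow>\<^sub>M borel_top (TX s)"
      proof (cases "s \<le> t")
        case True
        then have "(\<lambda>x. restrict x {1..t} s) \<in> ?F \<rightarrow>\<^sub>M borel_top (TX s)"
          using s by (intro measurable_Xsp_component[OF rF]) auto
        then show ?thesis using True s by simp
      next
        case False
        then show ?thesis using s x0 by (auto simp: space_Xsp)
      qed
    qed
    then have "(\<lambda>x. measure (\<kappa> (ext x)) B) \<in> borel_measurable ?F"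
      by (rule measurable_compose[where g="\<lambda>x. measure (\<kappa> x) B"]) measurable
    moreover have "measure (\<kappa> (ext x)) B = measure (\<kappa> x) B" if x: "x \<in> space ?F" for x
    proof -
      have x: "x \<in> space ?X" using x spF by simp
      have ex: "ext x \<in> space ?X" using x x0 by (auto simp: ext_def space_Xsp PiE_iff)
      have "forget N (T (zip_path N (ext x, u))) \<in> B \<longleftrightarrow> forget N (T (zip_path N (x, u))) \<in> B"
        if u: "u \<in> space ?L" for u
      proof -
        have z: "zip_path N (x, u) \<in> space (hatsp N TX)" "zip_path N (ext x, u) \<in> space (hatsp N TX)"
          using x ex u by (auto intro!: measurable_space[OF measurable_zip_path] simp: space_pair_measure)
        have "T (zip_path N (ext x, u)) s = T (zip_path N (x, u)) s" if s: "s \<in> {1..t}" for s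
        proof -
          have "s \<in> {1..N}" "\<forall>r\<in>{1..s}. zip_path N (ext x, u) r = zip_path N (x, u) r"
            using s t by (auto simp: zip_path_def ext_def)
          then show ?thesis using T z unfolding adapted_def by blast
        qed
        then have "restrict (forget N (T (zip_path N (ext x, u)))) {1..t} = restrict (forget N (T (zip_path N (x, u)))) {1..t}"
          using t by (auto simp: forget_def restrict_def fun_eq_iff)
        then show ?thesis using measurable_space[OF um[OF x] u] measurable_space[OF um[OF ex] u] by (simp add: A(1))
      qed
      then have "(\<lambda>u. forget N (T (zip_path N (ext x, u)))) -` B \<inter> space ?L = (\<lambda>u. forget N (T (zip_path N (x, u)))) -` B \<inter> space ?L"
        by auto
      then have "emeasure (\<kappa> (ext x)) B = emeasure (\<kappa> x) B"
        unfolding \<kappa>_def emeasure_distr[OF um[OF x] \<open>B \<in> sets ?Y\<close>] emeasure_distr[OF um[OF ex] \<open>B \<in> sets ?Y\<close>] by simp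
      then show ?thesis by (simp add: measure_def)
    qed
    ultimately show ?thesis by (subst measurable_cong[where g="\<lambda>x. measure (\<kappa> (ext x)) B"]) auto
  qed
  then show ?thesis
    unfolding causal_def XY using Cpl \<kappa>m bind by blast
qed

section \<open>Bicausal couplings are induced by transport maps\<close>

text \<open>The level set of \<open>f\<close> through \<open>x\<close> is a preimage under
  \<open>r\<close>, so it contains every point of \<open>S\<close> with the same image as
  \<open>x\<close>.\<close>

lemma measurable_vimage_algebra_fibre:
  fixes f :: "'a \<Rightarrow> real"
  assumes "f \<in> borel_measurable (vimage_algebra S r M)" "r \<in> S \<rightarrow> space M"
    and "x \<in> S" "y \<in> S" "r x = r y"
  shows "f x = f y"
proof -
  have "f -` {f x} \<inter> space (vimage_algebra S r M) \<in> sets (vimage_algebra S r M)"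
    using assms(1) by (rule measurable_sets) simp
  then obtain A where A: "f -` {f x} \<inter> S = r -` A \<inter> S"
    unfolding sets_vimage_algebra2[OF assms(2)] by auto
  then have "x \<in> r -` A" using assms(3) by blast
  then have "y \<in> r -` A \<inter> S" using assms(4,5) by simp
  then show ?thesis unfolding A[symmetric] by simp
qed

lemma nn_integral_disintegrated:
  assumes "\<kappa> \<in> X \<rightarrow>\<^sub>M prob_algebra Y" "prob_space \<mu>" "sets \<mu> = sets X"
    and \<pi>: "\<pi> = bind \<mu> (\<lambda>x. distr (\<kappa> x) (X \<Otimes>\<^sub>M Y) (\<lambda>y. (x, y)))"
    and g[measurable]: "g \<in> borel_measurable (X \<Otimes>\<^sub>M Y)"
  shows "integral\<^sup>N \<pi> g = (\<integral>\<^sup>+x. \<integral>\<^sup>+y. g (x, y) \<partial>\<kappa> x \<partial>\<mu>)"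
proof -
  note assms(3)[measurable_cong]
  have km: "(\<lambda>x. distr (\<kappa> x) (X \<Otimes>\<^sub>M Y) (\<lambda>y. (x, y))) \<in> X \<rightarrow>\<^sub>M prob_algebra (X \<Otimes>\<^sub>M Y)"
    by (rule measurable_distr_prob_space2[OF assms(1)]) measurable
  have km2: "(\<lambda>x. distr (\<kappa> x) (X \<Otimes>\<^sub>M Y) (\<lambda>y. (x, y))) \<in> \<mu> \<rightarrow>\<^sub>M subprob_algebra (X \<Otimes>\<^sub>M Y)"
    using measurable_prob_algebraD[OF km] by measurable
  have "integral\<^sup>N \<pi> g = (\<integral>\<^sup>+x. integral\<^sup>N (distr (\<kappa> x) (X \<Otimes>\<^sub>M Y) (\<lambda>y. (x, y))) g \<partial>\<mu>)"
    unfolding \<pi> by (rule nn_integral_bind[OF g km2])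
  also have "\<dots> = (\<integral>\<^sup>+x. \<integral>\<^sup>+y. g (x, y) \<partial>\<kappa> x \<partial>\<mu>)"
  proof (rule nn_integral_cong)
    fix x assume "x \<in> space \<mu>"
    then have x: "x \<in> space X" using sets_eq_imp_space_eq[OF assms(3)] by simp
    then have "\<kappa> x \<in> space (prob_algebra Y)" by (rule measurable_space[OF assms(1)])
    then have [measurable_cong]: "sets (\<kappa> x) = sets Y" by (simp add: space_prob_algebra)
    show "integral\<^sup>N (distr (\<kappa> x) (X \<Otimes>\<^sub>M Y) (\<lambda>y. (x, y))) g = (\<integral>\<^sup>+y. g (x, y) \<partial>\<kappa> x)"
      using x by (intro nn_integral_distr) measurable
  qed
  finally show ?thesis .
qed

text \<open>Causality makes the next coordinate of the first process conditionally independent of the past of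
  the second one, given its own past.\<close>

lemma causal_next_coordinate:
  fixes TX :: "nat \<Rightarrow> 'a topology" and TY :: "nat \<Rightarrow> 'b topology"
  assumes causal: "causal N (\<lambda>t. borel_top (TX t)) (\<lambda>t. borel_top (TY t)) \<mu> \<nu> \<pi>"
    and mu: "prob_space \<mu>" "sets \<mu> = sets (Xsp N TX)" and n: "n < N"
    and \<alpha>[measurable]: "\<alpha> \<in> Xsp n TX \<Otimes>\<^sub>M lam01 \<rightarrow>\<^sub>M borel_top (TX (Suc n))"
    and dis: "distr (distr \<mu> (Xsp n TX) (\<lambda>x. restrict x {1..n}) \<Otimes>\<^sub>M lam01) (Xsp n TX \<Otimes>\<^sub>M borel_top (TX (Suc n)))
        (\<lambda>(x, u). (x, \<alpha> (x, u)))
      = distr \<mu> (Xsp n TX \<Otimes>\<^sub>M borel_top (TX (Suc n))) (\<lambda>x. (restrict x {1..n}, x (Suc n)))"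
  shows "distr \<pi> ((Xsp n TX \<Otimes>\<^sub>M Xsp n TY) \<Otimes>\<^sub>M borel_top (TX (Suc n)))
        (\<lambda>(x, y). ((restrict x {1..n}, restrict y {1..n}), x (Suc n)))
      = distr (distr \<pi> (Xsp n TX \<Otimes>\<^sub>M Xsp n TY) (\<lambda>(x, y). (restrict x {1..n}, restrict y {1..n})) \<Otimes>\<^sub>M lam01)
        ((Xsp n TX \<Otimes>\<^sub>M Xsp n TY) \<Otimes>\<^sub>M borel_top (TX (Suc n))) (\<lambda>(h, u). (h, \<alpha> (fst h, u)))"
proof -
  note One_nat_def[simp del]
  let ?X = "Xsp N TX" and ?Y = "Xsp N TY" and ?Xn = "Xsp n TX" and ?Yn = "Xsp n TY" and ?Z = "borel_top (TX (Suc n))"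
  let ?rx = "\<lambda>x :: nat \<Rightarrow> 'a. restrict x {1..n}" and ?ry = "\<lambda>y :: nat \<Rightarrow> 'b. restrict y {1..n}"
  have XY: "PiM {1..N} (\<lambda>t. borel_top (TX t)) = ?X" "PiM {1..N} (\<lambda>t. borel_top (TY t)) = ?Y"
    "PiM {1..n} (\<lambda>t. borel_top (TX t)) = ?Xn" "PiM {1..n} (\<lambda>t. borel_top (TY t)) = ?Yn"
    by (simp_all add: Xsp_def pathsp_def)
  note causal = causal[unfolded causal_def XY]
  from causal have Cpl: "\<pi> \<in> Cpl ?X ?Y \<mu> \<nu>" by blast
  from causal obtain \<kappa> where \<kappa>: "\<kappa> \<in> ?X \<rightarrow>\<^sub>M prob_algebra ?Y"
    and \<pi>: "\<pi> = bind \<mu> (\<lambda>x. distr (\<kappa> x) (?X \<Otimes>\<^sub>M ?Y) (\<lambda>y. (x, y)))"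
    and \<kappa>F: "\<forall>t\<in>{1..<N}. \<forall>B\<in>sets (filt N t (\<lambda>t. borel_top (TY t))).
      (\<lambda>x. measure (\<kappa> x) B) \<in> borel_measurable (filt N t (\<lambda>t. borel_top (TX t)))"
    by blast
  have s\<pi>[measurable_cong]: "sets \<pi> = sets (?X \<Otimes>\<^sub>M ?Y)" and p\<pi>: "prob_space \<pi>" using Cpl by (auto simp: Cpl_def)
  note mu(2)[measurable_cong]
  interpret \<mu>: prob_space \<mu> by fact
  interpret \<pi>: prob_space \<pi> by fact
  interpret lam01: prob_space lam01 by (rule prob_space_lam01)
  have sp\<mu>: "space \<mu> = space ?X" by (rule sets_eq_imp_space_eq[OF mu(2)])
  have rm[measurable]: "?rx \<in> ?X \<rightarrow>\<^sub>M ?Xn" "?ry \<in> ?Y \<rightarrow>\<^sub>M ?Yn" "(\<lambda>x. x (Suc n)) \<in> ?X \<rightarrow>\<^sub>M ?Z"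
    using n by (auto intro!: measurable_restrict_Xsp measurable_Xsp_component)
  have rX: "?rx \<in> space ?X \<rightarrow> space ?Xn" using measurable_space[OF rm(1)] by auto
  define \<mu>n where "\<mu>n = distr \<mu> ?Xn ?rx"
  define \<pi>n where "\<pi>n = distr \<pi> (?Xn \<Otimes>\<^sub>M ?Yn) (\<lambda>(x, y). (?rx x, ?ry y))"
  have s[measurable_cong]: "sets \<mu>n = sets ?Xn" "sets \<pi>n = sets (?Xn \<Otimes>\<^sub>M ?Yn)" by (simp_all add: \<mu>n_def \<pi>n_def)
  interpret \<mu>n: prob_space \<mu>n unfolding \<mu>n_def by (rule \<mu>.prob_space_distr) measurable
  interpret \<pi>n: prob_space \<pi>n unfolding \<pi>n_def by (rule \<pi>.prob_space_distr) measurable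
  interpret \<pi>L: pair_prob_space \<pi>n lam01 ..
  obtain x0 where x0: "x0 \<in> space ?X" using \<mu>.not_empty sp\<mu> by auto
  \<comment> \<open>A path of length \<open>n\<close> is completed by a fixed path. Composing with
    this completion turns a function of full paths that depends only on the past into a measurable
    function of the past.\<close>
  define ext where "ext x = (\<lambda>t\<in>{1..N}. if t \<le> n then x t else x0 t)" for x
  have ext[measurable]: "ext \<in> ?Xn \<rightarrow>\<^sub>M ?X"
    unfolding ext_def Xsp_def[of N] pathsp_def
  proof (rule measurable_restrict)
    fix t assume t: "t \<in> {1..N}"
    show "(\<lambda>x. if t \<le> n then x t else x0 t) \<in> ?Xn \<rightarrow>\<^sub>M borel_top (TX t)"
      using t x0 by (cases "t \<le> n") (auto simp: space_Xsp intro!: measurable_Xsp_component)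
  qed
  have kX: "\<kappa> x \<in> space (prob_algebra ?Y)" if "x \<in> space ?X" for x by (rule measurable_space[OF \<kappa> that])
  have \<kappa>s: "sets (\<kappa> x) = sets ?Y" "prob_space (\<kappa> x)" if "x \<in> space ?X" for x
    using kX[OF that] by (simp_all add: space_prob_algebra)
  \<comment> \<open>The past of the second process is moved to the last factor, so that rectangles
    separate an event \<open>E\<close> of the first process from an event \<open>B\<close> of the
    second.\<close>
  have key: "distr \<pi> ((?Xn \<Otimes>\<^sub>M ?Z) \<Otimes>\<^sub>M ?Yn) (\<lambda>(x, y). ((?rx x, x (Suc n)), ?ry y))
    = distr (\<pi>n \<Otimes>\<^sub>M lam01) ((?Xn \<Otimes>\<^sub>M ?Z) \<Otimes>\<^sub>M ?Yn) (\<lambda>p. ((fst (fst p), \<alpha> (fst (fst p), snd p)), snd (fst p)))" (is "?l = ?r")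
  proof (rule pair_measure_eqI_Times)
    show "finite_measure ?l" by (rule \<pi>.finite_measure_distr) measurable
    show "finite_measure ?r" by (rule \<pi>L.finite_measure_distr) measurable
    fix E B assume [measurable]: "E \<in> sets (?Xn \<Otimes>\<^sub>M ?Z)" "B \<in> sets ?Yn"
    define D where "D = ?ry -` B \<inter> space ?Y"
    have D[measurable]: "D \<in> sets ?Y" unfolding D_def by measurable
    define k where "k x = emeasure (\<kappa> x) D" for x
    have km[measurable]: "k \<in> borel_measurable ?X"
      unfolding k_def using measurable_prob_algebraD[OF \<kappa>] by measurable
    define k' where "k' x = k (ext x)" for x
    have k'm[measurable]: "k' \<in> borel_measurable ?Xn" unfolding k'_def by measurable
    have kk': "k x = k' (?rx x)" if x: "x \<in> space ?X" for x
    proof -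
      have ex: "ext (?rx x) \<in> space ?X" using rX x by (intro measurable_space[OF ext]) auto
      have rex: "?rx (ext (?rx x)) = ?rx x" using n by (auto simp: ext_def restrict_def fun_eq_iff)
      interpret A: prob_space "\<kappa> x" by (rule \<kappa>s(2)[OF x])
      interpret B: prob_space "\<kappa> (ext (?rx x))" by (rule \<kappa>s(2)[OF ex])
      have "measure (\<kappa> x) D = measure (\<kappa> (ext (?rx x))) D"
      \<comment> \<open>The definition of causality starts at time 1; at time 0 the past is trivial
        and \<open>D\<close> is empty or everything.\<close>
      proof (cases "n = 0")
        case True
        then have "D = {} \<or> D = space ?Y" by (auto simp: D_def restrict_def)
        then show ?thesis
          using sets_eq_imp_space_eq[OF \<kappa>s(1)[OF x]] sets_eq_imp_space_eq[OF \<kappa>s(1)[OF ex]] A.prob_space B.prob_space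
          by auto
      next
        case False
        then have "n \<in> {1..<N}" using n by simp
        moreover have "D \<in> sets (filt N n (\<lambda>t. borel_top (TY t)))"
          unfolding filt_def XY D_def by (rule in_vimage_algebra) measurable
        ultimately have "(\<lambda>x. measure (\<kappa> x) D) \<in> borel_measurable (filt N n (\<lambda>t. borel_top (TX t)))"
          using \<kappa>F by blast
        then have "(\<lambda>x. measure (\<kappa> x) D) \<in> borel_measurable (vimage_algebra (space ?X) ?rx ?Xn)"
          unfolding filt_def XY .
        from measurable_vimage_algebra_fibre[OF this rX x ex] rex show ?thesis by simp
      qed
      then show ?thesis by (simp add: k_def k'_def A.emeasure_eq_measure B.emeasure_eq_measure)
    qed
    \<comment> \<open>Given \<open>x\<close>, the event \<open>B\<close> has probability
      \<open>k'\<close> of the past of \<open>x\<close>, so it may be exchanged for a weight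
      depending on that past alone.\<close>
    have intD: "(\<integral>\<^sup>+z. f (fst z) * indicator B (?ry (snd z)) \<partial>\<pi>) = (\<integral>\<^sup>+x. f x * k' (?rx x) \<partial>\<mu>)"
      if [measurable]: "f \<in> borel_measurable ?X" for f
    proof -
      have "(\<integral>\<^sup>+z. f (fst z) * indicator B (?ry (snd z)) \<partial>\<pi>)
          = (\<integral>\<^sup>+x. \<integral>\<^sup>+y. f x * indicator B (?ry y) \<partial>\<kappa> x \<partial>\<mu>)"
        by (subst nn_integral_disintegrated[OF \<kappa> mu \<pi>]) auto
      also have "\<dots> = (\<integral>\<^sup>+x. f x * k' (?rx x) \<partial>\<mu>)"
      proof (rule nn_integral_cong)
        fix x assume "x \<in> space \<mu>"
        then have x: "x \<in> space ?X" by (simp add: sp\<mu>)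
        note \<kappa>s(1)[OF x, measurable_cong]
        have "(\<integral>\<^sup>+y. f x * indicator B (?ry y) \<partial>\<kappa> x) = f x * (\<integral>\<^sup>+y. indicator B (?ry y) \<partial>\<kappa> x)"
          by (rule nn_integral_cmult) measurable
        also have "(\<integral>\<^sup>+y. indicator B (?ry y) \<partial>\<kappa> x) = (\<integral>\<^sup>+y. indicator D y \<partial>\<kappa> x)"
          using sets_eq_imp_space_eq[OF \<kappa>s(1)[OF x]] by (intro nn_integral_cong) (auto simp: D_def indicator_def)
        also have "\<dots> = k x" by (simp add: k_def)
        finally show "(\<integral>\<^sup>+y. f x * indicator B (?ry y) \<partial>\<kappa> x) = f x * k' (?rx x)" unfolding kk'[OF x] .
      qed
      finally show ?thesis .
    qed
    define w where "w x = (\<integral>\<^sup>+u. indicator E (x, \<alpha> (x, u)) \<partial>lam01)" for x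
    have wm[measurable]: "w \<in> borel_measurable ?Xn" unfolding w_def by measurable
    \<comment> \<open>The weight replaces \<open>B\<close>; since it does not involve the next
      coordinate, the latter can be replaced by \<open>\<alpha>\<close> and averaged into
      \<open>w\<close>. The same exchange read backwards restores \<open>B\<close>.\<close>
    have "emeasure ?l (E \<times> B) = (\<integral>\<^sup>+z. indicator (E \<times> B) z \<partial>?l)" by simp
    also have "\<dots> = (\<integral>\<^sup>+z. indicator E (?rx (fst z), fst z (Suc n)) * indicator B (?ry (snd z)) \<partial>\<pi>)"
      by (subst nn_integral_distr) (auto simp: split_beta' indicator_times)
    also have "\<dots> = (\<integral>\<^sup>+x. indicator E (?rx x, x (Suc n)) * k' (?rx x) \<partial>\<mu>)"
      by (rule intD[of "\<lambda>x. indicator E (?rx x, x (Suc n))"]) measurable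
    also have "\<dots> = (\<integral>\<^sup>+p. indicator E p * k' (fst p) \<partial>distr \<mu> (?Xn \<Otimes>\<^sub>M ?Z) (\<lambda>x. (?rx x, x (Suc n))))"
      by (subst nn_integral_distr) auto
    also have "\<dots> = (\<integral>\<^sup>+p. indicator E (fst p, \<alpha> p) * k' (fst p) \<partial>(\<mu>n \<Otimes>\<^sub>M lam01))"
      unfolding dis[symmetric] \<mu>n_def[symmetric] by (subst nn_integral_distr) (auto simp: split_beta')
    also have "\<dots> = (\<integral>\<^sup>+x. \<integral>\<^sup>+u. indicator E (x, \<alpha> (x, u)) * k' x \<partial>lam01 \<partial>\<mu>n)"
      by (subst lam01.nn_integral_fst[symmetric]) auto
    also have "\<dots> = (\<integral>\<^sup>+x. w x * k' x \<partial>\<mu>n)"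
    proof (rule nn_integral_cong)
      fix x assume "x \<in> space \<mu>n"
      then have x: "x \<in> space ?Xn" using sets_eq_imp_space_eq[OF s(1)] by simp
      then have "(\<integral>\<^sup>+u. indicator E (x, \<alpha> (x, u)) * k' x \<partial>lam01) = (\<integral>\<^sup>+u. indicator E (x, \<alpha> (x, u)) \<partial>lam01) * k' x"
        by (intro nn_integral_multc) measurable
      then show "(\<integral>\<^sup>+u. indicator E (x, \<alpha> (x, u)) * k' x \<partial>lam01) = w x * k' x" by (simp add: w_def)
    qed
    also have "\<dots> = (\<integral>\<^sup>+x. w (?rx x) * k' (?rx x) \<partial>\<mu>)"
      unfolding \<mu>n_def by (subst nn_integral_distr) auto
    also have "\<dots> = (\<integral>\<^sup>+z. w (?rx (fst z)) * indicator B (?ry (snd z)) \<partial>\<pi>)"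
      by (rule intD[of "\<lambda>x. w (?rx x)", symmetric]) measurable
    also have "\<dots> = (\<integral>\<^sup>+h. w (fst h) * indicator B (snd h) \<partial>\<pi>n)"
      unfolding \<pi>n_def by (subst nn_integral_distr) (auto simp: split_beta')
    also have "\<dots> = (\<integral>\<^sup>+h. \<integral>\<^sup>+u. indicator E (fst h, \<alpha> (fst h, u)) * indicator B (snd h) \<partial>lam01 \<partial>\<pi>n)"
    proof (rule nn_integral_cong)
      fix h assume "h \<in> space \<pi>n"
      then have h: "fst h \<in> space ?Xn" using sets_eq_imp_space_eq[OF s(2)] by (auto simp: space_pair_measure)
      then have "(\<integral>\<^sup>+u. indicator E (fst h, \<alpha> (fst h, u)) * indicator B (snd h) \<partial>lam01)
          = (\<integral>\<^sup>+u. indicator E (fst h, \<alpha> (fst h, u)) \<partial>lam01) * indicator B (snd h)"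
        by (intro nn_integral_multc) measurable
      then show "w (fst h) * indicator B (snd h)
        = (\<integral>\<^sup>+u. indicator E (fst h, \<alpha> (fst h, u)) * indicator B (snd h) \<partial>lam01)" by (simp add: w_def)
    qed
    also have "\<dots> = (\<integral>\<^sup>+p. indicator E (fst (fst p), \<alpha> (fst (fst p), snd p)) * indicator B (snd (fst p)) \<partial>(\<pi>n \<Otimes>\<^sub>M lam01))"
      by (subst lam01.nn_integral_fst[symmetric]) auto
    also have "\<dots> = (\<integral>\<^sup>+z. indicator (E \<times> B) z \<partial>?r)"
      by (subst nn_integral_distr) (auto simp: split_beta' indicator_times)
    also have "\<dots> = emeasure ?r (E \<times> B)" by simp
    finally show "emeasure ?l (E \<times> B) = emeasure ?r (E \<times> B)" .
  qed simp_all
  have "distr \<pi> ((?Xn \<Otimes>\<^sub>M ?Yn) \<Otimes>\<^sub>M ?Z) (\<lambda>(x, y). ((?rx x, ?ry y), x (Suc n)))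
      = distr ?l ((?Xn \<Otimes>\<^sub>M ?Yn) \<Otimes>\<^sub>M ?Z) (\<lambda>((x, z), y). ((x, y), z))"
    by (subst distr_distr) (auto simp: comp_def split_beta')
  also have "\<dots> = distr (\<pi>n \<Otimes>\<^sub>M lam01) ((?Xn \<Otimes>\<^sub>M ?Yn) \<Otimes>\<^sub>M ?Z) (\<lambda>(h, u). (h, \<alpha> (fst h, u)))"
    unfolding key by (subst distr_distr) (auto simp: comp_def split_beta')
  finally show ?thesis unfolding \<pi>n_def .
qed

section \<open>One time step of the enlarged measures\<close>

text \<open>Regroups a past with its new randomisation, and the earlier auxiliary variables with the
  new one, into the enlarged past and two fresh uniform variables.\<close>

lemma distr_pair_interchange:
  assumes "prob_space A" "prob_space B" "prob_space C" "prob_space D"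
  shows "distr ((A \<Otimes>\<^sub>M B) \<Otimes>\<^sub>M (C \<Otimes>\<^sub>M D)) ((A \<Otimes>\<^sub>M C) \<Otimes>\<^sub>M (B \<Otimes>\<^sub>M D)) (\<lambda>p. ((fst (fst p), fst (snd p)), (snd (fst p), snd (snd p))))
    = (A \<Otimes>\<^sub>M C) \<Otimes>\<^sub>M (B \<Otimes>\<^sub>M D)"
proof (rule pair_measure_eqI[symmetric])
  interpret A: prob_space A by fact
  interpret B: prob_space B by fact
  interpret C: prob_space C by fact
  interpret D: prob_space D by fact
  interpret AC: pair_prob_space A C ..
  interpret BD: pair_prob_space B D ..
  interpret CD: pair_prob_space C D ..
  show "sigma_finite_measure (A \<Otimes>\<^sub>M C)" "sigma_finite_measure (B \<Otimes>\<^sub>M D)" by unfold_locales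
  fix E F assume [measurable]: "E \<in> sets (A \<Otimes>\<^sub>M C)" "F \<in> sets (B \<Otimes>\<^sub>M D)"
  let ?f = "\<lambda>p. ((fst (fst p), fst (snd p)), (snd (fst p), snd (snd p)))"
  let ?S = "?f -` (E \<times> F) \<inter> space ((A \<Otimes>\<^sub>M B) \<Otimes>\<^sub>M (C \<Otimes>\<^sub>M D))"
  have [measurable]: "(\<lambda>a. emeasure C (Pair a -` E)) \<in> borel_measurable A" "(\<lambda>b. emeasure D (Pair b -` F)) \<in> borel_measurable B"
    by (auto intro: C.measurable_emeasure_Pair D.measurable_emeasure_Pair)
  have "emeasure (distr ((A \<Otimes>\<^sub>M B) \<Otimes>\<^sub>M (C \<Otimes>\<^sub>M D)) ((A \<Otimes>\<^sub>M C) \<Otimes>\<^sub>M (B \<Otimes>\<^sub>M D)) ?f) (E \<times> F)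
      = emeasure ((A \<Otimes>\<^sub>M B) \<Otimes>\<^sub>M (C \<Otimes>\<^sub>M D)) ?S"
    by (rule emeasure_distr) measurable
  also have "\<dots> = (\<integral>\<^sup>+p. emeasure (C \<Otimes>\<^sub>M D) (Pair p -` ?S) \<partial>(A \<Otimes>\<^sub>M B))"
    by (rule CD.P.emeasure_pair_measure_alt) measurable
  also have "\<dots> = (\<integral>\<^sup>+p. emeasure C (Pair (fst p) -` E) * emeasure D (Pair (snd p) -` F) \<partial>(A \<Otimes>\<^sub>M B))"
  proof (rule nn_integral_cong)
    fix p assume "p \<in> space (A \<Otimes>\<^sub>M B)"
    then have "Pair p -` ?S = (Pair (fst p) -` E) \<times> (Pair (snd p) -` F)"
      using sets.sets_into_space[of E "A \<Otimes>\<^sub>M C"] sets.sets_into_space[of F "B \<Otimes>\<^sub>M D"]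
      by (auto simp: space_pair_measure split_beta')
    moreover have "Pair (fst p) -` E \<in> sets C" "Pair (snd p) -` F \<in> sets D" by (auto intro!: sets_Pair1)
    ultimately show "emeasure (C \<Otimes>\<^sub>M D) (Pair p -` ?S) = emeasure C (Pair (fst p) -` E) * emeasure D (Pair (snd p) -` F)"
      by (simp add: D.emeasure_pair_measure_Times)
  qed
  also have "\<dots> = (\<integral>\<^sup>+a. \<integral>\<^sup>+b. emeasure C (Pair a -` E) * emeasure D (Pair b -` F) \<partial>B \<partial>A)"
    by (subst B.nn_integral_fst[symmetric]) auto
  also have "\<dots> = emeasure (A \<Otimes>\<^sub>M C) E * emeasure (B \<Otimes>\<^sub>M D) F"
    by (simp add: nn_integral_cmult nn_integral_multc C.emeasure_pair_measure_alt D.emeasure_pair_measure_alt)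
  finally show "emeasure (A \<Otimes>\<^sub>M C) E * emeasure (B \<Otimes>\<^sub>M D) F
      = emeasure (distr ((A \<Otimes>\<^sub>M B) \<Otimes>\<^sub>M (C \<Otimes>\<^sub>M D)) ((A \<Otimes>\<^sub>M C) \<Otimes>\<^sub>M (B \<Otimes>\<^sub>M D)) ?f) (E \<times> F)" ..
qed simp_all

text \<open>Two fresh uniform variables are spent: one drives the conditional law of the next
  coordinate through \<open>\<alpha>\<close>, the other is the new auxiliary coordinate. The new
  pair thus depends on the enlarged past only through the path, and not through earlier auxiliary
  coordinates.\<close>

lemma hatmeas_restrict_Suc:
  assumes mu: "prob_space \<mu>" "sets \<mu> = sets (Xsp N TX)" and n: "n < N"
    and \<alpha>[measurable]: "\<alpha> \<in> Xsp n TX \<Otimes>\<^sub>M lam01 \<rightarrow>\<^sub>M borel_top (TX (Suc n))"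
    and dis: "distr (distr \<mu> (Xsp n TX) (\<lambda>x. restrict x {1..n}) \<Otimes>\<^sub>M lam01) (Xsp n TX \<Otimes>\<^sub>M borel_top (TX (Suc n)))
        (\<lambda>(x, u). (x, \<alpha> (x, u)))
      = distr \<mu> (Xsp n TX \<Otimes>\<^sub>M borel_top (TX (Suc n))) (\<lambda>x. (restrict x {1..n}, x (Suc n)))"
  shows "hatmeas (Suc n) TX (distr \<mu> (Xsp (Suc n) TX) (\<lambda>x. restrict x {1..Suc n}))
    = distr (hatmeas n TX (distr \<mu> (Xsp n TX) (\<lambda>x. restrict x {1..n})) \<Otimes>\<^sub>M lam01_sq) (hatsp (Suc n) TX)
      (\<lambda>p. (fst p)(Suc n := (\<alpha> (forget n (fst p), fst (snd p)), snd (snd p))))"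
proof -
  note One_nat_def[simp del] mu(2)[measurable_cong]
  let ?Xn = "Xsp n TX" and ?Z = "borel_top (TX (Suc n))" and ?L = "PiM {1..n} (\<lambda>_. lam01)"
    and ?L' = "PiM {1..Suc n} (\<lambda>_. lam01)" and ?rx = "\<lambda>x. restrict x {1..n}"
  interpret \<mu>: prob_space \<mu> by fact
  interpret lam01: prob_space lam01 by (rule prob_space_lam01)
  interpret L: prob_space ?L by (rule prob_space_PiM_lam01)
  interpret L': prob_space ?L' by (rule prob_space_PiM_lam01)
  have [measurable]: "?rx \<in> Xsp N TX \<rightarrow>\<^sub>M ?Xn" "(\<lambda>x. x (Suc n)) \<in> Xsp N TX \<rightarrow>\<^sub>M ?Z"
    using n by (auto intro!: measurable_restrict_Xsp measurable_Xsp_component)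
  define \<mu>' where "\<mu>' = distr \<mu> (Xsp (Suc n) TX) (\<lambda>x. restrict x {1..Suc n})"
  define \<mu>n where "\<mu>n = distr \<mu> ?Xn ?rx"
  have s\<mu>n[measurable_cong]: "sets \<mu>n = sets ?Xn" by (simp add: \<mu>n_def)
  have sp\<mu>n: "space \<mu>n = space ?Xn" by (rule sets_eq_imp_space_eq[OF s\<mu>n])
  have p\<mu>n: "prob_space \<mu>n" unfolding \<mu>n_def by (rule \<mu>.prob_space_distr) measurable
  have upd[measurable]: "(\<lambda>(x, r). x(Suc n := \<alpha> (x, r))) \<in> ?Xn \<Otimes>\<^sub>M lam01 \<rightarrow>\<^sub>M Xsp (Suc n) TX"
    unfolding split_beta' by (rule measurable_upd_Xsp) measurable
  have upd1[measurable]: "(\<lambda>(x, z). x(Suc n := z)) \<in> ?Xn \<Otimes>\<^sub>M ?Z \<rightarrow>\<^sub>M Xsp (Suc n) TX"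
    unfolding split_beta' by (rule measurable_upd_Xsp) measurable
  have updL[measurable]: "(\<lambda>(U, u). U(Suc n := u)) \<in> ?L \<Otimes>\<^sub>M lam01 \<rightarrow>\<^sub>M ?L'"
    unfolding split_beta' by (rule measurable_fun_upd[of _ "{1..n}"]) (auto simp: atLeastAtMostSuc_conv)
  have upd2[measurable]: "(\<lambda>(z, (r, u)). z(Suc n := (\<alpha> (forget n z, r), u))) \<in> hatsp n TX \<Otimes>\<^sub>M lam01_sq \<rightarrow>\<^sub>M hatsp (Suc n) TX"
    unfolding split_beta' by (rule measurable_upd_hatsp) measurable
  have "\<mu>' = distr \<mu> (Xsp (Suc n) TX) (\<lambda>x. (?rx x)(Suc n := x (Suc n)))"
    unfolding \<mu>'_def restrict_Suc_path ..
  also have "\<dots> = distr (distr \<mu> (?Xn \<Otimes>\<^sub>M ?Z) (\<lambda>x. (?rx x, x (Suc n)))) (Xsp (Suc n) TX) (\<lambda>(x, z). x(Suc n := z))"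
    by (subst distr_distr) (auto simp: comp_def)
  also have "\<dots> = distr (\<mu>n \<Otimes>\<^sub>M lam01) (Xsp (Suc n) TX) (\<lambda>(x, r). x(Suc n := \<alpha> (x, r)))"
    unfolding dis[symmetric] \<mu>n_def[symmetric] by (subst distr_distr) (auto simp: comp_def split_beta')
  finally have 1: "\<mu>' = distr (\<mu>n \<Otimes>\<^sub>M lam01) (Xsp (Suc n) TX) (\<lambda>(x, r). x(Suc n := \<alpha> (x, r)))" .
  have "?L' = PiM (insert (Suc n) {1..n}) (\<lambda>_. lam01)" by (simp add: atLeastAtMostSuc_conv)
  also have "\<dots> = distr (lam01 \<Otimes>\<^sub>M ?L) ?L' (\<lambda>(u, U). U(Suc n := u))"
    using distr_pair_PiM_eq_PiM[of "{1..n}" "\<lambda>_. lam01" "Suc n"] prob_space_lam01 by (simp add: atLeastAtMostSuc_conv)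
  also have "lam01 \<Otimes>\<^sub>M ?L = distr (?L \<Otimes>\<^sub>M lam01) (lam01 \<Otimes>\<^sub>M ?L) (\<lambda>(x, y). (y, x))"
  proof -
    interpret pair_sigma_finite lam01 ?L ..
    show ?thesis by (rule distr_pair_swap)
  qed
  also have "distr \<dots> ?L' (\<lambda>(u, U). U(Suc n := u)) = distr (?L \<Otimes>\<^sub>M lam01) ?L' (\<lambda>(U, u). U(Suc n := u))"
  proof (subst distr_distr)
    have "(\<lambda>p. (snd p)(Suc n := fst p)) \<in> lam01 \<Otimes>\<^sub>M ?L \<rightarrow>\<^sub>M ?L'"
      by (rule measurable_fun_upd[of _ "{1..n}"]) (auto simp: atLeastAtMostSuc_conv)
    then show "(\<lambda>(u, U). U(Suc n := u)) \<in> lam01 \<Otimes>\<^sub>M ?L \<rightarrow>\<^sub>M ?L'" by (simp add: split_beta')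
  qed (auto simp: comp_def split_beta')
  finally have 2: "?L' = distr (?L \<Otimes>\<^sub>M lam01) ?L' (\<lambda>(U, u). U(Suc n := u))" .
  have 3: "\<mu>' \<Otimes>\<^sub>M ?L' = distr ((\<mu>n \<Otimes>\<^sub>M lam01) \<Otimes>\<^sub>M (?L \<Otimes>\<^sub>M lam01)) (Xsp (Suc n) TX \<Otimes>\<^sub>M ?L')
      (\<lambda>(p, q). ((\<lambda>(x, r). x(Suc n := \<alpha> (x, r))) p, (\<lambda>(U, u). U(Suc n := u)) q))"
    by (subst (1) 1, subst (1) 2, rule pair_measure_distr) (auto simp: 2[symmetric] L'.sigma_finite_measure_axioms)
  let ?I = "\<lambda>p. ((fst (fst p), fst (snd p)), (snd (fst p), snd (snd p)))"
  have "hatmeas (Suc n) TX \<mu>' = distr ((\<mu>n \<Otimes>\<^sub>M lam01) \<Otimes>\<^sub>M (?L \<Otimes>\<^sub>M lam01)) (hatsp (Suc n) TX)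
      (\<lambda>p. zip_path (Suc n) ((\<lambda>(x, r). x(Suc n := \<alpha> (x, r))) (fst p), (\<lambda>(U, u). U(Suc n := u)) (snd p)))"
    unfolding hatmeas_zip_path 3 by (subst distr_distr) (auto simp: comp_def split_beta')
  also have "\<dots> = distr ((\<mu>n \<Otimes>\<^sub>M lam01) \<Otimes>\<^sub>M (?L \<Otimes>\<^sub>M lam01)) (hatsp (Suc n) TX)
      (\<lambda>p. (zip_path n (fst (fst p), fst (snd p)))(Suc n := (\<alpha> (fst p), snd (snd p))))"
    by (rule distr_cong) (auto simp: zip_path_def restrict_def fun_eq_iff)
  also have "\<dots> = distr (distr ((\<mu>n \<Otimes>\<^sub>M lam01) \<Otimes>\<^sub>M (?L \<Otimes>\<^sub>M lam01)) ((\<mu>n \<Otimes>\<^sub>M ?L) \<Otimes>\<^sub>M lam01_sq) ?I) (hatsp (Suc n) TX)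
      (\<lambda>(p, (r, u)). (zip_path n p)(Suc n := (\<alpha> (forget n (zip_path n p), r), u)))"
  proof (subst distr_distr)
    have "(\<lambda>p. (zip_path n (fst p))(Suc n := (\<alpha> (forget n (zip_path n (fst p)), fst (snd p)), snd (snd p))))
      \<in> (\<mu>n \<Otimes>\<^sub>M ?L) \<Otimes>\<^sub>M lam01_sq \<rightarrow>\<^sub>M hatsp (Suc n) TX"
      by (rule measurable_upd_hatsp) measurable
    then show "(\<lambda>(p, (r, u)). (zip_path n p)(Suc n := (\<alpha> (forget n (zip_path n p), r), u)))
      \<in> (\<mu>n \<Otimes>\<^sub>M ?L) \<Otimes>\<^sub>M lam01_sq \<rightarrow>\<^sub>M hatsp (Suc n) TX" by (simp add: split_beta')
  qed (auto simp: forget_zip_path space_pair_measure sp\<mu>n intro!: distr_cong)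
  also have "\<dots> = distr ((\<mu>n \<Otimes>\<^sub>M ?L) \<Otimes>\<^sub>M lam01_sq) (hatsp (Suc n) TX)
      (\<lambda>(p, (r, u)). (zip_path n p)(Suc n := (\<alpha> (forget n (zip_path n p), r), u)))"
    by (simp only: distr_pair_interchange[OF p\<mu>n prob_space_lam01 prob_space_PiM_lam01 prob_space_lam01])
  also have "\<dots> = distr (distr ((\<mu>n \<Otimes>\<^sub>M ?L) \<Otimes>\<^sub>M lam01_sq) (hatsp n TX \<Otimes>\<^sub>M lam01_sq) (\<lambda>(p, q). (zip_path n p, q)))
      (hatsp (Suc n) TX) (\<lambda>(z, (r, u)). z(Suc n := (\<alpha> (forget n z, r), u)))"
    by (subst distr_distr[OF upd2]) (auto simp: comp_def split_beta')
  also have "distr ((\<mu>n \<Otimes>\<^sub>M ?L) \<Otimes>\<^sub>M lam01_sq) (hatsp n TX \<Otimes>\<^sub>M lam01_sq) (\<lambda>(p, q). (zip_path n p, q))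
      = hatmeas n TX \<mu>n \<Otimes>\<^sub>M distr lam01_sq lam01_sq (\<lambda>q. q)"
  proof -
    interpret LL: pair_prob_space lam01 lam01 ..
    show ?thesis unfolding hatmeas_zip_path
      by (rule pair_measure_distr[symmetric]) (auto simp: distr_id LL.sigma_finite_measure_axioms)
  qed
  finally show ?thesis unfolding distr_id \<mu>n_def \<mu>'_def by (simp only: split_beta')
qed

section \<open>Extending biadapted maps by one coordinate\<close>

lemma adapted_extend:
  assumes T: "adapted n (hatsp n TX) (hatsp n TY) T"
    and m: "(\<lambda>a. (T (restrict a {1..n}))(Suc n := k (restrict a {1..n}) (a (Suc n)))) \<in> hatsp (Suc n) TX \<rightarrow>\<^sub>M hatsp (Suc n) TY"
  shows "adapted (Suc n) (hatsp (Suc n) TX) (hatsp (Suc n) TY)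
    (\<lambda>a. (T (restrict a {1..n}))(Suc n := k (restrict a {1..n}) (a (Suc n))))"
    (is "adapted _ _ _ ?T")
  unfolding adapted_def
proof (intro conjI m ballI impI)
  fix a a' t assume a: "a \<in> space (hatsp (Suc n) TX)" "a' \<in> space (hatsp (Suc n) TX)"
    and t: "t \<in> {1..Suc n}" and eq: "\<forall>s\<in>{1..t}. a s = a' s"
  show "?T a t = ?T a' t"
  proof (cases "t = Suc n")
    case True
    then have "restrict a {1..n} = restrict a' {1..n}" "a (Suc n) = a' (Suc n)"
      using eq by (auto simp: restrict_def fun_eq_iff)
    then show ?thesis by simp
  next
    case False
    then have "t \<in> {1..n}" using t by auto
    moreover have "\<forall>s\<in>{1..t}. restrict a {1..n} s = restrict a' {1..n} s" using eq by (auto simp: restrict_def)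
    moreover have "restrict a {1..n} \<in> space (hatsp n TX)" "restrict a' {1..n} \<in> space (hatsp n TX)"
      using a measurable_space[OF measurable_restrict_hatsp[of n "Suc n"]] by auto
    ultimately have "T (restrict a {1..n}) t = T (restrict a' {1..n}) t" using T unfolding adapted_def by blast
    then show ?thesis using False by simp
  qed
qed

text \<open>The step map is selected by the pasts of both processes, and both are available on
  either side: from the source the other past is found by applying \<open>T\<close>, from the target
  by applying its inverse \<open>S\<close>. Hence the step is undone with the same
  \<open>h\<close>.\<close>

lemma biadapted_extend:
  fixes TX :: "nat \<Rightarrow> 'a topology" and TY :: "nat \<Rightarrow> 'b topology"
  assumes T: "biadapted n (hatsp n TX) (hatsp n TY) T"
    and K[measurable]: "K \<in> (Xsp n TX \<Otimes>\<^sub>M Xsp n TY) \<Otimes>\<^sub>M (borel_top (TX (Suc n)) \<Otimes>\<^sub>M lam01) \<rightarrow>\<^sub>M borel_top (TY (Suc n)) \<Otimes>\<^sub>M lam01"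
    and J[measurable]: "J \<in> (Xsp n TX \<Otimes>\<^sub>M Xsp n TY) \<Otimes>\<^sub>M (borel_top (TY (Suc n)) \<Otimes>\<^sub>M lam01) \<rightarrow>\<^sub>M borel_top (TX (Suc n)) \<Otimes>\<^sub>M lam01"
    and JK: "\<And>h z. h \<in> space (Xsp n TX \<Otimes>\<^sub>M Xsp n TY) \<Longrightarrow> z \<in> space (borel_top (TX (Suc n)) \<Otimes>\<^sub>M lam01) \<Longrightarrow> J (h, K (h, z)) = z"
    and KJ: "\<And>h z. h \<in> space (Xsp n TX \<Otimes>\<^sub>M Xsp n TY) \<Longrightarrow> z \<in> space (borel_top (TY (Suc n)) \<Otimes>\<^sub>M lam01) \<Longrightarrow> K (h, J (h, z)) = z"
  shows "biadapted (Suc n) (hatsp (Suc n) TX) (hatsp (Suc n) TY)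
    (\<lambda>a. (T (restrict a {1..n}))(Suc n := K ((forget n (restrict a {1..n}), forget n (T (restrict a {1..n}))), a (Suc n))))"
    (is "biadapted _ ?A' ?B' ?T")
proof -
  note One_nat_def[simp del]
  let ?A = "hatsp n TX" and ?B = "hatsp n TY"
  obtain S where S: "\<And>a. a \<in> space ?A \<Longrightarrow> S (T a) = a" "\<And>b. b \<in> space ?B \<Longrightarrow> T (S b) = b" "adapted n ?B ?A S"
    using T unfolding biadapted_def by blast
  have aT: "adapted n ?A ?B T" using T by (simp add: biadapted_def)
  have Tm[measurable]: "T \<in> ?A \<rightarrow>\<^sub>M ?B" and Sm[measurable]: "S \<in> ?B \<rightarrow>\<^sub>M ?A" using aT S(3) by (auto simp: adapted_def)
  let ?ra = "\<lambda>a :: nat \<Rightarrow> 'a \<times> real. restrict a {1..n}" and ?rb = "\<lambda>b :: nat \<Rightarrow> 'b \<times> real. restrict b {1..n}"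
  have ra[measurable]: "?ra \<in> ?A' \<rightarrow>\<^sub>M ?A" and rb[measurable]: "?rb \<in> ?B' \<rightarrow>\<^sub>M ?B" by (auto intro!: measurable_restrict_hatsp)
  have [measurable]: "(\<lambda>a. a (Suc n)) \<in> ?A' \<rightarrow>\<^sub>M borel_top (TX (Suc n)) \<Otimes>\<^sub>M lam01"
    "(\<lambda>a. a (Suc n)) \<in> ?B' \<rightarrow>\<^sub>M borel_top (TY (Suc n)) \<Otimes>\<^sub>M lam01"
    by (auto intro!: measurable_hatsp_component)
  let ?S = "\<lambda>b. (S (?rb b))(Suc n := J ((forget n (S (?rb b)), forget n (?rb b)), b (Suc n)))"
  have T'm: "?T \<in> ?A' \<rightarrow>\<^sub>M ?B'" by (rule measurable_upd_hatsp) measurable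
  have S'm: "?S \<in> ?B' \<rightarrow>\<^sub>M ?A'" by (rule measurable_upd_hatsp) measurable
  have aT': "adapted (Suc n) ?A' ?B' ?T"
    by (rule adapted_extend[OF aT, where k="\<lambda>z. \<lambda>w. K ((forget n z, forget n (T z)), w)", OF T'm])
  have aS': "adapted (Suc n) ?B' ?A' ?S"
    by (rule adapted_extend[OF S(3), where k="\<lambda>z. \<lambda>w. J ((forget n (S z), forget n z), w)", OF S'm])
  have ST: "?S (?T a) = a" if a: "a \<in> space ?A'" for a
  proof -
    have sp: "?ra a \<in> space ?A" using a measurable_space[OF ra] by auto
    have spT: "T (?ra a) \<in> space ?B" by (rule measurable_space[OF Tm sp])
    have r: "?rb (?T a) = T (?ra a)" by (rule restrict_upd_path[OF extensional_space_hatsp[OF spT]])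
    have "(forget n (?ra a), forget n (T (?ra a))) \<in> space (Xsp n TX \<Otimes>\<^sub>M Xsp n TY)"
      using sp spT by (auto simp: space_pair_measure intro!: measurable_space[OF measurable_forget])
    moreover have "a (Suc n) \<in> space (borel_top (TX (Suc n)) \<Otimes>\<^sub>M lam01)"
      using a by (auto simp: space_hatsp space_pair_measure PiE_iff)
    ultimately have "?S (?T a) = (?ra a)(Suc n := a (Suc n))"
      unfolding r S(1)[OF sp] by (simp add: JK)
    then show ?thesis using upd_restrict_path[OF extensional_space_hatsp[OF a]] by simp
  qed
  have TS: "?T (?S b) = b" if b: "b \<in> space ?B'" for b
  proof -
    have sp: "?rb b \<in> space ?B" using b measurable_space[OF rb] by auto
    have spS: "S (?rb b) \<in> space ?A" by (rule measurable_space[OF Sm sp])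
    have r: "?ra (?S b) = S (?rb b)" by (rule restrict_upd_path[OF extensional_space_hatsp[OF spS]])
    have "(forget n (S (?rb b)), forget n (?rb b)) \<in> space (Xsp n TX \<Otimes>\<^sub>M Xsp n TY)"
      using sp spS by (auto simp: space_pair_measure intro!: measurable_space[OF measurable_forget])
    moreover have "b (Suc n) \<in> space (borel_top (TY (Suc n)) \<Otimes>\<^sub>M lam01)"
      using b by (auto simp: space_hatsp space_pair_measure PiE_iff)
    ultimately have "?T (?S b) = (?rb b)(Suc n := b (Suc n))"
      unfolding r S(2)[OF sp] by (simp add: KJ)
    then show ?thesis using upd_restrict_path[OF extensional_space_hatsp[OF b]] by simp
  qed
  have "bij_betw ?T (space ?A') (space ?B')"
  proof (rule bij_betw_byWitness[where f'="?S"])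
    show "?T ` space ?A' \<subseteq> space ?B'" by (rule image_subsetI, rule measurable_space[OF T'm])
    show "?S ` space ?B' \<subseteq> space ?A'" by (rule image_subsetI, rule measurable_space[OF S'm])
  qed (intro ballI ST TS, assumption)+
  then show ?thesis unfolding biadapted_def by (intro conjI exI[of _ ?S] ballI aT' aS' ST TS)
qed

section \<open>The induction over time\<close>

lemma distr_pair_left:
  assumes [measurable]: "f \<in> M \<rightarrow>\<^sub>M N" and "prob_space L"
  shows "distr M N f \<Otimes>\<^sub>M L = distr (M \<Otimes>\<^sub>M L) (N \<Otimes>\<^sub>M L) (\<lambda>(x, l). (f x, l))"
proof -
  interpret L: prob_space L by fact
  have "distr M N f \<Otimes>\<^sub>M distr L L (\<lambda>l. l) = distr (M \<Otimes>\<^sub>M L) (N \<Otimes>\<^sub>M L) (\<lambda>(x, l). (f x, l))"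
    by (rule pair_measure_distr) (auto simp: distr_id L.sigma_finite_measure_axioms)
  then show ?thesis by (simp add: distr_id)
qed

text \<open>Substituting the first randomised representation into the second and reassociating the
  product expresses both new coordinates through the past and a point of the unit square.\<close>

lemma disintegration_chain:
  assumes "prob_space \<rho>" and [measurable_cong]: "sets \<rho> = sets H"
    and [measurable]: "f \<in> M \<rightarrow>\<^sub>M H" "g \<in> M \<rightarrow>\<^sub>M Z" "g' \<in> M \<rightarrow>\<^sub>M W"
    and [measurable]: "a \<in> H \<Otimes>\<^sub>M lam01 \<rightarrow>\<^sub>M Z" "c \<in> (H \<Otimes>\<^sub>M Z) \<Otimes>\<^sub>M lam01 \<rightarrow>\<^sub>M W"
    and 1: "distr M (H \<Otimes>\<^sub>M Z) (\<lambda>x. (f x, g x)) = distr (\<rho> \<Otimes>\<^sub>M lam01) (H \<Otimes>\<^sub>M Z) (\<lambda>(h, r). (h, a (h, r)))"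
    and 2: "distr (distr M (H \<Otimes>\<^sub>M Z) (\<lambda>x. (f x, g x)) \<Otimes>\<^sub>M lam01) ((H \<Otimes>\<^sub>M Z) \<Otimes>\<^sub>M W) (\<lambda>(p, s). (p, c (p, s)))
      = distr M ((H \<Otimes>\<^sub>M Z) \<Otimes>\<^sub>M W) (\<lambda>x. ((f x, g x), g' x))"
  shows "distr M (H \<Otimes>\<^sub>M (Z \<Otimes>\<^sub>M W)) (\<lambda>x. (f x, (g x, g' x)))
    = distr (\<rho> \<Otimes>\<^sub>M lam01_sq) (H \<Otimes>\<^sub>M (Z \<Otimes>\<^sub>M W))
        (\<lambda>(h, q). (h, (a (h, fst q), c ((h, a (h, fst q)), snd q))))"
proof -
  let ?HZ = "H \<Otimes>\<^sub>M Z" and ?C = "H \<Otimes>\<^sub>M (Z \<Otimes>\<^sub>M W)"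
  have [measurable]: "(\<lambda>(h, r). (h, a (h, r))) \<in> \<rho> \<Otimes>\<^sub>M lam01 \<rightarrow>\<^sub>M ?HZ" by measurable
  have 3: "distr M (?HZ \<Otimes>\<^sub>M W) (\<lambda>x. ((f x, g x), g' x)) = distr ((\<rho> \<Otimes>\<^sub>M lam01) \<Otimes>\<^sub>M lam01) (?HZ \<Otimes>\<^sub>M W)
      (\<lambda>q. ((fst (fst q), a (fst q)), c ((fst (fst q), a (fst q)), snd q)))"
    unfolding 2[symmetric] 1
    by (subst distr_pair_left) (auto simp: prob_space_lam01 distr_distr comp_def split_beta')
  have "distr M ?C (\<lambda>x. (f x, (g x, g' x)))
      = distr (distr M (?HZ \<Otimes>\<^sub>M W) (\<lambda>x. ((f x, g x), g' x))) ?C (\<lambda>p. (fst (fst p), (snd (fst p), snd p)))"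
    by (simp add: distr_distr comp_def)
  also have "\<dots> = distr (distr (\<rho> \<Otimes>\<^sub>M lam01_sq) ((\<rho> \<Otimes>\<^sub>M lam01) \<Otimes>\<^sub>M lam01) (\<lambda>(x, (y, z)). ((x, y), z)))
      ?C (\<lambda>q. (fst (fst q), (a (fst q), c ((fst (fst q), a (fst q)), snd q))))"
    unfolding 3 distr_pair_assoc[OF assms(1) prob_space_lam01 prob_space_lam01] by (simp add: distr_distr comp_def)
  also have "\<dots> = distr (\<rho> \<Otimes>\<^sub>M lam01_sq) ?C (\<lambda>(h, q). (h, (a (h, fst q), c ((h, a (h, fst q)), snd q))))"
    by (subst distr_distr) (auto simp: comp_def split_beta')
  finally show ?thesis .
qed

text \<open>Serves the start of the induction, where path spaces without coordinates have a single
  point.\<close>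

lemma prob_space_singleton_eqI:
  assumes "prob_space M" "prob_space N" "sets M = sets N" "space M = {p}"
  shows "M = N"
proof (rule measure_eqI)
  fix A assume "A \<in> sets M"
  then have "A = {} \<or> A = space M" using sets.sets_into_space[of A M] assms(4) by auto
  then show "emeasure M A = emeasure N A"
    using prob_space.emeasure_space_1[OF assms(1)] prob_space.emeasure_space_1[OF assms(2)]
      sets_eq_imp_space_eq[OF assms(3)] by auto
qed (rule assms(3))

lemma forget_upd: "forget (Suc n) (z(Suc n := w)) = (forget n z)(Suc n := fst w)"
  by (auto simp: forget_def restrict_def fun_eq_iff)

text \<open>In each induction step the new coordinate is transported by the one-step isomorphism selected by
  the pasts of both processes.\<close>

lemma bicausal_transport_map:
  fixes TX :: "nat \<Rightarrow> 'a topology" and TY :: "nat \<Rightarrow> 'b topology"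
  assumes stdX: "\<And>t. t \<in> {1..N} \<Longrightarrow> std_borel (borel_top (TX t))"
    and stdY: "\<And>t. t \<in> {1..N} \<Longrightarrow> std_borel (borel_top (TY t))"
    and mu: "prob_space \<mu>" "sets \<mu> = sets (Xsp N TX)"
    and nu: "prob_space \<nu>" "sets \<nu> = sets (Xsp N TY)"
    and bc: "\<pi> \<in> Cpl_bc N (\<lambda>t. borel_top (TX t)) (\<lambda>t. borel_top (TY t)) \<mu> \<nu>"
    and "n \<le> N"
  shows "\<exists>T. biadapted n (hatsp n TX) (hatsp n TY) T \<and>
    distr (hatmeas n TX (distr \<mu> (Xsp n TX) (\<lambda>x. restrict x {1..n}))) (hatsp n TY) T
      = hatmeas n TY (distr \<nu> (Xsp n TY) (\<lambda>y. restrict y {1..n})) \<and>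
    distr (hatmeas n TX (distr \<mu> (Xsp n TX) (\<lambda>x. restrict x {1..n}))) (Xsp n TX \<Otimes>\<^sub>M Xsp n TY)
        (\<lambda>a. (forget n a, forget n (T a)))
      = distr \<pi> (Xsp n TX \<Otimes>\<^sub>M Xsp n TY) (\<lambda>p. (restrict (fst p) {1..n}, restrict (snd p) {1..n}))"
  using \<open>n \<le> N\<close>
proof (induction n)
  note One_nat_def[simp del]
  interpret \<mu>: prob_space \<mu> by fact
  interpret \<nu>: prob_space \<nu> by fact
  note mu(2)[measurable_cong] nu(2)[measurable_cong]
  have XY: "PiM {1..N} (\<lambda>t. borel_top (TX t)) = Xsp N TX" "PiM {1..N} (\<lambda>t. borel_top (TY t)) = Xsp N TY"
    by (simp_all add: Xsp_def pathsp_def)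
  have "\<pi> \<in> Cpl (Xsp N TX) (Xsp N TY) \<mu> \<nu>" using bc by (simp add: Cpl_bc_def causal_def XY)
  then have s\<pi>: "sets \<pi> = sets (Xsp N TX \<Otimes>\<^sub>M Xsp N TY)" and p\<pi>: "prob_space \<pi>" by (auto simp: Cpl_def)
  note s\<pi>[measurable_cong]
  interpret \<pi>: prob_space \<pi> by fact
  {
    case 0
    have spX: "space (hatsp 0 TX) = {\<lambda>_. undefined}" and spY: "space (hatsp 0 TY) = {\<lambda>_. undefined}"
      and spXY: "space (Xsp 0 TX \<Otimes>\<^sub>M Xsp 0 TY) = {(\<lambda>_. undefined, \<lambda>_. undefined)}"
      by (auto simp: space_hatsp space_Xsp space_pair_measure)
    define T where "T = (\<lambda>a :: nat \<Rightarrow> 'a \<times> real. (\<lambda>_. undefined) :: nat \<Rightarrow> 'b \<times> real)"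
    define S where "S = (\<lambda>a :: nat \<Rightarrow> 'b \<times> real. (\<lambda>_. undefined) :: nat \<Rightarrow> 'a \<times> real)"
    have Tm[measurable]: "T \<in> hatsp 0 TX \<rightarrow>\<^sub>M hatsp 0 TY" and "S \<in> hatsp 0 TY \<rightarrow>\<^sub>M hatsp 0 TX"
      unfolding T_def S_def using spX spY by (auto intro!: measurable_const)
    then have "biadapted 0 (hatsp 0 TX) (hatsp 0 TY) T"
      unfolding biadapted_def adapted_def by (auto simp: spX spY bij_betw_def T_def S_def intro!: exI[of _ S])
    moreover
    have [measurable]: "(\<lambda>x. restrict x {1..0}) \<in> Xsp N TX \<rightarrow>\<^sub>M Xsp 0 TX" "(\<lambda>x. restrict x {1..0}) \<in> Xsp N TY \<rightarrow>\<^sub>M Xsp 0 TY"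
      by (rule measurable_restrict_Xsp, simp)+
    have pX: "prob_space (distr \<mu> (Xsp 0 TX) (\<lambda>x. restrict x {1..0}))" by (rule \<mu>.prob_space_distr) measurable
    have pY: "prob_space (distr \<nu> (Xsp 0 TY) (\<lambda>x. restrict x {1..0}))" by (rule \<nu>.prob_space_distr) measurable
    interpret hX: prob_space "hatmeas 0 TX (distr \<mu> (Xsp 0 TX) (\<lambda>x. restrict x {1..0}))" by (rule prob_space_hatmeas[OF pX]) simp
    have "distr (hatmeas 0 TX (distr \<mu> (Xsp 0 TX) (\<lambda>x. restrict x {1..0}))) (hatsp 0 TY) T
      = hatmeas 0 TY (distr \<nu> (Xsp 0 TY) (\<lambda>y. restrict y {1..0}))"
      by (rule prob_space_singleton_eqI[OF hX.prob_space_distr prob_space_hatmeas[OF pY]])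
         (auto simp: spY sets_hatmeas)
    moreover have "distr (hatmeas 0 TX (distr \<mu> (Xsp 0 TX) (\<lambda>x. restrict x {1..0}))) (Xsp 0 TX \<Otimes>\<^sub>M Xsp 0 TY)
        (\<lambda>a. (forget 0 a, forget 0 (T a)))
      = distr \<pi> (Xsp 0 TX \<Otimes>\<^sub>M Xsp 0 TY) (\<lambda>p. (restrict (fst p) {1..0}, restrict (snd p) {1..0}))"
      (is "?l = ?r")
    proof (rule prob_space_singleton_eqI)
      show "prob_space ?l" by (rule hX.prob_space_distr) measurable
      show "prob_space ?r" by (rule \<pi>.prob_space_distr) measurable
    qed (simp_all add: spXY)
    ultimately show ?case by blast
  next
    case (Suc n)
    then have n: "n < N" by simp
    let ?Xn = "Xsp n TX" and ?Yn = "Xsp n TY" and ?Z = "borel_top (TX (Suc n))" and ?W = "borel_top (TY (Suc n))"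
    let ?H = "?Xn \<Otimes>\<^sub>M ?Yn" and ?LL = lam01_sq
    let ?rx = "\<lambda>x :: nat \<Rightarrow> 'a. restrict x {1..n}" and ?ry = "\<lambda>y :: nat \<Rightarrow> 'b. restrict y {1..n}"
    define \<mu>n where "\<mu>n = distr \<mu> ?Xn ?rx"
    define \<nu>n where "\<nu>n = distr \<nu> ?Yn ?ry"
    define \<pi>n where "\<pi>n = distr \<pi> ?H (\<lambda>p. (?rx (fst p), ?ry (snd p)))"
    have Z: "std_borel ?Z" and W: "std_borel ?W" using n stdX stdY by auto
    have [measurable]: "?rx \<in> Xsp N TX \<rightarrow>\<^sub>M ?Xn" "?ry \<in> Xsp N TY \<rightarrow>\<^sub>M ?Yn"
      "(\<lambda>x. x (Suc n)) \<in> Xsp N TX \<rightarrow>\<^sub>M ?Z" "(\<lambda>x. x (Suc n)) \<in> Xsp N TY \<rightarrow>\<^sub>M ?W"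
      using n by (auto intro!: measurable_restrict_Xsp measurable_Xsp_component)
    have s[measurable_cong]: "sets \<mu>n = sets ?Xn" "sets \<nu>n = sets ?Yn" "sets \<pi>n = sets ?H"
      by (simp_all add: \<mu>n_def \<nu>n_def \<pi>n_def)
    have p\<mu>n: "prob_space \<mu>n" unfolding \<mu>n_def by (rule \<mu>.prob_space_distr) measurable
    have p\<pi>n: "prob_space \<pi>n" unfolding \<pi>n_def by (rule \<pi>.prob_space_distr) measurable
    interpret lam01: prob_space lam01 by (rule prob_space_lam01)
    interpret LL: pair_prob_space lam01 lam01 ..

    have "\<exists>q. q \<in> ?Xn \<Otimes>\<^sub>M lam01 \<rightarrow>\<^sub>M ?Z \<and> distr (\<mu>n \<Otimes>\<^sub>M lam01) (?Xn \<Otimes>\<^sub>M ?Z) (\<lambda>(x, u). (x, q (x, u))) = distr \<mu> (?Xn \<Otimes>\<^sub>M ?Z) (\<lambda>x. (?rx x, x (Suc n)))"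
      unfolding \<mu>n_def by (rule disintegration[OF mu(1) _ _ Z]) measurable
    then obtain \<alpha> where \<alpha>[measurable]: "\<alpha> \<in> ?Xn \<Otimes>\<^sub>M lam01 \<rightarrow>\<^sub>M ?Z"
      and \<alpha>d: "distr (\<mu>n \<Otimes>\<^sub>M lam01) (?Xn \<Otimes>\<^sub>M ?Z) (\<lambda>(x, u). (x, \<alpha> (x, u))) = distr \<mu> (?Xn \<Otimes>\<^sub>M ?Z) (\<lambda>x. (?rx x, x (Suc n)))"
      by blast
    have "\<exists>q. q \<in> ?Yn \<Otimes>\<^sub>M lam01 \<rightarrow>\<^sub>M ?W \<and> distr (\<nu>n \<Otimes>\<^sub>M lam01) (?Yn \<Otimes>\<^sub>M ?W) (\<lambda>(x, u). (x, q (x, u))) = distr \<nu> (?Yn \<Otimes>\<^sub>M ?W) (\<lambda>x. (?ry x, x (Suc n)))"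
      unfolding \<nu>n_def by (rule disintegration[OF nu(1) _ _ W]) measurable
    then obtain \<beta> where \<beta>[measurable]: "\<beta> \<in> ?Yn \<Otimes>\<^sub>M lam01 \<rightarrow>\<^sub>M ?W"
      and \<beta>d: "distr (\<nu>n \<Otimes>\<^sub>M lam01) (?Yn \<Otimes>\<^sub>M ?W) (\<lambda>(x, u). (x, \<beta> (x, u))) = distr \<nu> (?Yn \<Otimes>\<^sub>M ?W) (\<lambda>x. (?ry x, x (Suc n)))"
      by blast
    let ?h = "\<lambda>p :: (nat \<Rightarrow> 'a) \<times> (nat \<Rightarrow> 'b). (?rx (fst p), ?ry (snd p))"
    have hm[measurable]: "?h \<in> \<pi> \<rightarrow>\<^sub>M ?H" "(\<lambda>p. fst p (Suc n)) \<in> \<pi> \<rightarrow>\<^sub>M ?Z" "(\<lambda>p. snd p (Suc n)) \<in> \<pi> \<rightarrow>\<^sub>M ?W"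
      by measurable
    obtain c where c[measurable]: "c \<in> (?H \<Otimes>\<^sub>M ?Z) \<Otimes>\<^sub>M lam01 \<rightarrow>\<^sub>M ?W"
      and cd: "distr (distr \<pi> (?H \<Otimes>\<^sub>M ?Z) (\<lambda>p. (?h p, fst p (Suc n))) \<Otimes>\<^sub>M lam01) ((?H \<Otimes>\<^sub>M ?Z) \<Otimes>\<^sub>M ?W) (\<lambda>(h, u). (h, c (h, u)))
        = distr \<pi> ((?H \<Otimes>\<^sub>M ?Z) \<Otimes>\<^sub>M ?W) (\<lambda>p. ((?h p, fst p (Suc n)), snd p (Suc n)))"
      using disintegration[OF p\<pi> measurable_Pair[OF hm(1,2)] hm(3) W] by blast
    obtain d where d[measurable]: "d \<in> (?H \<Otimes>\<^sub>M ?W) \<Otimes>\<^sub>M lam01 \<rightarrow>\<^sub>M ?Z"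
      and dd: "distr (distr \<pi> (?H \<Otimes>\<^sub>M ?W) (\<lambda>p. (?h p, snd p (Suc n))) \<Otimes>\<^sub>M lam01) ((?H \<Otimes>\<^sub>M ?W) \<Otimes>\<^sub>M ?Z) (\<lambda>(h, u). (h, d (h, u)))
        = distr \<pi> ((?H \<Otimes>\<^sub>M ?W) \<Otimes>\<^sub>M ?Z) (\<lambda>p. ((?h p, snd p (Suc n)), fst p (Suc n)))"
      using disintegration[OF p\<pi> measurable_Pair[OF hm(1,3)] hm(2) Z] by blast
    \<comment> \<open>Both pasts are passed along, but each function reads only its own; that this
      is correct under \<open>\<pi>\<close> is the content of causality in the two
      directions.\<close>
    define a :: "((nat \<Rightarrow> 'a) \<times> (nat \<Rightarrow> 'b)) \<times> real \<Rightarrow> 'a" where "a = (\<lambda>(h, r). \<alpha> (fst h, r))"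
    define b :: "((nat \<Rightarrow> 'a) \<times> (nat \<Rightarrow> 'b)) \<times> real \<Rightarrow> 'b" where "b = (\<lambda>(h, r). \<beta> (snd h, r))"
    have ab[measurable]: "a \<in> ?H \<Otimes>\<^sub>M lam01 \<rightarrow>\<^sub>M ?Z" "b \<in> ?H \<Otimes>\<^sub>M lam01 \<rightarrow>\<^sub>M ?W"
      unfolding a_def b_def by measurable

    have P1: "distr \<pi> (?H \<Otimes>\<^sub>M ?Z) (\<lambda>p. (?h p, fst p (Suc n))) = distr (\<pi>n \<Otimes>\<^sub>M lam01) (?H \<Otimes>\<^sub>M ?Z) (\<lambda>(h, r). (h, a (h, r)))"
    proof -
      have "causal N (\<lambda>t. borel_top (TX t)) (\<lambda>t. borel_top (TY t)) \<mu> \<nu> \<pi>" using bc by (simp add: Cpl_bc_def)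
      from causal_next_coordinate[OF this mu n \<alpha> \<alpha>d[unfolded \<mu>n_def]]
      show ?thesis unfolding \<pi>n_def a_def by (simp add: split_beta')
    qed
    \<comment> \<open>Causality of the reversed coupling is applied to the swapped law, and the swap
      is undone afterwards.\<close>
    have Q1: "distr \<pi> (?H \<Otimes>\<^sub>M ?W) (\<lambda>p. (?h p, snd p (Suc n))) = distr (\<pi>n \<Otimes>\<^sub>M lam01) (?H \<Otimes>\<^sub>M ?W) (\<lambda>(h, r). (h, b (h, r)))"
    proof -
      define \<pi>' where "\<pi>' = distr \<pi> (Xsp N TY \<Otimes>\<^sub>M Xsp N TX) (\<lambda>p. (snd p, fst p))"
      have [measurable_cong]: "sets \<pi>' = sets (Xsp N TY \<Otimes>\<^sub>M Xsp N TX)" by (simp add: \<pi>'_def)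
      define \<pi>'n where "\<pi>'n = distr \<pi>' (?Yn \<Otimes>\<^sub>M ?Xn) (\<lambda>p. (?ry (fst p), ?rx (snd p)))"
      have [measurable_cong]: "sets \<pi>'n = sets (?Yn \<Otimes>\<^sub>M ?Xn)" by (simp add: \<pi>'n_def)
      have "causal N (\<lambda>t. borel_top (TY t)) (\<lambda>t. borel_top (TX t)) \<nu> \<mu> \<pi>'"
        using bc by (simp add: Cpl_bc_def XY \<pi>'_def split_beta')
      from causal_next_coordinate[OF this nu n \<beta> \<beta>d[unfolded \<nu>n_def]]
      have *: "distr \<pi>' ((?Yn \<Otimes>\<^sub>M ?Xn) \<Otimes>\<^sub>M ?W) (\<lambda>p. ((?ry (fst p), ?rx (snd p)), fst p (Suc n)))
        = distr (\<pi>'n \<Otimes>\<^sub>M lam01) ((?Yn \<Otimes>\<^sub>M ?Xn) \<Otimes>\<^sub>M ?W) (\<lambda>p. (fst p, \<beta> (fst (fst p), snd p)))"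
        unfolding \<pi>'n_def by (simp add: split_beta')
      let ?sw = "\<lambda>p. ((snd (fst p), fst (fst p)), snd p)"
      have "distr \<pi> (?H \<Otimes>\<^sub>M ?W) (\<lambda>p. (?h p, snd p (Suc n)))
          = distr (distr \<pi>' ((?Yn \<Otimes>\<^sub>M ?Xn) \<Otimes>\<^sub>M ?W) (\<lambda>p. ((?ry (fst p), ?rx (snd p)), fst p (Suc n)))) (?H \<Otimes>\<^sub>M ?W) ?sw"
        unfolding \<pi>'_def by (simp add: distr_distr comp_def)
      also have "\<dots> = distr (\<pi>'n \<Otimes>\<^sub>M lam01) (?H \<Otimes>\<^sub>M ?W) (\<lambda>p. ((snd (fst p), fst (fst p)), \<beta> (fst (fst p), snd p)))"
        unfolding * by (simp add: distr_distr comp_def)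
      also have "\<pi>'n = distr \<pi>n (?Yn \<Otimes>\<^sub>M ?Xn) (\<lambda>p. (snd p, fst p))"
        unfolding \<pi>'n_def \<pi>'_def \<pi>n_def by (simp add: distr_distr comp_def)
      also have "\<dots> \<Otimes>\<^sub>M lam01 = distr (\<pi>n \<Otimes>\<^sub>M lam01) ((?Yn \<Otimes>\<^sub>M ?Xn) \<Otimes>\<^sub>M lam01) (\<lambda>(x, l). ((snd x, fst x), l))"
        by (rule distr_pair_left[OF _ prob_space_lam01]) measurable
      also have "distr \<dots> (?H \<Otimes>\<^sub>M ?W) (\<lambda>p. ((snd (fst p), fst (fst p)), \<beta> (fst (fst p), snd p)))
          = distr (\<pi>n \<Otimes>\<^sub>M lam01) (?H \<Otimes>\<^sub>M ?W) (\<lambda>(h, r). (h, b (h, r)))"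
        by (simp add: distr_distr comp_def split_beta' b_def)
      finally show ?thesis .
    qed
    have joint: "distr \<pi> (?H \<Otimes>\<^sub>M (?Z \<Otimes>\<^sub>M ?W)) (\<lambda>p. (?h p, (fst p (Suc n), snd p (Suc n))))
      = distr (\<pi>n \<Otimes>\<^sub>M ?LL) (?H \<Otimes>\<^sub>M (?Z \<Otimes>\<^sub>M ?W)) (\<lambda>(h, q). (h, (a (h, fst q), c ((h, a (h, fst q)), snd q))))"
      by (rule disintegration_chain[OF p\<pi>n s(3) hm ab(1) c P1 cd])
    have joint': "distr \<pi> (?H \<Otimes>\<^sub>M (?W \<Otimes>\<^sub>M ?Z)) (\<lambda>p. (?h p, (snd p (Suc n), fst p (Suc n))))
      = distr (\<pi>n \<Otimes>\<^sub>M ?LL) (?H \<Otimes>\<^sub>M (?W \<Otimes>\<^sub>M ?Z)) (\<lambda>(h, q). (h, (b (h, fst q), d ((h, b (h, fst q)), snd q))))"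
      by (rule disintegration_chain[OF p\<pi>n s(3) hm(1,3,2) ab(2) d Q1 dd])
    define good where "good h \<longleftrightarrow> distr ?LL (?Z \<Otimes>\<^sub>M ?W) (\<lambda>(r, s). (a (h, r), c ((h, a (h, r)), s)))
        = distr ?LL (?Z \<Otimes>\<^sub>M ?W) (\<lambda>(r, s). (d ((h, b (h, r)), s), b (h, r)))" for h
    \<comment> \<open>Both orders of sampling describe the joint law of the pasts and the next pair
      under \<open>\<pi>\<close>, so uniqueness of fibre laws makes almost every pair of pasts
      good.\<close>
    have good: "AE h in \<pi>n. good h"
    proof -
      have "distr \<pi> (?H \<Otimes>\<^sub>M (?Z \<Otimes>\<^sub>M ?W)) (\<lambda>p. (?h p, (fst p (Suc n), snd p (Suc n))))
        = distr (distr \<pi> (?H \<Otimes>\<^sub>M (?W \<Otimes>\<^sub>M ?Z)) (\<lambda>p. (?h p, (snd p (Suc n), fst p (Suc n)))))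
          (?H \<Otimes>\<^sub>M (?Z \<Otimes>\<^sub>M ?W)) (\<lambda>p. (fst p, (snd (snd p), fst (snd p))))"
        by (simp add: distr_distr comp_def)
      also have "\<dots> = distr (\<pi>n \<Otimes>\<^sub>M ?LL) (?H \<Otimes>\<^sub>M (?Z \<Otimes>\<^sub>M ?W)) (\<lambda>(h, q). (h, (d ((h, b (h, fst q)), snd q), b (h, fst q))))"
        unfolding joint' by (simp add: distr_distr comp_def split_beta')
      finally have eq: "distr (\<pi>n \<Otimes>\<^sub>M ?LL) (?H \<Otimes>\<^sub>M (?Z \<Otimes>\<^sub>M ?W)) (\<lambda>(h, q). (h, (\<lambda>p. (a (fst p, fst (snd p)), c ((fst p, a (fst p, fst (snd p))), snd (snd p)))) (h, q)))
        = distr (\<pi>n \<Otimes>\<^sub>M ?LL) (?H \<Otimes>\<^sub>M (?Z \<Otimes>\<^sub>M ?W)) (\<lambda>(h, q). (h, (\<lambda>p. (d ((fst p, b (fst p, fst (snd p))), snd (snd p)), b (fst p, fst (snd p)))) (h, q)))"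
        unfolding joint by simp
      have "AE h in \<pi>n. distr ?LL (?Z \<Otimes>\<^sub>M ?W) (\<lambda>l. (\<lambda>p. (a (fst p, fst (snd p)), c ((fst p, a (fst p, fst (snd p))), snd (snd p)))) (h, l))
        = distr ?LL (?Z \<Otimes>\<^sub>M ?W) (\<lambda>l. (\<lambda>p. (d ((fst p, b (fst p, fst (snd p))), snd (snd p)), b (fst p, fst (snd p)))) (h, l))"
        by (rule distr_fiber_unique[OF p\<pi>n LL.prob_space_axioms _ _ s(3) std_borel_pair[OF Z W] eq]) measurable
      then show ?thesis unfolding good_def by (simp add: split_beta')
    qed
    \<comment> \<open>\<open>K\<close> and \<open>J\<close> are mutually inverse for every pair of
      pasts; goodness only affects the laws.\<close>
    obtain K J where K[measurable]: "K \<in> ?H \<Otimes>\<^sub>M (?Z \<Otimes>\<^sub>M lam01) \<rightarrow>\<^sub>M ?W \<Otimes>\<^sub>M lam01"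
      and J[measurable]: "J \<in> ?H \<Otimes>\<^sub>M (?W \<Otimes>\<^sub>M lam01) \<rightarrow>\<^sub>M ?Z \<Otimes>\<^sub>M lam01"
      and JK: "\<And>h z. h \<in> space ?H \<Longrightarrow> z \<in> space (?Z \<Otimes>\<^sub>M lam01) \<Longrightarrow> J (h, K (h, z)) = z"
      and KJ: "\<And>h z. h \<in> space ?H \<Longrightarrow> z \<in> space (?W \<Otimes>\<^sub>M lam01) \<Longrightarrow> K (h, J (h, z)) = z"
      and Kgood: "\<And>h. h \<in> space ?H \<Longrightarrow> good h \<Longrightarrow>
        distr ?LL (?W \<Otimes>\<^sub>M lam01) (\<lambda>(r, u). K (h, (a (h, r), u))) = distr ?LL (?W \<Otimes>\<^sub>M lam01) (\<lambda>(r, u). (b (h, r), u)) \<and>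
        distr ?LL (?Z \<Otimes>\<^sub>M ?W) (\<lambda>(r, u). (a (h, r), fst (K (h, (a (h, r), u)))))
        = distr ?LL (?Z \<Otimes>\<^sub>M ?W) (\<lambda>(r, s). (a (h, r), c ((h, a (h, r)), s)))"
      by (rule one_step_isomorphism[OF Z W, of a ?H b c d]) (simp, simp, rule c, rule d, rule that[unfolded good_def])

    obtain T where T: "biadapted n (hatsp n TX) (hatsp n TY) T"
      and push: "distr (hatmeas n TX \<mu>n) (hatsp n TY) T = hatmeas n TY \<nu>n"
      and law: "distr (hatmeas n TX \<mu>n) ?H (\<lambda>a. (forget n a, forget n (T a))) = \<pi>n"
      using Suc.IH[OF less_imp_le[OF n]] unfolding \<mu>n_def[symmetric] \<nu>n_def[symmetric] \<pi>n_def[symmetric] by blast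
    have Tm[measurable]: "T \<in> hatsp n TX \<rightarrow>\<^sub>M hatsp n TY" using T by (simp add: biadapted_def adapted_def)
    define M where "M = hatmeas n TX \<mu>n"
    have sM[measurable_cong]: "sets M = sets (hatsp n TX)" by (simp add: M_def sets_hatmeas)
    have spM: "space M = space (hatsp n TX)" by (rule sets_eq_imp_space_eq[OF sM])
    define hh where "hh z = (forget n z, forget n (T z))" for z
    have hh[measurable]: "hh \<in> hatsp n TX \<rightarrow>\<^sub>M ?H" unfolding hh_def by measurable
    have hh2: "distr M ?H hh = \<pi>n" unfolding M_def hh_def by (rule law)
    \<comment> \<open>By the induction hypothesis the pair of pasts has law \<open>\<pi>n\<close>
      under the enlarged measure, so almost every enlarged past is good.\<close>
    have AEgood: "AE z in M. good (hh z)"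
      using good unfolding hh2[symmetric] by (rule AE_distrD[rotated]) measurable
    define T' where "T' z = (T (restrict z {1..n}))(Suc n := K ((forget n (restrict z {1..n}), forget n (T (restrict z {1..n}))), z (Suc n)))" for z
    have bi: "biadapted (Suc n) (hatsp (Suc n) TX) (hatsp (Suc n) TY) T'"
      unfolding T'_def by (rule biadapted_extend[OF T K J JK KJ])
    then have T'm[measurable]: "T' \<in> hatsp (Suc n) TX \<rightarrow>\<^sub>M hatsp (Suc n) TY" by (simp add: biadapted_def adapted_def)
    have T'upd: "T' (z(Suc n := w)) = (T z)(Suc n := K (hh z, w))" if "z \<in> space M" for z w
      using that unfolding spM by (simp add: T'_def hh_def extensional_restrict[OF extensional_space_hatsp])
    note muS = hatmeas_restrict_Suc[OF mu n \<alpha> \<alpha>d[unfolded \<mu>n_def], folded \<mu>n_def, folded M_def]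
    note nuS = hatmeas_restrict_Suc[OF nu n \<beta> \<beta>d[unfolded \<nu>n_def], folded \<nu>n_def]
    let ?hX = "hatmeas (Suc n) TX (distr \<mu> (Xsp (Suc n) TX) (\<lambda>x. restrict x {1..Suc n}))"
    have updX[measurable]: "(\<lambda>p. (fst p)(Suc n := (\<alpha> (forget n (fst p), fst (snd p)), snd (snd p)))) \<in> M \<Otimes>\<^sub>M ?LL \<rightarrow>\<^sub>M hatsp (Suc n) TX"
      by (rule measurable_upd_hatsp) measurable
    have \<alpha>a: "\<alpha> (forget n z, r) = a (hh z, r)" and \<beta>b: "\<beta> (forget n (T z), r) = b (hh z, r)" for z r
      by (simp_all add: a_def b_def hh_def)
    have push': "distr ?hX (hatsp (Suc n) TY) T'
        = hatmeas (Suc n) TY (distr \<nu> (Xsp (Suc n) TY) (\<lambda>x. restrict x {1..Suc n}))"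
    proof -
      let ?V = "hatsp n TX \<Otimes>\<^sub>M (?W \<Otimes>\<^sub>M lam01)"
      define w1 where "w1 p = K (hh (fst p), (a (hh (fst p), fst (snd p)), snd (snd p)))" for p
      define w2 where "w2 p = (b (hh (fst p), fst (snd p)), snd (snd p))" for p :: "(nat \<Rightarrow> 'a \<times> real) \<times> (real \<times> real)"
      have w[measurable]: "w1 \<in> M \<Otimes>\<^sub>M ?LL \<rightarrow>\<^sub>M ?W \<Otimes>\<^sub>M lam01" "w2 \<in> M \<Otimes>\<^sub>M ?LL \<rightarrow>\<^sub>M ?W \<Otimes>\<^sub>M lam01"
        unfolding w1_def w2_def by measurable
      have g[measurable]: "(\<lambda>p. (T (fst p))(Suc n := snd p)) \<in> hatsp n TX \<Otimes>\<^sub>M (?W \<Otimes>\<^sub>M lam01) \<rightarrow>\<^sub>M hatsp (Suc n) TY"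
        by (rule measurable_upd_hatsp) measurable
      have updY[measurable]: "(\<lambda>p. (fst p)(Suc n := (\<beta> (forget n (fst p), fst (snd p)), snd (snd p)))) \<in> hatsp n TY \<Otimes>\<^sub>M ?LL \<rightarrow>\<^sub>M hatsp (Suc n) TY"
        by (rule measurable_upd_hatsp) measurable
      \<comment> \<open>Given the enlarged past \<open>z\<close>, the new target pair has the law of
        \<open>w2\<close>, whose auxiliary variable is uniform and whose other coordinate depends on
        \<open>z\<close> only through the past of the second process, as in the step of the enlarged
        \<open>\<nu>\<close>.\<close>
      have fib: "distr (M \<Otimes>\<^sub>M ?LL) ?V (\<lambda>(z, q). (z, w1 (z, q)))
        = distr (M \<Otimes>\<^sub>M ?LL) ?V (\<lambda>(z, q). (z, w2 (z, q)))"
      proof (rule distr_fiber_cong[OF LL.sigma_finite_measure_axioms LL.sigma_finite_measure_axioms w sM])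
        show "AE z in M. distr ?LL (?W \<Otimes>\<^sub>M lam01) (\<lambda>l. w1 (z, l)) = distr ?LL (?W \<Otimes>\<^sub>M lam01) (\<lambda>l. w2 (z, l))"
          using AEgood AE_space
        proof eventually_elim
          case (elim z)
          then have "hh z \<in> space ?H" unfolding spM by (intro measurable_space[OF hh])
          from Kgood[OF this elim(1)] show ?case by (simp add: w1_def w2_def split_beta')
        qed
      qed
      have "distr ?hX (hatsp (Suc n) TY) T'
          = distr (M \<Otimes>\<^sub>M ?LL) (hatsp (Suc n) TY) (\<lambda>p. (T (fst p))(Suc n := w1 p))"
        unfolding muS
        by (subst distr_distr[OF T'm updX])
           (auto simp: comp_def space_pair_measure T'upd w1_def \<alpha>a simp del: fun_upd_apply intro!: distr_cong)
      also have "\<dots> = distr (distr (M \<Otimes>\<^sub>M ?LL) ?V (\<lambda>(z, q). (z, w1 (z, q))))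
          (hatsp (Suc n) TY) (\<lambda>p. (T (fst p))(Suc n := snd p))"
        by (subst distr_distr[OF g]) (auto simp: comp_def split_beta')
      also have "\<dots> = distr (M \<Otimes>\<^sub>M ?LL) (hatsp (Suc n) TY) (\<lambda>p. (T (fst p))(Suc n := w2 p))"
        unfolding fib by (subst distr_distr[OF g]) (auto simp: comp_def split_beta')
      \<comment> \<open>Since \<open>w2\<close> depends on \<open>z\<close> through
        \<open>T z\<close> alone, the source past can be pushed forward and the induction hypothesis
        applied.\<close>
      also have "\<dots> = distr (distr (M \<Otimes>\<^sub>M ?LL) (hatsp n TY \<Otimes>\<^sub>M ?LL) (\<lambda>(z, l). (T z, l))) (hatsp (Suc n) TY)
          (\<lambda>p. (fst p)(Suc n := (\<beta> (forget n (fst p), fst (snd p)), snd (snd p))))"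
        by (subst distr_distr[OF updY]) (auto simp: comp_def split_beta' w2_def \<beta>b)
      also have "distr (M \<Otimes>\<^sub>M ?LL) (hatsp n TY \<Otimes>\<^sub>M ?LL) (\<lambda>(z, l). (T z, l)) = distr M (hatsp n TY) T \<Otimes>\<^sub>M ?LL"
        by (rule distr_pair_left[symmetric]) (auto intro: LL.prob_space_axioms)
      also have "distr M (hatsp n TY) T = hatmeas n TY \<nu>n" unfolding M_def by (rule push)
      finally show ?thesis unfolding nuS .
    qed
    have law': "distr ?hX (Xsp (Suc n) TX \<Otimes>\<^sub>M Xsp (Suc n) TY)
        (\<lambda>z. (forget (Suc n) z, forget (Suc n) (T' z)))
      = distr \<pi> (Xsp (Suc n) TX \<Otimes>\<^sub>M Xsp (Suc n) TY) (\<lambda>p. (restrict (fst p) {1..Suc n}, restrict (snd p) {1..Suc n}))"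
    proof -
      let ?V = "hatsp n TX \<Otimes>\<^sub>M (?Z \<Otimes>\<^sub>M ?W)"
      let ?XY = "Xsp (Suc n) TX \<Otimes>\<^sub>M Xsp (Suc n) TY"
      define w1 where "w1 p = (a (hh (fst p), fst (snd p)), fst (K (hh (fst p), (a (hh (fst p), fst (snd p)), snd (snd p)))))" for p
      define w2 where "w2 p = (a (hh (fst p), fst (snd p)), c ((hh (fst p), a (hh (fst p), fst (snd p))), snd (snd p)))" for p
      have w[measurable]: "w1 \<in> M \<Otimes>\<^sub>M ?LL \<rightarrow>\<^sub>M ?Z \<Otimes>\<^sub>M ?W" "w2 \<in> M \<Otimes>\<^sub>M ?LL \<rightarrow>\<^sub>M ?Z \<Otimes>\<^sub>M ?W"
        unfolding w1_def w2_def by measurable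
      define g where "g p = ((fst (fst p))(Suc n := fst (snd p)), (snd (fst p))(Suc n := snd (snd p)))"
        for p :: "((nat \<Rightarrow> 'a) \<times> (nat \<Rightarrow> 'b)) \<times> ('a \<times> 'b)"
      have g[measurable]: "g \<in> ?H \<Otimes>\<^sub>M (?Z \<Otimes>\<^sub>M ?W) \<rightarrow>\<^sub>M ?XY"
        unfolding g_def by (intro measurable_Pair measurable_upd_Xsp) measurable
      \<comment> \<open>Here the new \<open>y\<close> is compared jointly with the new
        \<open>x\<close>: producing it by \<open>K\<close> gives the same law as sampling it by
        \<open>c\<close>.\<close>
      have fib: "distr (M \<Otimes>\<^sub>M ?LL) ?V (\<lambda>(z, q). (z, w1 (z, q)))
        = distr (M \<Otimes>\<^sub>M ?LL) ?V (\<lambda>(z, q). (z, w2 (z, q)))"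
      proof (rule distr_fiber_cong[OF LL.sigma_finite_measure_axioms LL.sigma_finite_measure_axioms w sM])
        show "AE z in M. distr ?LL (?Z \<Otimes>\<^sub>M ?W) (\<lambda>l. w1 (z, l)) = distr ?LL (?Z \<Otimes>\<^sub>M ?W) (\<lambda>l. w2 (z, l))"
          using AEgood AE_space
        proof eventually_elim
          case (elim z)
          then have "hh z \<in> space ?H" unfolding spM by (intro measurable_space[OF hh])
          from Kgood[OF this elim(1)] show ?case by (simp add: w1_def w2_def split_beta')
        qed
      qed
      have "distr ?hX ?XY
          (\<lambda>z. (forget (Suc n) z, forget (Suc n) (T' z))) = distr (M \<Otimes>\<^sub>M ?LL) ?XY (\<lambda>p. g (hh (fst p), w1 p))"
        unfolding muS
        by (subst distr_distr[OF _ updX])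
           (auto simp: comp_def space_pair_measure T'upd forget_upd w1_def \<alpha>a g_def hh_def[THEN arg_cong[of _ _ fst]] hh_def[THEN arg_cong[of _ _ snd]] simp del: fun_upd_apply intro!: distr_cong)
      also have "\<dots> = distr (distr (M \<Otimes>\<^sub>M ?LL) ?V (\<lambda>(z, q). (z, w1 (z, q)))) ?XY (\<lambda>p. g (hh (fst p), snd p))"
        by (subst distr_distr) (auto simp: comp_def split_beta')
      also have "\<dots> = distr (M \<Otimes>\<^sub>M ?LL) ?XY (\<lambda>p. g (hh (fst p), w2 p))"
        unfolding fib by (subst distr_distr) (auto simp: comp_def split_beta')
      also have "\<dots> = distr (distr (distr (M \<Otimes>\<^sub>M ?LL) (?H \<Otimes>\<^sub>M ?LL) (\<lambda>(z, l). (hh z, l))) (?H \<Otimes>\<^sub>M (?Z \<Otimes>\<^sub>M ?W))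
          (\<lambda>(h, q). (h, (a (h, fst q), c ((h, a (h, fst q)), snd q))))) ?XY g"
        by (simp add: distr_distr comp_def split_beta' w2_def)
      also have "distr (M \<Otimes>\<^sub>M ?LL) (?H \<Otimes>\<^sub>M ?LL) (\<lambda>(z, l). (hh z, l)) = distr M ?H hh \<Otimes>\<^sub>M ?LL"
        by (rule distr_pair_left[symmetric]) (auto intro: LL.prob_space_axioms)
      also have "distr (distr (distr M ?H hh \<Otimes>\<^sub>M ?LL) (?H \<Otimes>\<^sub>M (?Z \<Otimes>\<^sub>M ?W))
          (\<lambda>(h, q). (h, (a (h, fst q), c ((h, a (h, fst q)), snd q))))) ?XY g
        = distr (distr \<pi> (?H \<Otimes>\<^sub>M (?Z \<Otimes>\<^sub>M ?W)) (\<lambda>p. (?h p, (fst p (Suc n), snd p (Suc n))))) ?XY g"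
        unfolding hh2 joint ..
      also have "\<dots> = distr \<pi> ?XY (\<lambda>p. ((?rx (fst p))(Suc n := fst p (Suc n)), (?ry (snd p))(Suc n := snd p (Suc n))))"
        by (subst distr_distr) (auto simp: comp_def g_def)
      finally show ?thesis unfolding restrict_Suc_path .
    qed
    show ?case using bi push' law' by blast
  }
qed

theorem theorem3p5:
  fixes N :: nat
    and TX :: "nat \<Rightarrow> 'a topology" and TY :: "nat \<Rightarrow> 'b topology"
    and \<mu> :: "(nat \<Rightarrow> 'a) measure" and \<nu> :: "(nat \<Rightarrow> 'b) measure"
  assumes polX: "\<forall>t\<in>{1..N}. polish_top (TX t)"
    and polY: "\<forall>t\<in>{1..N}. polish_top (TY t)"
    and mu: "prob_space \<mu>" "sets \<mu> = sets (Xsp N TX)"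
    and nu: "prob_space \<nu>" "sets \<nu> = sets (Xsp N TY)"
  shows "(\<forall>\<pi>. \<pi> \<in> Cpl_bc N (\<lambda>t. borel_top (TX t)) (\<lambda>t. borel_top (TY t)) \<mu> \<nu> \<longrightarrow>
            (\<exists>T. biadapted N (hatsp N TX) (hatsp N TY) T \<and>
                 distr (hatmeas N TX \<mu>) (hatsp N TY) T = hatmeas N TY \<nu> \<and>
                 distr (distr (hatmeas N TX \<mu>) (hatsp N TX \<Otimes>\<^sub>M hatsp N TY) (\<lambda>a. (a, T a)))
                   (Xsp N TX \<Otimes>\<^sub>M Xsp N TY) (\<lambda>(a, b). (forget N a, forget N b)) = \<pi>))
       \<and>
         (\<forall>\<pi>. prob_space \<pi> \<and> sets \<pi> = sets (Xsp N TX \<Otimes>\<^sub>M Xsp N TY) \<and>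
            (\<exists>T. biadapted N (hatsp N TX) (hatsp N TY) T \<and>
                 distr (hatmeas N TX \<mu>) (hatsp N TY) T = hatmeas N TY \<nu> \<and>
                 distr (distr (hatmeas N TX \<mu>) (hatsp N TX \<Otimes>\<^sub>M hatsp N TY) (\<lambda>a. (a, T a)))
                   (Xsp N TX \<Otimes>\<^sub>M Xsp N TY) (\<lambda>(a, b). (forget N a, forget N b)) = \<pi>)
            \<longrightarrow> \<pi> \<in> Cpl_bc N (\<lambda>t. borel_top (TX t)) (\<lambda>t. borel_top (TY t)) \<mu> \<nu>)"
  (is "(\<forall>\<pi>. ?bc \<pi> \<longrightarrow> ?ex \<pi>) \<and> (\<forall>\<pi>. prob_space \<pi> \<and> _ \<pi> \<and> ?ex \<pi> \<longrightarrow> _ \<pi>)")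
proof (intro conjI allI impI)
  let ?BX = "\<lambda>t. borel_top (TX t)" and ?BY = "\<lambda>t. borel_top (TY t)" and ?X = "Xsp N TX" and ?Y = "Xsp N TY"
  \<comment> \<open>An empty space has no decoder; nonemptiness of each factor comes from the
    existence of a probability measure on the product.\<close>
  have std: "std_borel (borel_top (TT t))"
    if "prob_space \<rho>" "sets \<rho> = sets (Xsp N TT)" "\<forall>t\<in>{1..N}. polish_top (TT t)" "t \<in> {1..N}"
    for \<rho> :: "(nat \<Rightarrow> 'c) measure" and TT t
  proof (rule std_borel_polish)
    show "polish_top (TT t)" using that by blast
    have "space (Xsp N TT) \<noteq> {}"
      using prob_space.not_empty[OF that(1)] sets_eq_imp_space_eq[OF that(2)] by simp
    then show "topspace (TT t) \<noteq> {}"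
      using that(4) by (auto simp: space_Xsp PiE_eq_empty_iff borel_top_def space_measure_of_conv)
  qed
  have law: "distr (distr (hatmeas N TX \<mu>) (hatsp N TX \<Otimes>\<^sub>M hatsp N TY) (\<lambda>a. (a, T a)))
      (?X \<Otimes>\<^sub>M ?Y) (\<lambda>(a, b). (forget N a, forget N b))
    = distr (hatmeas N TX \<mu>) (?X \<Otimes>\<^sub>M ?Y) (\<lambda>a. (forget N a, forget N (T a)))"
    if [measurable]: "T \<in> hatsp N TX \<rightarrow>\<^sub>M hatsp N TY" for T
    by (simp add: distr_distr comp_def split_beta')
  {
    fix \<pi> assume bc: "?bc \<pi>"
    then have s\<pi>: "sets \<pi> = sets (?X \<Otimes>\<^sub>M ?Y)"
      by (simp add: Cpl_bc_def causal_def Cpl_def Xsp_def pathsp_def)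
    \<comment> \<open>At the final time the restrictions in the inductive statement are identities,
      because paths are extensional on \<open>{1..N}\<close>.\<close>
    have res: "x \<in> space (Xsp N TT) \<Longrightarrow> restrict x {1..N} = x" for x and TT :: "nat \<Rightarrow> 'c topology"
      by (rule extensional_restrict[OF extensional_space_Xsp])
    have id: "distr \<rho> (Xsp N TT) (\<lambda>x. restrict x {1..N}) = \<rho>" if "sets \<rho> = sets (Xsp N TT)"
      for \<rho> and TT :: "nat \<Rightarrow> 'c topology"
    proof -
      have "distr \<rho> (Xsp N TT) (\<lambda>x. restrict x {1..N}) = distr \<rho> (Xsp N TT) (\<lambda>x. x)"
        by (intro distr_cong refl res) (simp add: sets_eq_imp_space_eq[OF that])
      then show ?thesis using that by (simp add: distr_id2)
    qed
    have id\<pi>: "distr \<pi> (?X \<Otimes>\<^sub>M ?Y) (\<lambda>p. (restrict (fst p) {1..N}, restrict (snd p) {1..N})) = \<pi>"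
    proof -
      have "distr \<pi> (?X \<Otimes>\<^sub>M ?Y) (\<lambda>p. (restrict (fst p) {1..N}, restrict (snd p) {1..N})) = distr \<pi> (?X \<Otimes>\<^sub>M ?Y) (\<lambda>p. p)"
      proof (intro distr_cong refl)
        fix p assume "p \<in> space \<pi>"
        then have "fst p \<in> space ?X" "snd p \<in> space ?Y"
          unfolding sets_eq_imp_space_eq[OF s\<pi>] space_pair_measure by (simp_all add: mem_Times_iff)
        then show "(restrict (fst p) {1..N}, restrict (snd p) {1..N}) = p"
          by (simp add: extensional_restrict extensional_space_Xsp prod_eq_iff del: One_nat_def)
      qed
      then show ?thesis using s\<pi> by (simp add: distr_id2)
    qed
    obtain T where T: "biadapted N (hatsp N TX) (hatsp N TY) T"
      "distr (hatmeas N TX \<mu>) (hatsp N TY) T = hatmeas N TY \<nu>"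
      "distr (hatmeas N TX \<mu>) (?X \<Otimes>\<^sub>M ?Y) (\<lambda>a. (forget N a, forget N (T a))) = \<pi>"
      using bicausal_transport_map[OF std[OF mu polX] std[OF nu polY] mu nu bc order_refl]
      unfolding id[OF mu(2)] id[OF nu(2)] id\<pi> by blast
    then have "T \<in> hatsp N TX \<rightarrow>\<^sub>M hatsp N TY" by (simp add: biadapted_def adapted_def)
    then show "?ex \<pi>"
      using T law by auto
  next
    fix \<pi> assume "prob_space \<pi> \<and> sets \<pi> = sets (?X \<Otimes>\<^sub>M ?Y) \<and> ?ex \<pi>"
    then obtain T where T: "biadapted N (hatsp N TX) (hatsp N TY) T"
      and push: "distr (hatmeas N TX \<mu>) (hatsp N TY) T = hatmeas N TY \<nu>"
      and \<pi>: "distr (distr (hatmeas N TX \<mu>) (hatsp N TX \<Otimes>\<^sub>M hatsp N TY) (\<lambda>a. (a, T a)))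
          (?X \<Otimes>\<^sub>M ?Y) (\<lambda>(a, b). (forget N a, forget N b)) = \<pi>" by blast
    obtain S where S: "\<And>a. a \<in> space (hatsp N TX) \<Longrightarrow> S (T a) = a" "adapted N (hatsp N TY) (hatsp N TX) S"
      using T unfolding biadapted_def by blast
    have aT: "adapted N (hatsp N TX) (hatsp N TY) T" using T by (simp add: biadapted_def)
    have Tm[measurable]: "T \<in> hatsp N TX \<rightarrow>\<^sub>M hatsp N TY" and [measurable]: "S \<in> hatsp N TY \<rightarrow>\<^sub>M hatsp N TX"
      using aT S(2) by (auto simp: adapted_def)
    have sp: "space (hatmeas N TX \<mu>) = space (hatsp N TX)" by (rule sets_eq_imp_space_eq[OF sets_hatmeas])
    have \<pi>': "\<pi> = distr (hatmeas N TX \<mu>) (?X \<Otimes>\<^sub>M ?Y) (\<lambda>a. (forget N a, forget N (T a)))"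
      using \<pi> law[OF Tm] by simp
    have pushS: "distr (hatmeas N TY \<nu>) (hatsp N TX) S = hatmeas N TX \<mu>"
    proof -
      have "distr (hatmeas N TY \<nu>) (hatsp N TX) S = distr (hatmeas N TX \<mu>) (hatsp N TX) (\<lambda>a. a)"
        unfolding push[symmetric] by (subst distr_distr) (auto simp: S(1) sp intro!: distr_cong)
      then show ?thesis by (simp add: distr_id2 sets_hatmeas)
    qed
    \<comment> \<open>Substituting \<open>b = T a\<close> exhibits the swapped coupling as the one
      induced by \<open>S\<close> from the enlarged \<open>\<nu>\<close>, so the same criterion
      applies in reverse.\<close>
    have "distr \<pi> (?Y \<Otimes>\<^sub>M ?X) (\<lambda>(x, y). (y, x)) = distr (hatmeas N TX \<mu>) (?Y \<Otimes>\<^sub>M ?X) (\<lambda>a. (forget N (T a), forget N a))"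
      unfolding \<pi>' by (simp add: distr_distr comp_def split_beta')
    also have "\<dots> = distr (hatmeas N TY \<nu>) (?Y \<Otimes>\<^sub>M ?X) (\<lambda>b. (forget N b, forget N (S b)))"
      unfolding push[symmetric] by (subst distr_distr) (auto simp: S(1) sp intro!: distr_cong)
    finally have swap: "distr \<pi> (?Y \<Otimes>\<^sub>M ?X) (\<lambda>(x, y). (y, x)) = \<dots>" .
    have "causal N ?BX ?BY \<mu> \<nu> \<pi>"
      by (rule causal_of_adapted[OF mu nu(2) aT push \<pi>'])
    moreover have "causal N ?BY ?BX \<nu> \<mu> (distr \<pi> (?Y \<Otimes>\<^sub>M ?X) (\<lambda>(x, y). (y, x)))"
      by (rule causal_of_adapted[OF nu mu(2) S(2) pushS swap])
    ultimately show "?bc \<pi>"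
      unfolding Cpl_bc_def by (simp add: Xsp_def pathsp_def)
  }
qed

end
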